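(* Fix an integer $k\ge 1$. Let $\widetilde{S}^{/\!/}_N((k+1)\cdots 1)$ be the set of bounded affine permutations of size $N$ that avoid the decreasing pattern $(k+1)k\cdots 21$. Then, as $N\to\infty$, $$\left|\widetilde{S}^{/\!/}_N((k+1)\cdots 1)\right| \;\sim\; k^{2N}\left(\frac{N}{4\pi}\right)^{(k-1)/2}\frac{Z^*_k}{k^{k/2}\,(k-1)!},$$ where $$Z^*_k=\frac{1}{(k-1)!}\sum_{j=0}^{\lfloor k/2\rfloor}(-1)^j\binom{k}{j}(k-2j)^{k-1}.$$ Here $a_N\sim b_N$ means $\lim_{N\to\infty}a_N/b_N=1$.
   Context: An affine permutation of size $N$ is a bijection $\sigma:\mathbb{Z}\to\mathbb{Z}$ such that (i) $\sigma(i+N)=\sigma(i)+N$ for all $i\in\mathbb{Z}$, and (ii) $\sum_{i=1}^N\sigma(i)=\sum_{i=1}^N i$. It is bounded if $|\sigma(i)-i|<N$ for all $i\in\mathbb{Z}$. Such a $\sigma$ contains the pattern $(k+1)\cdots 1$ if there are integers $i_1<i_2<\cdots<i_{k+1}$ with $\sigma(i_1)>\sigma(i_2)>\cdots>\sigma(i_{k+1})$; otherwise it avoids it. All bijections $\mathbb Z\to\mathbb Z$ satisfying the conditions for the given $N$ are counted, even if they also satisfy (i) for a smaller period. (For $k=1$, $Z_1^*=1$.) *)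

theory Defs
  imports "HOL-Analysis.Analysis"
begin

definition affine_permutation :: "nat \<Rightarrow> (int \<Rightarrow> int) \<Rightarrow> bool" where
  "affine_permutation N \<sigma> \<longleftrightarrow>
     bij \<sigma> \<and>
     (\<forall>i. \<sigma> (i + int N) = \<sigma> i + int N) \<and>
     (\<Sum>i = 1..int N. \<sigma> i) = (\<Sum>i = 1..int N. i)"

definition bounded_affine_permutation :: "nat \<Rightarrow> (int \<Rightarrow> int) \<Rightarrow> bool" where
  "bounded_affine_permutation N \<sigma> \<longleftrightarrow>
     affine_permutation N \<sigma> \<and> (\<forall>i. \<bar>\<sigma> i - i\<bar> < int N)"

text \<open>Containment of the decreasing pattern \<open>m \<cdots> 2 1\<close> of length \<open>m\<close>; only the values
  of \<open>p\<close> on \<open>{1..m}\<close> matter.\<close>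

definition contains_decreasing :: "nat \<Rightarrow> (int \<Rightarrow> int) \<Rightarrow> bool" where
  "contains_decreasing m \<sigma> \<longleftrightarrow>
     (\<exists>p :: nat \<Rightarrow> int. \<forall>a\<in>{1..m}. \<forall>b\<in>{1..m}. a < b \<longrightarrow> p a < p b \<and> \<sigma> (p a) > \<sigma> (p b))"

definition bounded_avoiding_decreasing :: "nat \<Rightarrow> nat \<Rightarrow> (int \<Rightarrow> int) set" where
  "bounded_avoiding_decreasing N m =
     {\<sigma>. bounded_affine_permutation N \<sigma> \<and> \<not> contains_decreasing m \<sigma>}"

text \<open>For positive size this set is finite, so that its \<open>card\<close> is the genuine cardinality.
  (Size \<open>0\<close> is degenerate and irrelevant for the asymptotics.)\<close>

lemma finite_bounded_avoiding_decreasing: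
  assumes "N > 0"
  shows "finite (bounded_avoiding_decreasing N m)"
proof -
  let ?I = "{1..int N}"
  let ?r = "\<lambda>\<sigma> :: int \<Rightarrow> int. restrict \<sigma> ?I"
  have shift_nat: "\<sigma> (i + int k * int N) = \<sigma> i + int k * int N"
    if "\<And>i. \<sigma> (i + int N) = \<sigma> i + int N" for \<sigma> :: "int \<Rightarrow> int" and i k
  proof (induction k)
    case (Suc k)
    have "\<sigma> (i + int (Suc k) * int N) = \<sigma> ((i + int k * int N) + int N)"
      by (simp add: algebra_simps)
    also have "\<dots> = \<sigma> i + int (Suc k) * int N"
      using that[of "i + int k * int N"] Suc by (simp add: algebra_simps)
    finally show ?case .
  qed simp
  have shift: "\<sigma> (i + q * int N) = \<sigma> i + q * int N"
    if *: "\<And>i. \<sigma> (i + int N) = \<sigma> i + int N" for \<sigma> :: "int \<Rightarrow> int" and i q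
  proof (cases "q \<ge> 0")
    case True
    then show ?thesis using shift_nat[where \<sigma>=\<sigma>, OF *, of i "nat q"] by simp
  next
    case False
    then show ?thesis using shift_nat[where \<sigma>=\<sigma>, OF *, of "i + q * int N" "nat (- q)"] by simp
  qed
  have "inj_on ?r (bounded_avoiding_decreasing N m)"
  proof (rule inj_onI)
    fix \<sigma> \<tau>
    assume s: "\<sigma> \<in> bounded_avoiding_decreasing N m"
      and t: "\<tau> \<in> bounded_avoiding_decreasing N m" and eq: "?r \<sigma> = ?r \<tau>"
    have ps: "\<And>i. \<sigma> (i + int N) = \<sigma> i + int N" and pt: "\<And>i. \<tau> (i + int N) = \<tau> i + int N"
      using s t by (auto simp: bounded_avoiding_decreasing_def bounded_affine_permutation_def
          affine_permutation_def)
    show "\<sigma> = \<tau>"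
    proof
      fix i
      define j q where "j = (i - 1) mod int N + 1" and "q = (i - 1) div int N"
      have ij: "i = j + q * int N"
        unfolding j_def q_def by (simp add: algebra_simps)
      have "0 \<le> (i - 1) mod int N" "(i - 1) mod int N < int N"
        using assms by simp_all
      then have "j \<in> ?I"
        unfolding j_def atLeastAtMost_iff by linarith
      then have "\<sigma> j = \<tau> j" using fun_cong[OF eq, of j] by simp
      then show "\<sigma> i = \<tau> i" unfolding ij shift[where \<sigma>=\<sigma>, OF ps] shift[where \<sigma>=\<tau>, OF pt] by simp
    qed
  qed
  moreover have "?r ` bounded_avoiding_decreasing N m \<subseteq> (\<Pi>\<^sub>E i\<in>?I. {i - int N..i + int N})"
  proof
    fix f assume "f \<in> ?r ` bounded_avoiding_decreasing N m"
    then obtain \<sigma> where f: "f = ?r \<sigma>" and b: "\<And>i. \<bar>\<sigma> i - i\<bar> < int N"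
      by (auto simp: bounded_avoiding_decreasing_def bounded_affine_permutation_def)
    have "\<sigma> i \<in> {i - int N..i + int N}" for i
      using b[of i] by auto
    then show "f \<in> (\<Pi>\<^sub>E i\<in>?I. {i - int N..i + int N})"
      unfolding f restrict_PiE_iff by blast
  qed
  moreover have "finite (\<Pi>\<^sub>E i\<in>?I. {i - int N..i + int N})"
    by (intro finite_PiE) auto
  ultimately show ?thesis
    by (meson finite_imageD finite_subset)
qed

definition Z_star :: "nat \<Rightarrow> real" where
  "Z_star k = 1 / fact (k - 1) *
     (\<Sum>j = 0..k div 2. (-1) ^ j * real (k choose j) * (real k - 2 * real j) ^ (k - 1))"

end

(*
  A permutation avoiding (k+1)...1 splits into k increasing periodic chains, namely the
  classes of the greedy colouring of i by the length of the longest decreasing sequence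
  ending at i.  Such a coloured permutation is encoded by a word f in k letters (colours of
  the positions in a period), a word g of the same content (colours of the values) and an
  integer shift s c for each colour, saying by how many ranks chain c is moved; the sum
  condition becomes sum s = 0.  All but an exponentially small proportion of the words are
  balanced up to D = N^(2/3) in every prefix, and then chain c stays within O(D) of the line
  y = x + k * s c, so that boundedness amounts to |s c| <= N/k up to O(D).  If moreover the
  shifts are pairwise further apart than 12 D, then the permutation determines its colouring
  up to renaming of the colours.  Hence the number sought is asymptotically 1/k! times

    (number of pairs of words of length N in k letters with equal content)
      * (number of integer vectors s of length k with sum 0 and entries in [-N/k, N/k]).

  The first factor is found by induction on k from the asymptotics of the sum of the squared
  binomial probabilities (Parseval and Laplace's method); the second is a coefficient of
  ((1 - x^m)/(1 - x))^k and produces Z_star k.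
*)
theory Submission
  imports Defs "HOL-Probability.Probability" "HOL-Real_Asymp.Real_Asymp"
begin

section \<open>Coloured permutations and ranks\<close>

text \<open>The scale D = N^(2/3) is squeezed from both sides. It exceeds the fluctuation scale sqrt
  N: with Chernoff parameter N^(-1/2) the proportion of unbalanced words is at most a polynomial
  times exp(1 - N^(1/6)), which beats the polynomially small share of equal-content pairs among all
  pairs and the polynomial number of shift vectors. It is o(N): changing the box radius by O(D), or
  forbidding shifts closer than 12 D, changes the order N^(k-1) count of shift vectors only by a
  factor 1 + o(1).

  The constant 12: the shift of a chain is within 3 D of the displacement of each of its points
  divided by k. If chains are named by shifts, two colourings of one permutation give a position
  labels at most 6 D apart, so positions alike in one colouring have labels at most 12 D apart in
  the other.

  The obstacle is that a permutation may admit many colourings. The upper bound avoids it: one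
  colouring per permutation is chosen, which determines the permutation, and atypical cases are
  bounded crudely. Only the lower bound needs uniqueness, and only for balanced words with separated
  shifts.\<close>

definition prefix_count :: "(int \<Rightarrow> 'c) \<Rightarrow> 'c \<Rightarrow> int \<Rightarrow> int" where
  "prefix_count f c m = int (card {j \<in> {0..<m}. f j = c})"

text \<open>A signed count in the \<open>N\<close>-periodic extension of \<open>f\<close>: the
  number of \<open>c\<close> in \<open>[0, i)\<close> for nonnegative \<open>i\<close>, and minus
  the number in \<open>[i, 0)\<close> otherwise. Flooring \<open>div\<close> and \<open>mod\<close>
  give both cases by one formula, so ranks make sense on all integers.\<close>

definition colour_rank :: "nat \<Rightarrow> (int \<Rightarrow> 'c) \<Rightarrow> 'c \<Rightarrow> int \<Rightarrow> int" where
  "colour_rank N f c i = prefix_count f c (int N) * (i div int N) + prefix_count f c (i mod int N)"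

lemma prefix_count_0 [simp]: "prefix_count f c 0 = 0"
  by (simp add: prefix_count_def)

lemma prefix_count_nonneg: "0 \<le> prefix_count f c m"
  by (simp add: prefix_count_def)

lemma prefix_count_pos_iff: "prefix_count f c m > 0 \<longleftrightarrow> (\<exists>j\<in>{0..<m}. f j = c)"
proof -
  have "finite {j \<in> {0..<m}. f j = c}" by (rule finite_subset[of _ "{0..<m}"]) auto
  then show ?thesis unfolding prefix_count_def of_nat_0_less_iff card_gt_0_iff by blast
qed

lemma prefix_count_Suc:
  assumes "m \<ge> 0"
  shows "prefix_count f c (m + 1) = prefix_count f c m + (if f m = c then 1 else 0)"
proof -
  have "{j \<in> {0..<m+1}. f j = c} = (if f m = c then insert m {j \<in> {0..<m}. f j = c} else {j \<in> {0..<m}. f j = c})"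
    using assms by (auto simp: less_le)
  moreover have "finite {j \<in> {0..<m}. f j = c}" by (rule finite_subset[of _ "{0..<m}"]) auto
  moreover have "m \<notin> {j \<in> {0..<m}. f j = c}" by simp
  ultimately show ?thesis unfolding prefix_count_def
    by (cases "f m = c") (simp_all only: simp_thms if_True if_False card_insert_disjoint of_nat_Suc add_0_right add.commute)
qed

context
  fixes N :: nat
  assumes N_pos: "N > 0"
begin

lemma colour_rank_Suc: "colour_rank N f c (i + 1) = colour_rank N f c i + (if f (i mod int N) = c then 1 else 0)"
proof (cases "i mod int N + 1 = int N")
  case True
  have e: "i + 1 = int N * (i div int N + 1)"
    using True by (metis add.assoc distrib_left mult.right_neutral mult_div_mod_eq)
  have "(i + 1) div int N = i div int N + 1" "(i + 1) mod int N = 0"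
    unfolding e using N_pos by auto
  moreover have "prefix_count f c (int N) = prefix_count f c (i mod int N) + (if f (i mod int N) = c then 1 else 0)"
    using prefix_count_Suc[of "i mod int N" f c] N_pos unfolding True by simp
  ultimately show ?thesis by (simp add: colour_rank_def algebra_simps)
next
  case False
  have b: "0 \<le> i mod int N" "i mod int N < int N" using N_pos by simp_all
  then have l: "i mod int N + 1 < int N" "0 \<le> i mod int N + 1" using False by linarith+
  have e: "i + 1 = int N * (i div int N) + (i mod int N + 1)" by (simp add: algebra_simps)
  have "(i + 1) div int N = i div int N" "(i + 1) mod int N = i mod int N + 1"
    using int_div_pos_eq[OF e l(2,1)] int_mod_pos_eq[OF e l(2,1)] by simp_all
  then show ?thesis using prefix_count_Suc[of "i mod int N" f c] b by (simp add: colour_rank_def)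
qed

lemma colour_rank_shift: "colour_rank N f c (i + int N) = colour_rank N f c i + prefix_count f c (int N)"
  using N_pos by (simp add: colour_rank_def algebra_simps)

lemma colour_rank_diff:
  assumes "i \<le> j"
  shows "colour_rank N f c j - colour_rank N f c i = int (card {t \<in> {i..<j}. f (t mod int N) = c})"
  using assms
proof (induction j rule: int_ge_induct)
  case base
  then show ?case by simp
next
  case (step j)
  have "{t \<in> {i..<j+1}. f (t mod int N) = c} = (if f (j mod int N) = c then insert j {t \<in> {i..<j}. f (t mod int N) = c} else {t \<in> {i..<j}. f (t mod int N) = c})"
    using step.hyps by (auto simp: less_le)
  moreover have "finite {t \<in> {i..<j}. f (t mod int N) = c}" by (rule finite_subset[of _ "{i..<j}"]) auto
  moreover have "j \<notin> {t \<in> {i..<j}. f (t mod int N) = c}" by simp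
  ultimately have "int (card {t \<in> {i..<j+1}. f (t mod int N) = c})
      = int (card {t \<in> {i..<j}. f (t mod int N) = c}) + (if f (j mod int N) = c then 1 else 0)"
    by (cases "f (j mod int N) = c") (simp_all only: simp_thms if_True if_False card_insert_disjoint of_nat_Suc add_0_right add.commute)
  then show ?case using step.IH colour_rank_Suc[of f c j] by linarith
qed

lemma colour_rank_mono: "i \<le> j \<Longrightarrow> colour_rank N f c i \<le> colour_rank N f c j"
  using colour_rank_diff[of i j f c] by linarith

lemma colour_rank_strict:
  assumes "i < j" "f (i mod int N) = c"
  shows "colour_rank N f c i < colour_rank N f c j"
  using colour_rank_Suc[of f c i] colour_rank_mono[of "i+1" j f c] assms by auto

lemma colour_rank_inj:
  assumes "f (i mod int N) = c" "f (j mod int N) = c" "colour_rank N f c i = colour_rank N f c j"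
  shows "i = j"
  using colour_rank_strict[of i j f c] colour_rank_strict[of j i f c] assms by (metis less_irrefl linorder_less_linear)

lemma colour_rank_less_iff:
  assumes "f (i mod int N) = c" "f (j mod int N) = c"
  shows "colour_rank N f c i < colour_rank N f c j \<longleftrightarrow> i < j"
  using colour_rank_strict[of i j f c] colour_rank_mono[of j i f c] assms by (meson not_le)

text \<open>Ranks increase strictly along a class, so the map is injective into an interval with as
  many elements as the class; counting then gives surjectivity.\<close>

lemma bij_betw_prefix_count:
  "bij_betw (prefix_count f c) {j \<in> {0..<int N}. f j = c} {0..<prefix_count f c (int N)}"
proof -
  let ?K = "{j \<in> {0..<int N}. f j = c}"
  have rk: "prefix_count f c j = colour_rank N f c j" if "j \<in> ?K" for j
    using that by (simp add: colour_rank_def)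
  have inj: "inj_on (prefix_count f c) ?K"
  proof (rule inj_onI)
    fix x y assume h: "x \<in> ?K" "y \<in> ?K" "prefix_count f c x = prefix_count f c y"
    show "x = y" by (rule colour_rank_inj[of f x c y]) (use h rk[OF h(1)] rk[OF h(2)] in auto)
  qed
  have sub: "prefix_count f c ` ?K \<subseteq> {0..<prefix_count f c (int N)}"
  proof
    fix r assume "r \<in> prefix_count f c ` ?K"
    then obtain j where j: "j \<in> ?K" "r = prefix_count f c j" by auto
    have "colour_rank N f c j < colour_rank N f c (int N)" by (rule colour_rank_strict) (use j in auto)
    moreover have "colour_rank N f c (int N) = prefix_count f c (int N)" using N_pos by (simp add: colour_rank_def)
    ultimately show "r \<in> {0..<prefix_count f c (int N)}"
      using j(2) rk[OF j(1)] prefix_count_nonneg[of f c j] by simp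
  qed
  have "card (prefix_count f c ` ?K) = card ?K" by (rule card_image[OF inj])
  moreover have "card {0..<prefix_count f c (int N)} = card ?K" by (simp add: prefix_count_def)
  ultimately have "prefix_count f c ` ?K = {0..<prefix_count f c (int N)}"
    by (intro card_subset_eq sub) auto
  with inj show ?thesis by (simp add: bij_betw_def)
qed

text \<open>With \<open>n\<close> elements of colour \<open>c\<close> per period,
  \<open>r div n\<close> selects the period and \<open>r mod n\<close> the element inside
  it.\<close>

lemma colour_rank_surj:
  assumes "prefix_count f c (int N) > 0"
  shows "\<exists>i. f (i mod int N) = c \<and> colour_rank N f c i = r"
proof -
  let ?n = "prefix_count f c (int N)"
  have "r mod ?n \<in> {0..<?n}" using assms by simp
  then have "r mod ?n \<in> prefix_count f c ` {j \<in> {0..<int N}. f j = c}"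
    using bij_betw_imp_surj_on[OF bij_betw_prefix_count[of f c]] by simp
  then obtain j where j: "j \<in> {0..<int N}" "f j = c" "prefix_count f c j = r mod ?n"
    by auto
  let ?i = "j + int N * (r div ?n)"
  have "?i mod int N = j" "?i div int N = r div ?n" using j(1) by auto
  then show ?thesis using j by (intro exI[of _ ?i]) (simp add: colour_rank_def)
qed

text \<open>\<open>f\<close> colours the positions and \<open>g\<close> the values; on colour \<open>c\<close>, the map \<open>\<sigma>\<close> sends the
  position of rank \<open>r\<close> to the value of rank \<open>r + s c\<close>.\<close>

definition coloured_by :: "(int \<Rightarrow> int) \<Rightarrow> (int \<Rightarrow> 'c) \<Rightarrow> (int \<Rightarrow> 'c) \<Rightarrow> ('c \<Rightarrow> int) \<Rightarrow> bool" where
  "coloured_by \<sigma> f g s \<longleftrightarrow> (\<forall>i. g (\<sigma> i mod int N) = f (i mod int N) \<and>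
     colour_rank N g (f (i mod int N)) (\<sigma> i) = colour_rank N f (f (i mod int N)) i + s (f (i mod int N)))"

lemma coloured_by_unique:
  assumes "coloured_by \<sigma> f g s" "coloured_by \<tau> f g s"
  shows "\<sigma> = \<tau>"
proof
  fix i show "\<sigma> i = \<tau> i"
  proof (rule colour_rank_inj)
    show "g (\<sigma> i mod int N) = f (i mod int N)" "g (\<tau> i mod int N) = f (i mod int N)"
      using assms by (simp_all add: coloured_by_def)
    show "colour_rank N g (f (i mod int N)) (\<sigma> i) = colour_rank N g (f (i mod int N)) (\<tau> i)"
      using assms by (simp add: coloured_by_def)
  qed
qed

lemma coloured_by_mono:
  assumes "coloured_by \<sigma> f g s" "f (i mod int N) = f (j mod int N)" "i < j"
  shows "\<sigma> i < \<sigma> j"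
proof -
  let ?c = "f (i mod int N)"
  have "colour_rank N f ?c i < colour_rank N f ?c j" using assms by (intro colour_rank_strict) auto
  then have "colour_rank N g ?c (\<sigma> i) < colour_rank N g ?c (\<sigma> j)"
    using assms unfolding coloured_by_def by (metis add_less_cancel_right)
  then show ?thesis
    using assms unfolding coloured_by_def by (subst (asm) colour_rank_less_iff) auto
qed

text \<open>By pigeonhole two of the \<open>k + 1\<close> entries of a decreasing pattern would
  share a colour, along which \<open>\<sigma>\<close> increases.\<close>

lemma not_contains_decreasing_coloured:
  assumes mono: "\<And>i j. f (i mod int N) = f (j mod int N) \<Longrightarrow> i < j \<Longrightarrow> \<sigma> i < \<sigma> j"
    and range: "\<And>i. f (i mod int N) \<in> C" and C: "finite C" "card C = k"
  shows "\<not> contains_decreasing (k + 1) \<sigma>"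
proof
  assume "contains_decreasing (k + 1) \<sigma>"
  then obtain p :: "nat \<Rightarrow> int" where
    p: "\<And>a b. a \<in> {1..k+1} \<Longrightarrow> b \<in> {1..k+1} \<Longrightarrow> a < b \<Longrightarrow> p a < p b \<and> \<sigma> (p a) > \<sigma> (p b)"
    unfolding contains_decreasing_def by blast
  let ?h = "\<lambda>a. f (p a mod int N)"
  have "?h ` {1..k+1} \<subseteq> C" using range by auto
  then have "card (?h ` {1..k+1}) \<le> k" using C card_mono by metis
  then have "\<not> inj_on ?h {1..k+1}" by (intro pigeonhole) auto
  then obtain a b where ab: "a \<in> {1..k+1}" "b \<in> {1..k+1}" "?h a = ?h b" "a < b"
    unfolding inj_on_def by (metis linorder_less_linear)
  with p[of a b] mono[of "p a" "p b"] show False by auto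
qed

section \<open>The sum condition expressed by shifts\<close>

lemma periodic_shift:
  assumes "\<And>i. \<sigma> (i + int N) = \<sigma> i + int N"
  shows "\<sigma> (i + q * int N) = \<sigma> i + q * int N"
proof (induction q rule: int_induct[of _ 0])
  case base
  then show ?case by simp
next
  case (step1 q)
  then show ?case using assms[of "i + q * int N"] by (simp add: algebra_simps)
next
  case (step2 q)
  then show ?case using assms[of "i + (q - 1) * int N"] by (simp add: algebra_simps)
qed

lemma bij_betw_periodic_mod:
  assumes "bij \<sigma>" and per: "\<And>i. \<sigma> (i + int N) = \<sigma> i + int N"
  shows "bij_betw (\<lambda>i. \<sigma> i mod int N) {0..<int N} {0..<int N}"
proof -
  have "inj_on (\<lambda>i. \<sigma> i mod int N) {0..<int N}"
  proof (rule inj_onI)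
    fix x y assume x: "x \<in> {0..<int N}" and y: "y \<in> {0..<int N}" and e: "\<sigma> x mod int N = \<sigma> y mod int N"
    define q where "q = \<sigma> x div int N - \<sigma> y div int N"
    have "\<sigma> x = \<sigma> x div int N * int N + \<sigma> x mod int N" "\<sigma> y = \<sigma> y div int N * int N + \<sigma> y mod int N"
      by (simp_all only: div_mult_mod_eq)
    then have "\<sigma> x = \<sigma> y + q * int N" using e unfolding q_def left_diff_distrib by linarith
    also have "\<dots> = \<sigma> (y + q * int N)" by (rule periodic_shift[symmetric]) (rule per)
    finally have "x = y + q * int N" using assms(1) by (meson bij_is_inj injD)
    then have "x mod int N = y mod int N" by simp
    then show "x = y" using x y by simp
  qed
  moreover have "(\<lambda>i. \<sigma> i mod int N) ` {0..<int N} \<subseteq> {0..<int N}" using N_pos by auto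
  ultimately show ?thesis by (simp add: bij_betw_def endo_inj_surj)
qed

lemma sum_periodic_window:
  fixes d :: "int \<Rightarrow> int"
  assumes "\<And>i. d (i + int N) = d i"
  shows "(\<Sum>i = 1..int N. d i) = (\<Sum>i\<in>{0..<int N}. d i)"
proof -
  have "{1..int N} = insert (int N) {1..<int N}" "{0..<int N} = insert 0 {1..<int N}" using N_pos by auto
  then show ?thesis using assms[of 0] by simp
qed

text \<open>The residues of \<open>\<sigma>\<close> on a window are a permutation of the window, so
  they cancel against the sum of the positions and only \<open>N\<close> times the sum of the
  quotients remains.\<close>

lemma affine_sum_iff:
  assumes "bij \<sigma>" and per: "\<And>i. \<sigma> (i + int N) = \<sigma> i + int N"
  shows "(\<Sum>i = 1..int N. \<sigma> i) = (\<Sum>i = 1..int N. i) \<longleftrightarrow> (\<Sum>i\<in>{0..<int N}. \<sigma> i div int N) = 0"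
proof -
  have "(\<Sum>i = 1..int N. \<sigma> i) - (\<Sum>i = 1..int N. i) = (\<Sum>i = 1..int N. \<sigma> i - i)"
    by (simp add: sum_subtractf)
  also have "\<dots> = (\<Sum>i\<in>{0..<int N}. \<sigma> i - i)"
    by (rule sum_periodic_window) (simp add: per)
  also have "\<dots> = (\<Sum>i\<in>{0..<int N}. int N * (\<sigma> i div int N) + \<sigma> i mod int N) - (\<Sum>i\<in>{0..<int N}. i)"
    by (simp add: sum_subtractf)
  also have "\<dots> = int N * (\<Sum>i\<in>{0..<int N}. \<sigma> i div int N) + (\<Sum>i\<in>{0..<int N}. \<sigma> i mod int N) - (\<Sum>i\<in>{0..<int N}. i)"
    by (simp only: sum.distrib sum_distrib_left)
  also have "(\<Sum>i\<in>{0..<int N}. \<sigma> i mod int N) = (\<Sum>i\<in>{0..<int N}. i)"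
    using sum.reindex_bij_betw[OF bij_betw_periodic_mod[OF assms], of "\<lambda>i. i"] by simp
  finally show ?thesis using N_pos by auto
qed

lemma bij_betw_colour_class:
  assumes "bij \<sigma>" and per: "\<And>i. \<sigma> (i + int N) = \<sigma> i + int N"
    and col: "\<And>i. g (\<sigma> i mod int N) = f (i mod int N)"
  shows "bij_betw (\<lambda>i. \<sigma> i mod int N) {j \<in> {0..<int N}. f j = c} {j \<in> {0..<int N}. g j = c}"
proof -
  let ?h = "\<lambda>i. \<sigma> i mod int N"
  have b: "bij_betw ?h {0..<int N} {0..<int N}" by (rule bij_betw_periodic_mod[OF assms(1,2)])
  have gf: "g (?h i) = f i" if "i \<in> {0..<int N}" for i using col[of i] that by simp
  then have "?h ` {j \<in> {0..<int N}. f j = c} = {j \<in> {0..<int N}. g j = c}"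
  proof (intro equalityI subsetI)
    fix y assume y: "y \<in> {j \<in> {0..<int N}. g j = c}"
    then obtain i where "i \<in> {0..<int N}" "y = ?h i"
      using bij_betw_imp_surj_on[OF b] by blast
    then show "y \<in> ?h ` {j \<in> {0..<int N}. f j = c}" using y gf by auto
  qed (use bij_betw_imp_surj_on[OF b] gf in auto)
  then show ?thesis using b by (intro bij_betw_subset[OF b]) auto
qed

lemma prefix_count_eq_of_coloured:
  assumes "bij \<sigma>" "\<And>i. \<sigma> (i + int N) = \<sigma> i + int N"
    and "\<And>i. g (\<sigma> i mod int N) = f (i mod int N)"
  shows "prefix_count g c (int N) = prefix_count f c (int N)"
  using bij_betw_same_card[OF bij_betw_colour_class[of \<sigma> g f c, OF assms]] by (simp add: prefix_count_def)

lemma sum_prefix_count_class: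
  "(\<Sum>j | j \<in> {0..<int N} \<and> f j = c. prefix_count f c j) = (\<Sum>t\<in>{0..<prefix_count f c (int N)}. t)"
  using sum.reindex_bij_betw[OF bij_betw_prefix_count[of f c], of "\<lambda>t. t"] by simp

text \<open>Sum the rank equation over the positions of colour \<open>c\<close> in one window. The
  ranks inside a period run through the same interval on both sides, so they cancel and a factor
  equal to the class size is left. The formula depends on the class of positions alone, which later
  makes the shift recoverable from the partition into chains.\<close>

lemma shift_eq_sum:
  assumes "bij \<sigma>" "\<And>i. \<sigma> (i + int N) = \<sigma> i + int N" and com: "coloured_by \<sigma> f g s"
    and pos: "prefix_count f c (int N) > 0"
  shows "s c = (\<Sum>i | i \<in> {0..<int N} \<and> f i = c. \<sigma> i div int N)"
proof -
  let ?K = "{i. i \<in> {0..<int N} \<and> f i = c}"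
  let ?n = "prefix_count f c (int N)"
  have col: "\<And>i. g (\<sigma> i mod int N) = f (i mod int N)" using com by (simp add: coloured_by_def)
  have n: "prefix_count g c (int N) = ?n" by (rule prefix_count_eq_of_coloured[of \<sigma> g f, OF assms(1,2) col])
  have K: "int (card ?K) = ?n" by (simp add: prefix_count_def)
  have "colour_rank N g c (\<sigma> i) = prefix_count f c i + s c" if "i \<in> ?K" for i
  proof -
    have "f (i mod int N) = c" "colour_rank N f c i = prefix_count f c i" using that by (auto simp: colour_rank_def)
    then show ?thesis using com unfolding coloured_by_def by metis
  qed
  then have "(\<Sum>i\<in>?K. ?n * (\<sigma> i div int N) + prefix_count g c (\<sigma> i mod int N)) = (\<Sum>i\<in>?K. prefix_count f c i + s c)"
    by (intro sum.cong) (auto simp: colour_rank_def n)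
  then have "?n * (\<Sum>i\<in>?K. \<sigma> i div int N) + (\<Sum>i\<in>?K. prefix_count g c (\<sigma> i mod int N))
      = (\<Sum>i\<in>?K. prefix_count f c i) + ?n * s c"
    by (simp add: sum.distrib sum_distrib_left K[symmetric])
  moreover have "(\<Sum>i\<in>?K. prefix_count g c (\<sigma> i mod int N)) = (\<Sum>j | j \<in> {0..<int N} \<and> g j = c. prefix_count g c j)"
    using sum.reindex_bij_betw[OF bij_betw_colour_class[of \<sigma> g f c, OF assms(1,2) col], of "prefix_count g c"] by simp
  ultimately have "?n * (\<Sum>i\<in>?K. \<sigma> i div int N) = ?n * s c"
    using sum_prefix_count_class[of f c] sum_prefix_count_class[of g c] n by simp
  then show ?thesis using pos by simp
qed

text \<open>Adding \<open>shift_eq_sum\<close> over all colours gives the sum of quotients in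
  \<open>affine_sum_iff\<close>. A colour that does not occur has no chain to determine its shift,
  so its entry has to be fixed as 0.\<close>

lemma affine_of_coloured:
  assumes "bij \<sigma>" "\<And>i. \<sigma> (i + int N) = \<sigma> i + int N" and com: "coloured_by \<sigma> f g s"
    and C: "finite C" "\<And>i. f (i mod int N) \<in> C" and pos: "\<And>c. c \<in> C \<Longrightarrow> prefix_count f c (int N) > 0 \<or> s c = 0"
  shows "affine_permutation N \<sigma> \<longleftrightarrow> sum s C = 0"
proof -
  have fC: "f i \<in> C" if "i \<in> {0..<int N}" for i using C(2)[of i] that by simp
  have "sum s C = (\<Sum>c\<in>C. \<Sum>i | i \<in> {0..<int N} \<and> f i = c. \<sigma> i div int N)"
  proof (rule sum.cong[OF refl])
    fix c assume c: "c \<in> C"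
    show "s c = (\<Sum>i | i \<in> {0..<int N} \<and> f i = c. \<sigma> i div int N)"
    proof (cases "prefix_count f c (int N) > 0")
      case True then show ?thesis using shift_eq_sum[OF assms(1-3)] by simp
    next
      case False
      then have e: "{i. i \<in> {0..<int N} \<and> f i = c} = {}" using prefix_count_pos_iff[of f c "int N"] by auto
      show ?thesis using pos[OF c] False unfolding e by simp
    qed
  qed
  also have "\<dots> = (\<Sum>i\<in>{0..<int N}. \<sigma> i div int N)"
    by (rule sum.group) (use C fC in auto)
  finally show ?thesis
    using affine_sum_iff[OF assms(1,2)] assms(1,2) by (auto simp: affine_permutation_def)
qed

text \<open>Each position is sent to the unique value of its colour with the prescribed rank. Equal
  class sizes make both ranks advance by the same amount over a period, whence periodicity;
  prescribing the rank of the position instead gives surjectivity.\<close>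

lemma coloured_by_exists:
  assumes cnt: "\<And>c. prefix_count f c (int N) = prefix_count g c (int N)"
  shows "\<exists>\<sigma>. coloured_by \<sigma> f g s \<and> bij \<sigma> \<and> (\<forall>i. \<sigma> (i + int N) = \<sigma> i + int N)"
proof -
  have posf: "prefix_count f (f (i mod int N)) (int N) > 0" for f :: "int \<Rightarrow> 'a" and i
  proof -
    have "i mod int N \<in> {0..<int N}" using N_pos by simp
    then show ?thesis unfolding prefix_count_pos_iff by blast
  qed
  have "\<exists>y. g (y mod int N) = f (i mod int N) \<and>
     colour_rank N g (f (i mod int N)) y = colour_rank N f (f (i mod int N)) i + s (f (i mod int N))" for i
    by (rule colour_rank_surj) (use posf[of f i] cnt in simp)
  then obtain \<sigma> where \<sigma>: "\<And>i. g (\<sigma> i mod int N) = f (i mod int N) \<and>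
     colour_rank N g (f (i mod int N)) (\<sigma> i) = colour_rank N f (f (i mod int N)) i + s (f (i mod int N))"
    by metis
  then have com: "coloured_by \<sigma> f g s" by (simp add: coloured_by_def)
  have per: "\<sigma> (i + int N) = \<sigma> i + int N" for i
  proof (rule colour_rank_inj[of g _ "f (i mod int N)"])
    show "colour_rank N g (f (i mod int N)) (\<sigma> (i + int N)) = colour_rank N g (f (i mod int N)) (\<sigma> i + int N)"
      using \<sigma>[of "i + int N"] \<sigma>[of i] by (simp add: colour_rank_shift cnt)
  qed (use \<sigma>[of "i + int N"] \<sigma>[of i] in simp_all)
  have "inj \<sigma>"
  proof (rule injI)
    fix i j assume e: "\<sigma> i = \<sigma> j"
    show "i = j"
      by (rule colour_rank_inj[of f _ "f (i mod int N)"]) (use \<sigma>[of i] \<sigma>[of j] e in simp_all)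
  qed
  moreover have "surj \<sigma>"
    unfolding surj_def
  proof
    fix y
    let ?c = "g (y mod int N)"
    obtain i where i: "f (i mod int N) = ?c" "colour_rank N f ?c i = colour_rank N g ?c y - s ?c"
      using colour_rank_surj[of f ?c "colour_rank N g ?c y - s ?c"] posf[of g y] cnt by auto
    have "\<sigma> i = y"
      by (rule colour_rank_inj[of g _ ?c]) (use \<sigma>[of i] i in simp_all)
    then show "\<exists>x. y = \<sigma> x" by blast
  qed
  ultimately show ?thesis using com per by (auto simp: bij_def)
qed

text \<open>On a class, \<open>\<sigma>\<close> is an increasing bijection onto the values of that
  colour, so it preserves the number of class members between two points. Hence the rank of the
  value minus the rank of the position is constant on the class, and \<open>shift_eq_sum\<close>
  identifies this constant with \<open>s c\<close>.\<close>

lemma coloured_by_of_increasing: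
  assumes aff: "affine_permutation N \<sigma>" 
    and mono: "\<And>i j. f (i mod int N) = f (j mod int N) \<Longrightarrow> i < j \<Longrightarrow> \<sigma> i < \<sigma> j"
    and g: "\<And>y. y \<in> {0..<int N} \<Longrightarrow> g y = f (inv \<sigma> y mod int N)"
    and s: "\<And>c. c \<in> f ` {0..<int N} \<Longrightarrow> s c = (\<Sum>i | i \<in> {0..<int N} \<and> f i = c. \<sigma> i div int N)"
  shows "coloured_by \<sigma> f g s"
proof -
  have bij: "bij \<sigma>" and per: "\<And>i. \<sigma> (i + int N) = \<sigma> i + int N"
    using aff by (auto simp: affine_permutation_def)
  have col: "g (\<sigma> i mod int N) = f (i mod int N)" for i
  proof -
    have "\<sigma> (i + - (\<sigma> i div int N) * int N) = \<sigma> i + - (\<sigma> i div int N) * int N"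
      by (rule periodic_shift) (rule per)
    also have "\<dots> = \<sigma> i mod int N" by (simp add: minus_div_mult_eq_mod)
    finally have "inv \<sigma> (\<sigma> i mod int N) = i + - (\<sigma> i div int N) * int N"
      using bij by (metis bij_is_inj inv_f_f)
    then have "inv \<sigma> (\<sigma> i mod int N) mod int N = i mod int N" by (metis mod_mult_self1)
    then show ?thesis using g[of "\<sigma> i mod int N"] N_pos by simp
  qed
  have diff: "colour_rank N g c (\<sigma> i) - colour_rank N f c i = colour_rank N g c (\<sigma> j) - colour_rank N f c j"
    if ij: "f (i mod int N) = c" "f (j mod int N) = c" "i < j" for i j c
  proof -
    have lt: "\<sigma> i < \<sigma> j" using mono ij by simp
    have monoiff: "\<sigma> x < \<sigma> y \<longleftrightarrow> x < y" if "f (x mod int N) = c" "f (y mod int N) = c" for x y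
      using mono[of x y] mono[of y x] that by (metis less_asym' linorder_less_linear)
    have "\<sigma> ` {t \<in> {i..<j}. f (t mod int N) = c} = {t \<in> {\<sigma> i..<\<sigma> j}. g (t mod int N) = c}"
    proof (intro equalityI subsetI)
      fix y assume "y \<in> \<sigma> ` {t \<in> {i..<j}. f (t mod int N) = c}"
      then obtain t where t: "y = \<sigma> t" "i \<le> t" "t < j" "f (t mod int N) = c" by auto
      then show "y \<in> {t \<in> {\<sigma> i..<\<sigma> j}. g (t mod int N) = c}"
        using monoiff[of t j] monoiff[of t i] ij col by (auto simp: not_less[symmetric])
    next
      fix y assume y: "y \<in> {t \<in> {\<sigma> i..<\<sigma> j}. g (t mod int N) = c}"
      obtain t where t: "y = \<sigma> t" using bij by (metis bij_pointE)
      then have "f (t mod int N) = c" using y col by simp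
      then show "y \<in> \<sigma> ` {t \<in> {i..<j}. f (t mod int N) = c}"
        using monoiff[of t j] monoiff[of t i] ij y t by (auto simp: not_less[symmetric])
    qed
    moreover have "inj_on \<sigma> {t \<in> {i..<j}. f (t mod int N) = c}"
      using bij by (meson bij_is_inj inj_on_subset subset_UNIV)
    ultimately have "card {t \<in> {\<sigma> i..<\<sigma> j}. g (t mod int N) = c} = card {t \<in> {i..<j}. f (t mod int N) = c}"
      by (simp only: card_image flip: \<open>_ = {t \<in> {\<sigma> i..<\<sigma> j}. g (t mod int N) = c}\<close>)
    then show ?thesis using colour_rank_diff[of i j f c] colour_rank_diff[of "\<sigma> i" "\<sigma> j" g c] lt ij by simp
  qed
  \<comment> \<open>The shift is read off at one chosen representative of the class; by
    \<open>diff\<close> every other representative gives the same number.\<close>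
  define s' where "s' c = (let i = SOME i. f (i mod int N) = c in colour_rank N g c (\<sigma> i) - colour_rank N f c i)" for c
  have "colour_rank N g (f (i mod int N)) (\<sigma> i) = colour_rank N f (f (i mod int N)) i + s' (f (i mod int N))" for i
  proof -
    let ?c = "f (i mod int N)"
    define j where "j = (SOME j. f (j mod int N) = ?c)"
    have j: "f (j mod int N) = ?c" unfolding j_def by (rule someI[of _ i]) simp
    have "colour_rank N g ?c (\<sigma> i) - colour_rank N f ?c i = colour_rank N g ?c (\<sigma> j) - colour_rank N f ?c j"
      using diff[OF refl j] diff[OF j refl] by (cases i j rule: linorder_cases) auto
    then show ?thesis unfolding s'_def Let_def j_def[symmetric] by linarith
  qed
  then have com: "coloured_by \<sigma> f g s'" using col by (simp add: coloured_by_def)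
  have "s' c = s c" if "c \<in> f ` {0..<int N}" for c
  proof -
    have "prefix_count f c (int N) > 0" using that unfolding prefix_count_pos_iff by blast
    from shift_eq_sum[OF bij per com this] s[OF that] show ?thesis by simp
  qed
  then show ?thesis using com N_pos unfolding coloured_by_def by simp
qed

text \<open>Along an inversion \<open>i < j\<close>, \<open>\<sigma> i > \<sigma> j\<close>, a
  longest decreasing sequence ending at \<open>i\<close> extends by \<open>j\<close>, so the length
  \<open>h\<close> strictly increases; positions with equal \<open>h\<close> are therefore in
  increasing order. Translating sequences by multiples of \<open>N\<close> makes \<open>h\<close>
  periodic, so it descends to one window, and avoidance caps it at \<open>k\<close>.\<close>

lemma increasing_colouring_exists:
  assumes "inj \<sigma>" and av: "\<not> contains_decreasing (k + 1) \<sigma>" and per: "\<And>i. \<sigma> (i + int N) = \<sigma> i + int N"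
  shows "\<exists>f \<in> {0..<int N} \<rightarrow>\<^sub>E {1..int k}. \<forall>i j. f (i mod int N) = f (j mod int N) \<longrightarrow> i < j \<longrightarrow> \<sigma> i < \<sigma> j"
proof -
  define dec where "dec p m \<longleftrightarrow> (\<forall>a\<in>{1..m}. \<forall>b\<in>{1..m}. a < b \<longrightarrow> p a < p b \<and> \<sigma> (p a) > \<sigma> (p b))"
    for p :: "nat \<Rightarrow> int" and m :: nat
  define L where "L i = {m. m \<ge> 1 \<and> (\<exists>p. dec p m \<and> p m = i)}" for i
  define h where "h i = Max (L i)" for i
  have Lk: "m \<le> k" if mL: "m \<in> L i" for m i
  proof (rule ccontr)
    assume "\<not> m \<le> k"
    then have "{1..k+1} \<subseteq> {1..m}" by auto
    moreover obtain p where "dec p m" using mL unfolding L_def by blast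
    ultimately have "dec p (k+1)" unfolding dec_def by blast
    then show False using av unfolding contains_decreasing_def dec_def by blast
  qed
  have fin: "finite (L i)" for i
    by (rule finite_subset[of _ "{..k}"]) (use Lk in auto)
  have one: "1 \<in> L i" for i
    by (auto simp: L_def dec_def)
  have hL: "h i \<in> L i" for i unfolding h_def using fin one by (intro Max_in) auto
  have step: "h i < h j" if "i < j" "\<sigma> i > \<sigma> j" for i j
  proof -
    obtain p where p: "dec p (h i)" "p (h i) = i" "h i \<ge> 1" using hL[of i] by (auto simp: L_def)
    have le: "p a \<le> i \<and> \<sigma> (p a) \<ge> \<sigma> i" if "a \<in> {1..h i}" for a
      using p(1)[unfolded dec_def, rule_format, OF that, of "h i"] p(2,3) that by (cases "a = h i") auto
    have "dec (p(h i + 1 := j)) (h i + 1)"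
      unfolding dec_def
    proof (intro ballI impI)
      fix a b assume ab: "a \<in> {1..h i + 1}" "b \<in> {1..h i + 1}" "a < b"
      show "(p(h i + 1 := j)) a < (p(h i + 1 := j)) b \<and> \<sigma> ((p(h i + 1 := j)) b) < \<sigma> ((p(h i + 1 := j)) a)"
      proof (cases "b = h i + 1")
        case True
        then show ?thesis using le[of a] ab that by auto
      next
        case False
        then show ?thesis using p(1)[unfolded dec_def, rule_format, of a b] ab by auto
      qed
    qed
    then have "h i + 1 \<in> L j" unfolding L_def by (auto intro!: exI[of _ "p(h i + 1 := j)"])
    then have "h i + 1 \<le> h j" unfolding h_def[of j] using fin by (intro Max_ge) auto
    then show ?thesis by simp
  qed
  have Lsub: "L i \<subseteq> L (i + q * int N)" for i q
  proof
    fix m assume "m \<in> L i"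
    then obtain p where p: "m \<ge> 1" "dec p m" "p m = i" by (auto simp: L_def)
    have "dec (\<lambda>a. p a + q * int N) m"
      using p(2) periodic_shift[of \<sigma>, OF per] by (auto simp: dec_def)
    then show "m \<in> L (i + q * int N)" using p by (auto simp: L_def)
  qed
  have hper: "h (i mod int N) = h i" for i
  proof -
    have "L (i mod int N) \<subseteq> L i" using Lsub[of "i mod int N" "i div int N"] by simp
    moreover have "L i \<subseteq> L (i mod int N)" using Lsub[of "i" "- (i div int N)"]
      by (simp add: minus_div_mult_eq_mod)
    ultimately show ?thesis by (simp add: h_def)
  qed
  define f where "f = restrict (\<lambda>i. int (h i)) {0..<int N}"
  have fh: "f (i mod int N) = int (h i)" for i using N_pos by (simp add: f_def hper)
  have "f \<in> {0..<int N} \<rightarrow>\<^sub>E {1..int k}"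
    using hL Lk by (force simp: f_def L_def)
  moreover have "\<sigma> i < \<sigma> j" if "f (i mod int N) = f (j mod int N)" "i < j" for i j
  proof -
    have "\<not> \<sigma> j < \<sigma> i" using step[of i j] that fh by auto
    moreover have "\<sigma> i \<noteq> \<sigma> j" using that assms(1) by (auto dest: injD)
    ultimately show ?thesis by simp
  qed
  ultimately show ?thesis by blast
qed

end

section \<open>Balanced words and pairs of words with equal content\<close>

lemma exp_le_quadratic:
  fixes x :: real
  assumes "\<bar>x\<bar> \<le> 1"
  shows "exp x \<le> 1 + x + x\<^sup>2"
proof (cases "x \<ge> 0")
  case True
  then show ?thesis using exp_bound[of x] assms by simp
next
  case False
  define y where "y = - x"
  have y: "0 < y" "y \<le> 1" using False assms by (auto simp: y_def)
  \<comment> \<open>The product equals 1 + y^3.\<close>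
  have "1 \<le> (1 + y) * (1 - y + y\<^sup>2)"
    using y by (simp add: algebra_simps power2_eq_square)
  also have "\<dots> \<le> exp y * (1 - y + y\<^sup>2)"
    using y exp_ge_add_one_self[of y] by (intro mult_right_mono) auto
  finally have "exp (- y) * 1 \<le> exp (- y) * (exp y * (1 - y + y\<^sup>2))"
    by (intro mult_left_mono) auto
  also have "\<dots> = 1 - y + y\<^sup>2" by (simp add: exp_minus field_simps)
  finally show ?thesis by (simp add: y_def)
qed

text \<open>Exponential Markov inequality for a uniformly random word: the exponential moment
  factorises over positions, and since \<open>X\<close> is centred the linear term drops out,
  leaving at most \<open>card C * exp (l\<^sup>2)\<close> per position. The set \<open>J\<close>
  will be a prefix.\<close>

lemma card_words_tail:
  fixes X :: "'c \<Rightarrow> real" and I :: "'i set" and l :: real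
  assumes C: "finite C" "C \<noteq> {}" and X: "\<And>c. c \<in> C \<Longrightarrow> \<bar>X c\<bar> \<le> 1" "(\<Sum>c\<in>C. X c) = 0"
    and I: "finite I" "J \<subseteq> I" and l: "0 \<le> l" "l \<le> 1"
  shows "real (card {f \<in> I \<rightarrow>\<^sub>E C. (\<Sum>j\<in>J. X (f j)) > D})
    \<le> real (card C) ^ card I * exp (l\<^sup>2 * card I - l * D)"
proof -
  let ?T = "{f \<in> I \<rightarrow>\<^sub>E C. (\<Sum>j\<in>J. X (f j)) > D}"
  have fin: "finite (I \<rightarrow>\<^sub>E C)" using C I by (simp add: finite_PiE)
  have fac: "(\<Sum>c\<in>C. if j \<in> J then exp (l * X c) else 1) \<le> card C * exp (l\<^sup>2)" for j
  proof (cases "j \<in> J")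
    case True
    have "exp (l * X c) \<le> 1 + l * X c + l\<^sup>2" if "c \<in> C" for c
    proof -
      have "\<bar>l * X c\<bar> \<le> 1" using X(1)[OF that] l by (simp add: abs_mult mult_le_one)
      then have "exp (l * X c) \<le> 1 + l * X c + (l * X c)\<^sup>2" by (rule exp_le_quadratic)
      also have "(l * X c)\<^sup>2 \<le> l\<^sup>2"
        using X(1)[OF that] by (simp add: power_mult_distrib abs_square_le_1 mult_left_le)
      finally show ?thesis by simp
    qed
    then have "(\<Sum>c\<in>C. exp (l * X c)) \<le> (\<Sum>c\<in>C. 1 + l * X c + l\<^sup>2)" by (rule sum_mono)
    also have "\<dots> = card C * (1 + l\<^sup>2)"
      by (simp add: sum.distrib X(2) algebra_simps flip: sum_distrib_left)
    also have "\<dots> \<le> card C * exp (l\<^sup>2)" by (intro mult_left_mono exp_ge_add_one_self) auto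
    finally show ?thesis using True by simp
  next
    case False
    then show ?thesis using mult_left_mono[of 1 "exp (l\<^sup>2)" "real (card C)"] by simp
  qed
  have "real (card ?T) * exp (l * D) = (\<Sum>f\<in>?T. exp (l * D))" by simp
  also have "\<dots> \<le> (\<Sum>f\<in>?T. exp (l * (\<Sum>j\<in>J. X (f j))))"
    using l by (intro sum_mono) (auto intro!: mult_left_mono)
  also have "\<dots> \<le> (\<Sum>f\<in>I \<rightarrow>\<^sub>E C. exp (l * (\<Sum>j\<in>J. X (f j))))"
    by (intro sum_mono2 fin) auto
  also have "\<dots> = (\<Sum>f\<in>I \<rightarrow>\<^sub>E C. \<Prod>j\<in>I. if j \<in> J then exp (l * X (f j)) else 1)"
  proof (rule sum.cong[OF refl])
    fix f
    have "exp (l * (\<Sum>j\<in>J. X (f j))) = (\<Prod>j\<in>J. exp (l * X (f j)))"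
      using I by (simp add: sum_distrib_left exp_sum finite_subset)
    also have "\<dots> = (\<Prod>j\<in>I. if j \<in> J then exp (l * X (f j)) else 1)"
      using I by (simp add: prod.If_cases Int_absorb1)
    finally show "exp (l * (\<Sum>j\<in>J. X (f j))) = \<dots>" .
  qed
  also have "\<dots> = (\<Prod>j\<in>I. \<Sum>c\<in>C. if j \<in> J then exp (l * X c) else 1)"
    using C I by (intro prod_sum_PiE[symmetric]) auto
  also have "\<dots> \<le> (\<Prod>j\<in>I. card C * exp (l\<^sup>2))"
    using fac by (intro prod_mono) (auto intro!: sum_nonneg)
  also have "\<dots> = real (card C) ^ card I * exp (l\<^sup>2 * card I)"
    by (simp add: power_mult_distrib exp_of_nat2_mult)
  finally have "real (card ?T) * exp (l * D) \<le> real (card C) ^ card I * exp (l\<^sup>2 * card I)" .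
  then show ?thesis by (simp add: exp_diff pos_le_divide_eq)
qed

definition balanced :: "nat \<Rightarrow> 'c set \<Rightarrow> real \<Rightarrow> (int \<Rightarrow> 'c) \<Rightarrow> bool" where
  "balanced N C D f \<longleftrightarrow> (\<forall>c\<in>C. \<forall>m\<in>{0..int N}. \<bar>real_of_int (prefix_count f c m) - real_of_int m / card C\<bar> \<le> D)"

text \<open>Union bound over the colour, the \<open>N + 1\<close> prefix lengths and the two signs
  of the deviation.\<close>

lemma card_unbalanced_words:
  fixes l :: real
  assumes C: "finite C" "C \<noteq> {}" and l: "0 \<le> l" "l \<le> 1"
  shows "real (card {f \<in> {0..<int N} \<rightarrow>\<^sub>E C. \<not> balanced N C D f})
    \<le> 2 * card C * (N + 1) * (real (card C) ^ N * exp (l\<^sup>2 * N - l * D))"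
proof -
  let ?I = "{0..<int N}" and ?k = "real (card C)"
  let ?B = "real (card C) ^ N * exp (l\<^sup>2 * N - l * D)"
  \<comment> \<open>The centred indicator of the letter \<open>c\<close>: it sums to zero over the
    alphabet, and its prefix sums along a word are the deviations occurring in
    \<open>balanced\<close>.\<close>
  define X where "X c c' = of_bool (c' = c) - 1 / ?k" for c c' :: 'a
  have k: "?k \<ge> 1" using C by (simp add: Suc_leI card_gt_0_iff)
  have Xb: "\<bar>X c c'\<bar> \<le> 1" for c c' using k by (auto simp: X_def field_simps abs_if)
  have X0: "(\<Sum>c'\<in>C. X c c') = 0" if "c \<in> C" for c
    using that C k by (simp add: X_def sum_subtractf of_bool_def sum.delta)
  have dev: "real_of_int (prefix_count f c m) - real_of_int m / ?k = (\<Sum>j\<in>{0..<m}. X c (f j))"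
    if "0 \<le> m" for f c m
  proof -
    have "(\<Sum>j\<in>{0..<m}. of_bool (f j = c) :: real) = real (card ({0..<m} \<inter> {j. f j = c}))"
      by (simp add: sum_of_bool_eq)
    then show ?thesis using that
      by (simp add: X_def sum_subtractf prefix_count_def Int_def)
  qed
  define T where "T c m s = {f \<in> ?I \<rightarrow>\<^sub>E C. (\<Sum>j\<in>{0..<m}. s * X c (f j)) > D}" for c m and s :: real
  have T: "real (card (T c m s)) \<le> ?B" if "c \<in> C" "m \<in> {0..int N}" "s \<in> {1, -1}" for c m s
  proof -
    have "real (card (T c m s)) \<le> ?k ^ card ?I * exp (l\<^sup>2 * card ?I - l * D)"
      unfolding T_def by (rule card_words_tail)
        (use that C l X0 Xb in \<open>auto simp: abs_mult simp flip: sum_distrib_left sum_negf\<close>)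
    then show ?thesis by simp
  qed
  have "{f \<in> ?I \<rightarrow>\<^sub>E C. \<not> balanced N C D f} \<subseteq> (\<Union>(c, m, s)\<in>C \<times> {0..int N} \<times> {1, -1}. T c m s)"
  proof
    fix f assume f: "f \<in> {f \<in> ?I \<rightarrow>\<^sub>E C. \<not> balanced N C D f}"
    then obtain c m where cm: "c \<in> C" "m \<in> {0..int N}" "\<not> \<bar>real_of_int (prefix_count f c m) - real_of_int m / ?k\<bar> \<le> D"
      unfolding balanced_def by blast
    then have "\<bar>\<Sum>j\<in>{0..<m}. X c (f j)\<bar> > D" using dev[of m f c] by auto
    then have "f \<in> T c m 1 \<or> f \<in> T c m (-1)" using f by (auto simp: T_def sum_negf abs_if split: if_splits)
    then show "f \<in> (\<Union>(c, m, s)\<in>C \<times> {0..int N} \<times> {1, -1}. T c m s)" using cm(1,2) by blast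
  qed
  moreover have "finite (T c m s)" for c m s
    by (rule finite_subset[of _ "?I \<rightarrow>\<^sub>E C"]) (use C in \<open>auto simp: T_def finite_PiE\<close>)
  ultimately have "card {f \<in> ?I \<rightarrow>\<^sub>E C. \<not> balanced N C D f} \<le> card (\<Union>(c, m, s)\<in>C \<times> {0..int N} \<times> {1::real, -1}. T c m s)"
    using C by (intro card_mono) auto
  also have "\<dots> \<le> (\<Sum>(c, m, s)\<in>C \<times> {0..int N} \<times> {1::real, -1}. card (T c m s))"
    using C by (intro order.trans[OF card_UN_le]) (auto simp: case_prod_unfold)
  finally have "real (card {f \<in> ?I \<rightarrow>\<^sub>E C. \<not> balanced N C D f}) \<le> (\<Sum>(c, m, s)\<in>C \<times> {0..int N} \<times> {1::real, -1}. real (card (T c m s)))"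
    unfolding case_prod_unfold of_nat_sum[symmetric] of_nat_le_iff .
  also have "\<dots> \<le> (\<Sum>(c, m, s)\<in>C \<times> {0..int N} \<times> {1::real, -1}. ?B)"
    unfolding case_prod_unfold by (intro sum_mono T) auto
  also have "\<dots> = 2 * card C * (N + 1) * ?B"
    by (simp add: case_prod_unfold card_cartesian_product algebra_simps)
  finally show ?thesis .
qed

text \<open>Two index sets are allowed because deleting a letter leaves different sets of positions
  in the two words.\<close>

definition equal_content :: "'i set \<Rightarrow> 'j set \<Rightarrow> 'c set \<Rightarrow> (('i \<Rightarrow> 'c) \<times> ('j \<Rightarrow> 'c)) set" where
  "equal_content I J C = {(f, g). f \<in> I \<rightarrow>\<^sub>E C \<and> g \<in> J \<rightarrow>\<^sub>E C \<and>
     (\<forall>c\<in>C. card {i \<in> I. f i = c} = card {j \<in> J. g j = c})}"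

text \<open>Inverse of deleting the letter \<open>c\<close>: a word on the remaining positions
  \<open>X\<close> is completed by \<open>c\<close>. The value \<open>undefined\<close> outside
  \<open>I\<close> keeps the result in the extensional function space.\<close>

definition fill_colour :: "'c \<Rightarrow> 'i set \<Rightarrow> 'i set \<Rightarrow> ('i \<Rightarrow> 'c) \<Rightarrow> 'i \<Rightarrow> 'c" where
  "fill_colour c I X f = (\<lambda>i. if i \<in> X then f i else if i \<in> I then c else undefined)"

text \<open>Recursion by removal of one letter: \<open>j\<close> positions carry the other letters,
  and these positions are chosen independently in the two words.\<close>

fun pair_count :: "nat \<Rightarrow> nat \<Rightarrow> nat" where
  "pair_count 0 N = (if N = 0 then 1 else 0)"
| "pair_count (Suc k) N = (\<Sum>j\<le>N. (N choose j)\<^sup>2 * pair_count k j)"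

lemma finite_equal_content:
  "finite I \<Longrightarrow> finite J \<Longrightarrow> finite C \<Longrightarrow> finite (equal_content I J C)"
  by (rule finite_subset[of _ "(I \<rightarrow>\<^sub>E C) \<times> (J \<rightarrow>\<^sub>E C)"]) (auto simp: equal_content_def finite_PiE)

text \<open>Deleting the letter \<open>c\<close> from both words leaves a pair over the smaller
  alphabet on index sets \<open>X\<close> and \<open>Y\<close>. Since \<open>I\<close> and
  \<open>J\<close> are equinumerous, the two words contain \<open>c\<close> equally often exactly
  when \<open>X\<close> and \<open>Y\<close> have the same size; grouping by that size gives the
  recursion.\<close>

lemma card_equal_content:
  fixes I :: "'i set" and J :: "'j set" and C :: "'c set"
  assumes "finite C" "finite I" "finite J" "card I = card J"
  shows "card (equal_content I J C) = pair_count (card C) (card I)"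
  using assms
proof (induction C arbitrary: I J rule: finite_induct)
  case empty
  show ?case
  proof (cases "I = {}")
    case True
    then have "J = {}" using empty by simp
    then show ?thesis using True by (simp add: equal_content_def)
  next
    case False
    then show ?thesis using empty by (auto simp: equal_content_def)
  qed
next
  case (insert c C)
  define U where "U = {(X, Y). X \<subseteq> I \<and> Y \<subseteq> J \<and> card X = card Y}"
  define N where "N = card I"
  have finI: "finite I" and finJ: "finite J" and N: "card J = N" using insert by (auto simp: N_def)
  have finU: "finite U"
    by (rule finite_subset[of _ "Pow I \<times> Pow J"]) (use finI finJ in \<open>auto simp: U_def\<close>)
  note ext_def = fill_colour_def
  let ?F = "\<lambda>(f, g). (({i \<in> I. f i \<noteq> c}, {j \<in> J. g j \<noteq> c}), (restrict f {i \<in> I. f i \<noteq> c}, restrict g {j \<in> J. g j \<noteq> c}))"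
  let ?G = "\<lambda>((X, Y), (f, g)). (fill_colour c I X f :: 'i \<Rightarrow> 'c, fill_colour c J Y g :: 'j \<Rightarrow> 'c)"
  have compl: "card {i \<in> K. h i = c} = card K - card {i \<in> K. h i \<noteq> c} \<and> card {i \<in> K. h i \<noteq> c} \<le> card K"
    if "finite K" for K :: "'z set" and h :: "'z \<Rightarrow> 'c"
  proof -
    have "{i \<in> K. h i = c} = K - {i \<in> K. h i \<noteq> c}" by auto
    then show ?thesis using that by (auto simp: card_Diff_subset card_mono)
  qed
  have extcls: "{i \<in> K. fill_colour c K X h i = d} = {i \<in> X. h i = d}" if "X \<subseteq> K" "d \<in> C" for K X d and h :: "'z \<Rightarrow> 'c"
    using that insert.hyps by (auto simp: ext_def)
  have extne: "{i \<in> K. fill_colour c K X h i \<noteq> c} = X" if "X \<subseteq> K" "h \<in> X \<rightarrow>\<^sub>E C" for K X and h :: "'z \<Rightarrow> 'c"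
    using that insert.hyps by (auto simp: ext_def PiE_iff)
  have extres: "restrict (fill_colour c K X h) X = h" if "h \<in> X \<rightarrow>\<^sub>E C" for K X and h :: "'z \<Rightarrow> 'c"
    using that by (auto simp: ext_def fun_eq_iff PiE_iff extensional_def restrict_def)
  have extinv: "fill_colour c K {i \<in> K. h i \<noteq> c} (restrict h {i \<in> K. h i \<noteq> c}) = h" if "h \<in> K \<rightarrow>\<^sub>E insert c C" for K and h :: "'z \<Rightarrow> 'c"
    using that by (auto simp: ext_def fun_eq_iff PiE_iff extensional_def)
  have extin: "fill_colour c K X h \<in> K \<rightarrow>\<^sub>E insert c C" if "X \<subseteq> K" "h \<in> X \<rightarrow>\<^sub>E C" for K X and h :: "'z \<Rightarrow> 'c"
    using that by (auto simp: ext_def PiE_iff extensional_def)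
  have "bij_betw ?F (equal_content I J (insert c C)) (SIGMA (X, Y):U. equal_content X Y C)"
  proof (rule bij_betw_byWitness[where f' = ?G])
    show "\<forall>a\<in>equal_content I J (insert c C). ?G (?F a) = a"
      using extinv[of _ I] extinv[of _ J] by (auto simp: equal_content_def)
    show "\<forall>a'\<in>(SIGMA (X, Y):U. equal_content X Y C). ?F (?G a') = a'"
      using extne[of _ I] extne[of _ J] extres[of _ _ I] extres[of _ _ J] by (auto simp: equal_content_def U_def)
    show "?F ` equal_content I J (insert c C) \<subseteq> (SIGMA (X, Y):U. equal_content X Y C)"
    proof (rule image_subsetI)
      fix z assume z: "z \<in> equal_content I J (insert c C)"
      obtain f g where zfg: "z = (f, g)" by (cases z)
      then have fg: "(f, g) \<in> equal_content I J (insert c C)" using z by simp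
      let ?X = "{i \<in> I. f i \<noteq> c}" and ?Y = "{j \<in> J. g j \<noteq> c}"
      have "card {i \<in> I. f i = c} = card {j \<in> J. g j = c}" using fg by (simp add: equal_content_def)
      then have "card ?X = card ?Y"
        using compl[OF finI, of f] compl[OF finJ, of g] N N_def by linarith
      then have "(?X, ?Y) \<in> U" by (auto simp: U_def)
      moreover have "(restrict f ?X, restrict g ?Y) \<in> equal_content ?X ?Y C"
      proof -
        have "{i \<in> ?X. restrict f ?X i = d} = {i \<in> I. f i = d}" "{j \<in> ?Y. restrict g ?Y j = d} = {j \<in> J. g j = d}"
          if "d \<in> C" for d using that insert.hyps by auto
        then show ?thesis using fg by (auto simp: equal_content_def PiE_iff)
      qed
      ultimately show "?F z \<in> (SIGMA (X, Y):U. equal_content X Y C)" unfolding zfg by simp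
    qed
    show "?G ` (SIGMA (X, Y):U. equal_content X Y C) \<subseteq> equal_content I J (insert c C)"
    proof (rule image_subsetI)
      fix z assume z: "z \<in> (SIGMA (X, Y):U. equal_content X Y C)"
      obtain X Y f g where zfg: "z = ((X, Y), (f, g))" by (cases z) (metis surj_pair)
      then have XY: "(X, Y) \<in> U" and fg: "(f, g) \<in> equal_content X Y C" using z by auto
      have s: "X \<subseteq> I" "Y \<subseteq> J" "card X = card Y" "f \<in> X \<rightarrow>\<^sub>E C" "g \<in> Y \<rightarrow>\<^sub>E C"
        using XY fg by (auto simp: U_def equal_content_def)
      have "card {i \<in> I. fill_colour c I X f i = d} = card {j \<in> J. fill_colour c J Y g j = d}" if "d \<in> insert c C" for d
      proof (cases "d = c")
        case True
        show ?thesis unfolding True using compl[OF finI, of "fill_colour c I X f"] compl[OF finJ, of "fill_colour c J Y g"]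
            extne[OF s(1,4)] extne[OF s(2,5)] s(3) N N_def by simp
      next
        case False
        then have "d \<in> C" using that by simp
        then show ?thesis using extcls[OF s(1)] extcls[OF s(2)] fg by (simp add: equal_content_def)
      qed
      then show "?G z \<in> equal_content I J (insert c C)" unfolding zfg
        using extin[OF s(1,4)] extin[OF s(2,5)] by (simp add: equal_content_def)
    qed
  qed
  then have "card (equal_content I J (insert c C)) = card (SIGMA (X, Y):U. equal_content X Y C)"
    by (rule bij_betw_same_card)
  also have "\<dots> = (\<Sum>(X, Y)\<in>U. card (equal_content X Y C))"
    using finU finI finJ insert.hyps
    by (subst card_SigmaI) (auto simp: U_def case_prod_unfold intro!: finite_equal_content intro: finite_subset)
  also have "\<dots> = (\<Sum>(X, Y)\<in>U. pair_count (card C) (card X))"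
  proof (rule sum.cong[OF refl], clarify)
    fix X Y assume "(X, Y) \<in> U"
    then show "card (equal_content X Y C) = pair_count (card C) (card X)"
      using finI finJ by (intro insert.IH) (auto simp: U_def intro: finite_subset)
  qed
  also have "\<dots> = (\<Sum>j\<in>{..N}. \<Sum>XY | XY \<in> U \<and> card (fst XY) = j. case XY of (X, Y) \<Rightarrow> pair_count (card C) (card X))"
  proof (rule sum.group[symmetric, OF finU])
    have "card (fst XY) \<le> N" if "XY \<in> U" for XY
      unfolding N_def using that by (intro card_mono finI) (auto simp: U_def)
    then show "(\<lambda>XY. card (fst XY)) ` U \<subseteq> {..N}" by auto
  qed simp
  also have "\<dots> = (\<Sum>j\<le>N. (N choose j)\<^sup>2 * pair_count (card C) j)"
  proof (rule sum.cong[OF refl])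
    fix j
    have e: "{XY. XY \<in> U \<and> card (fst XY) = j} = {X. X \<subseteq> I \<and> card X = j} \<times> {Y. Y \<subseteq> J \<and> card Y = j}"
      by (auto simp: U_def)
    have "(\<Sum>XY | XY \<in> U \<and> card (fst XY) = j. case XY of (X, Y) \<Rightarrow> pair_count (card C) (card X))
        = (\<Sum>XY | XY \<in> U \<and> card (fst XY) = j. pair_count (card C) j)"
      by (rule sum.cong) auto
    also have "\<dots> = (N choose j)\<^sup>2 * pair_count (card C) j"
      unfolding e using n_subsets[OF finI, of j] n_subsets[OF finJ, of j] N N_def
      by (simp add: card_cartesian_product power2_eq_square)
    finally show "(\<Sum>XY | XY \<in> U \<and> card (fst XY) = j. case XY of (X, Y) \<Rightarrow> pair_count (card C) (card X)) = \<dots>" .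
  qed
  finally show ?case using insert.hyps by (simp add: N_def)
qed

section \<open>Asymptotics of the number of pairs with equal content\<close>

text \<open>A crude quadratic bound on all of [-pi, pi]; it yields the Gaussian that dominates the
  rescaled integrands in Laplace's method.\<close>

lemma one_minus_cos_ge:
  fixes x :: real
  assumes "\<bar>x\<bar> \<le> pi"
  shows "x\<^sup>2 / 18 \<le> 1 - cos x"
proof -
  define y where "y = \<bar>x\<bar> / 2"
  have y: "0 \<le> y" "y \<le> 2" using assms pi_less_4 by (auto simp: y_def)
  \<comment> \<open>On [0, 2] the Taylor bound sin y >= y - y^3/6 together with y^3 <= 4 y leaves a
    third of y.\<close>
  have "y / 3 \<le> sin y"
  proof (cases "y = 0")
    case False
    then obtain t where t: "sin y = (\<Sum>m<3. sin_coeff m * y ^ m) + sin (t + 1 / 2 * real 3 * pi) / fact 3 * y ^ 3"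
      using Maclaurin_sin_expansion3[of 3 y] y by auto
    have s: "(\<Sum>m<3. sin_coeff m * y ^ m) = y"
      by (simp add: sin_coeff_def eval_nat_numeral)
    have "- 1 / 6 * y ^ 3 \<le> sin (t + 1 / 2 * real 3 * pi) / fact 3 * y ^ 3"
      using y by (intro mult_right_mono) (auto simp: fact_numeral)
    then have "y - y ^ 3 / 6 \<le> sin y" using t s by simp
    moreover have "y ^ 3 \<le> 4 * y"
      using mult_mono[of y 2 y 2] y by (simp add: power3_eq_cube mult_right_mono)
    ultimately show ?thesis by simp
  qed simp
  then have "(y / 3)\<^sup>2 \<le> (sin y)\<^sup>2" using y by (intro power_mono) auto
  moreover have "1 - cos x = 2 * (sin y)\<^sup>2"
    using cos_double_sin[of y] by (simp add: y_def)
  moreover have "(y / 3)\<^sup>2 = x\<^sup>2 / 36" by (simp add: y_def power_divide)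
  ultimately show ?thesis by simp
qed

lemma integral_cos_int:
  "(\<integral>t. cos (real_of_int n * t) * indicator {-pi..pi} t \<partial>lborel) = (if n = 0 then 2 * pi else 0)"
  "integrable lborel (\<lambda>t. cos (real_of_int n * t) * indicator {-pi..pi} t)"
proof -
  have "has_bochner_integral lborel (\<lambda>t. cos (real_of_int n * t) * indicator {-pi..pi} t) (if n = 0 then 2 * pi else 0)"
  proof (cases "n = 0")
    case True
    then show ?thesis
      using has_bochner_integral_FTC_Icc_real[of "-pi" pi "\<lambda>x. x" "\<lambda>_. 1"] by simp
  next
    case False
    have "has_bochner_integral lborel (\<lambda>t. cos (real_of_int n * t) * indicator {-pi..pi} t)
        (sin (real_of_int n * pi) / n - sin (real_of_int n * (-pi)) / n)"
      by (rule has_bochner_integral_FTC_Icc_real) (use False in \<open>auto intro!: derivative_eq_intros continuous_intros\<close>)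
    moreover have "sin (real_of_int n * pi) = 0"
      using sin_zero_iff_int2 by auto
    ultimately show ?thesis using False by simp
  qed
  then show "(\<integral>t. cos (real_of_int n * t) * indicator {-pi..pi} t \<partial>lborel) = (if n = 0 then 2 * pi else 0)"
    "integrable lborel (\<lambda>t. cos (real_of_int n * t) * indicator {-pi..pi} t)"
    by (auto simp: has_bochner_integral_iff)
qed

text \<open>For real coefficients the squared modulus is a double sum of cosines of (j - l) t, of
  which only the diagonal survives integration.\<close>

lemma parseval_trig_poly:
  fixes b :: "nat \<Rightarrow> real"
  shows "(\<integral>t. (norm (\<Sum>j\<le>N. of_real (b j) * cis t ^ j))\<^sup>2 * indicator {-pi..pi} t \<partial>lborel) = 2 * pi * (\<Sum>j\<le>N. (b j)\<^sup>2)"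
proof -
  have eq: "(norm (\<Sum>j\<le>N. of_real (b j) * cis t ^ j))\<^sup>2
      = (\<Sum>j\<le>N. \<Sum>l\<le>N. b j * b l * cos (real_of_int (int j - int l) * t))" for t
  proof -
    let ?z = "\<Sum>j\<le>N. of_real (b j) * cis t ^ j"
    have re: "Re ?z = (\<Sum>j\<le>N. b j * cos (real j * t))" and im: "Im ?z = (\<Sum>j\<le>N. b j * sin (real j * t))"
      by (simp_all add: Complex.DeMoivre)
    have "(norm ?z)\<^sup>2 = (\<Sum>j\<le>N. \<Sum>l\<le>N. b j * cos (real j * t) * (b l * cos (real l * t)) + b j * sin (real j * t) * (b l * sin (real l * t)))"
      unfolding cmod_power2 re im by (simp only: power2_eq_square sum_product sum.distrib)
    also have "\<dots> = (\<Sum>j\<le>N. \<Sum>l\<le>N. b j * b l * cos (real_of_int (int j - int l) * t))"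
      by (intro sum.cong refl) (simp add: left_diff_distrib cos_diff algebra_simps)
    finally show ?thesis .
  qed
  have "(\<integral>t. (norm (\<Sum>j\<le>N. of_real (b j) * cis t ^ j))\<^sup>2 * indicator {-pi..pi} t \<partial>lborel)
      = (\<integral>t. (\<Sum>j\<le>N. \<Sum>l\<le>N. b j * b l * (cos (real_of_int (int j - int l) * t) * indicator {-pi..pi} t)) \<partial>lborel)"
    unfolding eq by (simp add: sum_distrib_right mult.assoc)
  also have "\<dots> = (\<Sum>j\<le>N. \<Sum>l\<le>N. b j * b l * (if int j - int l = 0 then 2 * pi else 0))"
    by (subst Bochner_Integration.integral_sum; (intro sum.cong refl Bochner_Integration.integrable_sum integrable_mult_right integral_cos_int(2))?)
      (subst Bochner_Integration.integral_sum; (intro sum.cong refl integrable_mult_right integral_cos_int(2))?;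
       subst integral_mult_right_zero; subst integral_cos_int(1); simp)
  also have "\<dots> = (\<Sum>j\<le>N. b j * b j * (2 * pi))"
  proof (intro sum.cong refl)
    fix j assume "j \<in> {..N}"
    have "(\<Sum>l\<le>N. b j * b l * (if int j - int l = 0 then 2 * pi else 0)) = (\<Sum>l\<le>N. if l = j then b j * b l * (2 * pi) else 0)"
      by (intro sum.cong refl) auto
    then show "(\<Sum>l\<le>N. b j * b l * (if int j - int l = 0 then 2 * pi else 0)) = b j * b j * (2 * pi)"
      using \<open>j \<in> {..N}\<close> by simp
  qed
  finally show ?thesis by (simp add: power2_eq_square sum_distrib_left mult_ac)
qed

text \<open>The generating polynomial of the weights is (p z + 1 - p)^N, whose squared modulus on
  the unit circle is \<open>h t ^ N\<close>. Parseval turns the sum into an integral; after the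
  substitution of t / sqrt N for t the integrand tends to exp(- a t^2), and the limit is a Gaussian
  integral.\<close>

lemma sum_binomial_squares_asymp:
  fixes p :: real
  assumes p: "0 < p" "p < 1"
  shows "(\<lambda>N. sqrt (real N) * (\<Sum>j\<le>N. (real (N choose j) * p ^ j * (1 - p) ^ (N - j))\<^sup>2))
    \<longlonglongrightarrow> 1 / (2 * sqrt (pi * p * (1 - p)))"
proof -
  define a where "a = p * (1 - p)"
  have a: "0 < a" "a \<le> 1 / 4"
    using p zero_le_power2[of "p - 1/2"] by (auto simp: a_def power2_eq_square algebra_simps)
  define S where "S N = (\<Sum>j\<le>N. (real (N choose j) * p ^ j * (1 - p) ^ (N - j))\<^sup>2)" for N
  define h where "h t = 1 - 2 * a * (1 - cos t)" for t
  have h0: "0 \<le> h t" for t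
  proof -
    have "2 * a * (1 - cos t) \<le> 2 * (1/4) * 2"
      using a by (intro mult_mono) auto
    then show ?thesis by (simp add: h_def)
  qed
  \<comment> \<open>For \<open>N = 0\<close> division by zero would make the integrand constantly 1,
    which no integrable function dominates; \<open>of_bool\<close> removes this case.\<close>
  define F where "F N t = of_bool (N > 0) * h (t / sqrt (real N)) ^ N * indicator {-pi..pi} (t / sqrt (real N))" for N t
  have int: "2 * pi * S N = (\<integral>t. h t ^ N * indicator {-pi..pi} t \<partial>lborel)" for N
  proof -
    have "(norm (\<Sum>j\<le>N. of_real (real (N choose j) * p ^ j * (1 - p) ^ (N - j)) * cis t ^ j))\<^sup>2 = h t ^ N" for t
    proof -
      have "(\<Sum>j\<le>N. of_real (real (N choose j) * p ^ j * (1 - p) ^ (N - j)) * cis t ^ j)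
          = (of_real p * cis t + of_real (1 - p)) ^ N"
        unfolding binomial_ring by (intro sum.cong refl) (simp add: power_mult_distrib)
      then have "(norm (\<Sum>j\<le>N. of_real (real (N choose j) * p ^ j * (1 - p) ^ (N - j)) * cis t ^ j))\<^sup>2
         = ((norm (of_real p * cis t + of_real (1 - p)))\<^sup>2) ^ N"
        by (simp add: norm_power flip: power_mult) (simp add: mult.commute)
      also have "(norm (of_real p * cis t + of_real (1 - p)))\<^sup>2 = (p * cos t + (1 - p))\<^sup>2 + (p * sin t)\<^sup>2"
        by (simp add: cmod_power2)
      also have "\<dots> = h t"
        using sin_cos_squared_add[of t] unfolding h_def a_def by algebra
      finally show ?thesis .
    qed
    then show ?thesis unfolding S_def parseval_trig_poly[symmetric] by simp
  qed
  have scaled: "2 * pi * (sqrt (real N) * S N) = (\<integral>t. F N t \<partial>lborel)" if "N > 0" for N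
  proof -
    have "(\<integral>t. h t ^ N * indicator {-pi..pi} t \<partial>lborel) = \<bar>1 / sqrt (real N)\<bar> *\<^sub>R (\<integral>t. F N t \<partial>lborel)"
      using lborel_integral_real_affine[of "1 / sqrt (real N)" "\<lambda>t. h t ^ N * indicator {-pi..pi} t" 0] that
      by (simp add: F_def)
    then have "sqrt (real N) * (\<integral>t. h t ^ N * indicator {-pi..pi} t \<partial>lborel) = (\<integral>t. F N t \<partial>lborel)"
      using that by simp
    then show ?thesis unfolding int[symmetric] by (simp only: mult_ac)
  qed
  have gauss: "has_bochner_integral lborel (\<lambda>t. exp (- c * t\<^sup>2)) (sqrt (pi / c))" if "c > 0" for c :: real
  proof -
    have e: "has_bochner_integral lborel (\<lambda>t::real. exp (- t\<^sup>2)) (sqrt pi)"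
      using has_bochner_integral_even_function[OF gaussian_moment_0] by simp
    have "has_bochner_integral lborel (\<lambda>t::real. exp (- (0 + sqrt c * t)\<^sup>2)) (sqrt pi /\<^sub>R \<bar>sqrt c\<bar>)"
      using lborel_has_bochner_integral_real_affine_iff[of "sqrt c" "\<lambda>t. exp (- t\<^sup>2)" "sqrt pi" 0] e that by simp
    then show ?thesis using that by (simp add: power_mult_distrib real_sqrt_mult real_sqrt_inverse divide_inverse mult.commute)
  qed
  have lim: "(\<lambda>N. \<integral>t. F N t \<partial>lborel) \<longlonglongrightarrow> (\<integral>t. exp (- a * t\<^sup>2) \<partial>lborel)"
  proof (rule integral_dominated_convergence)
    \<comment> \<open>The rate a/9 is 2 a times the constant 1/18 of
      \<open>one_minus_cos_ge\<close>.\<close>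
    show "integrable lborel (\<lambda>t. exp (- (a / 9) * t\<^sup>2))" using gauss[of "a / 9"] a by (simp add: has_bochner_integral_iff)
    show "(\<lambda>t. exp (- a * t\<^sup>2)) \<in> borel_measurable lborel" by measurable
    show "F N \<in> borel_measurable lborel" for N unfolding F_def h_def by measurable
    show "AE t in lborel. (\<lambda>N. F N t) \<longlonglongrightarrow> exp (- a * t\<^sup>2)"
    proof (rule AE_I2)
      fix t :: real
      have "(\<lambda>N. (1 - 2 * a * (1 - cos (t / sqrt (real N)))) ^ N) \<longlonglongrightarrow> exp (- a * t\<^sup>2)"
      proof -
        \<comment> \<open>The expansion is done for one sign of \<open>t\<close>; evenness of the
          cosine covers the other.\<close>
        have pos: "(\<lambda>N. (1 - 2 * a * (1 - cos (t / sqrt (real N)))) ^ N) \<longlonglongrightarrow> exp (- (a * (t * t)))" if "t > 0" for t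
          using that a by real_asymp
        consider "t > 0" | "t = 0" | "- t > 0" by linarith
        then show ?thesis using pos[of t] pos[of "-t"] by cases (simp_all add: power2_eq_square)
      qed
      moreover have "eventually (\<lambda>N. \<bar>t / sqrt (real N)\<bar> < pi) sequentially"
      proof (rule order_tendstoD(2))
        have "(\<lambda>N. t / sqrt (real N)) \<longlonglongrightarrow> 0" by real_asymp
        then show "(\<lambda>N. \<bar>t / sqrt (real N)\<bar>) \<longlonglongrightarrow> 0" by (rule tendsto_rabs_zero)
      qed simp
      then have "eventually (\<lambda>N. h (t / sqrt (real N)) ^ N = F N t) sequentially"
        using eventually_gt_at_top[of 0] by eventually_elim (auto simp: F_def indicator_def abs_if split: if_splits)
      ultimately show "(\<lambda>N. F N t) \<longlonglongrightarrow> exp (- a * t\<^sup>2)"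
        unfolding h_def by (rule Lim_transform_eventually)
    qed
    show "AE t in lborel. norm (F N t) \<le> exp (- (a / 9) * t\<^sup>2)" for N
    proof (rule AE_I2)
      fix t :: real
      show "norm (F N t) \<le> exp (- (a / 9) * t\<^sup>2)"
      proof (cases "N > 0 \<and> t / sqrt (real N) \<in> {-pi..pi}")
        case True
        define u where "u = t / sqrt (real N)"
        have "u\<^sup>2 / 18 \<le> 1 - cos u" using True by (intro one_minus_cos_ge) (auto simp: u_def)
        then have "2 * a * (u\<^sup>2 / 18) \<le> 2 * a * (1 - cos u)" using a by (intro mult_left_mono) auto
        then have "h u \<le> 1 + (- (a / 9) * u\<^sup>2)" by (simp add: h_def)
        also have "\<dots> \<le> exp (- (a / 9) * u\<^sup>2)" by (rule exp_ge_add_one_self)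
        finally have "h u ^ N \<le> exp (- (a / 9) * u\<^sup>2) ^ N" using h0 by (intro power_mono)
        also have "\<dots> = exp (- (a / 9) * (u\<^sup>2 * N))" by (simp add: exp_of_nat2_mult[symmetric])
        also have "u\<^sup>2 * N = t\<^sup>2" using True by (simp add: u_def power_divide)
        finally show ?thesis using True h0 by (simp add: F_def u_def)
      next
        case False
        then show ?thesis by (auto simp: F_def)
      qed
    qed
  qed
  have "(\<integral>t. exp (- a * t\<^sup>2) \<partial>lborel) = sqrt (pi / a)"
    using gauss[OF a(1)] by (simp add: has_bochner_integral_iff)
  with lim have "(\<lambda>N. (\<integral>t. F N t \<partial>lborel) / (2 * pi)) \<longlonglongrightarrow> sqrt (pi / a) / (2 * pi)"
    by (intro tendsto_divide) auto
  moreover have "eventually (\<lambda>N. (\<integral>t. F N t \<partial>lborel) / (2 * pi) = sqrt (real N) * S N) sequentially"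
    using eventually_gt_at_top[of 0] by eventually_elim (simp flip: scaled)
  ultimately have "(\<lambda>N. sqrt (real N) * S N) \<longlonglongrightarrow> sqrt (pi / a) / (2 * pi)"
    by (rule Lim_transform_eventually)
  also have "sqrt (pi / a) / (2 * pi) = (sqrt pi / sqrt a) / (2 * (sqrt pi * sqrt pi))"
    by (simp add: real_sqrt_divide)
  also have "\<dots> = 1 / (2 * (sqrt pi * sqrt a))"
  proof -
    have "(x / y) / (2 * (x * x)) = 1 / (2 * (x * y))" if "x > 0" "y > 0" for x y :: real
      using that by (simp add: field_simps)
    from this[of "sqrt pi" "sqrt a"] show ?thesis using a(1) by (simp only: real_sqrt_gt_0_iff pi_gt_zero)
  qed
  also have "sqrt pi * sqrt a = sqrt (pi * p * (1 - p))"
    by (simp only: a_def real_sqrt_mult mult.assoc)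
  finally show ?thesis by (simp add: S_def)
qed

section \<open>Concentration of binomial weights and averages against their squares\<close>

definition binomial_weight :: "real \<Rightarrow> nat \<Rightarrow> nat \<Rightarrow> real" where
  "binomial_weight p N j = real (N choose j) * p ^ j * (1 - p) ^ (N - j)"

lemma binomial_weight_nonneg: "0 \<le> p \<Longrightarrow> p \<le> 1 \<Longrightarrow> 0 \<le> binomial_weight p N j"
  by (simp add: binomial_weight_def)

lemma sum_binomial_weight: "(\<Sum>j\<le>N. binomial_weight p N j) = 1"
  using binomial_ring[of p "1 - p" N] by (simp add: binomial_weight_def)

text \<open>Centring at \<open>p * N\<close> lets the exponential split over successes and failures,
  so the binomial theorem collapses the sum to an N-th power. In its base the linear terms of the
  two exponentials cancel. Both signs of \<open>l\<close> are allowed, one for each tail.\<close>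

lemma binomial_exp_moment:
  fixes l :: real
  assumes p: "0 \<le> p" "p \<le> 1" and l: "\<bar>l\<bar> \<le> 1"
  shows "(\<Sum>j\<le>N. binomial_weight p N j * exp (l * (real j - p * real N))) \<le> exp (l\<^sup>2 * N)"
proof -
  have "(\<Sum>j\<le>N. binomial_weight p N j * exp (l * (real j - p * real N)))
      = (\<Sum>j\<le>N. real (N choose j) * (p * exp (l * (1 - p))) ^ j * ((1 - p) * exp (- l * p)) ^ (N - j))"
  proof (rule sum.cong[OF refl])
    fix j assume "j \<in> {..N}"
    then have "exp (l * (real j - p * real N)) = exp (l * (1 - p)) ^ j * exp (- l * p) ^ (N - j)"
      by (simp add: exp_of_nat_mult[symmetric] exp_add[symmetric] of_nat_diff algebra_simps)
    then show "binomial_weight p N j * exp (l * (real j - p * real N))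
        = real (N choose j) * (p * exp (l * (1 - p))) ^ j * ((1 - p) * exp (- l * p)) ^ (N - j)"
      by (simp add: binomial_weight_def power_mult_distrib)
  qed
  also have "\<dots> = (p * exp (l * (1 - p)) + (1 - p) * exp (- l * p)) ^ N"
    by (simp add: binomial_ring)
  also have "\<dots> \<le> exp (l\<^sup>2) ^ N"
  proof (rule power_mono)
    have le: "exp (l * q) \<le> 1 + l * q + l\<^sup>2" if "\<bar>q\<bar> \<le> 1" for q
    proof -
      have "exp (l * q) \<le> 1 + l * q + (l * q)\<^sup>2"
        using l that by (intro exp_le_quadratic) (simp add: abs_mult mult_le_one)
      also have "(l * q)\<^sup>2 \<le> l\<^sup>2"
        using that by (simp add: power_mult_distrib abs_square_le_1 mult_left_le)
      finally show ?thesis by simp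
    qed
    have "p * exp (l * (1 - p)) + (1 - p) * exp (l * (- p))
        \<le> p * (1 + l * (1 - p) + l\<^sup>2) + (1 - p) * (1 + l * (- p) + l\<^sup>2)"
      using p by (intro add_mono mult_left_mono le) auto
    also have "\<dots> = 1 + l\<^sup>2" by (simp add: algebra_simps)
    also have "\<dots> \<le> exp (l\<^sup>2)" by (rule exp_ge_add_one_self)
    finally show "p * exp (l * (1 - p)) + (1 - p) * exp (- l * p) \<le> exp (l\<^sup>2)" by simp
  qed (use p in auto)
  finally show ?thesis by (simp add: exp_of_nat2_mult)
qed

lemma binomial_tail:
  fixes l :: real
  assumes p: "0 \<le> p" "p \<le> 1" and l: "0 \<le> l" "l \<le> 1"
  shows "(\<Sum>j | j \<le> N \<and> \<bar>real j - p * real N\<bar> > D. binomial_weight p N j) \<le> 2 * exp (l\<^sup>2 * N - l * D)"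
proof -
  let ?x = "\<lambda>j. real j - p * real N"
  have "(\<Sum>j | j \<le> N \<and> \<bar>?x j\<bar> > D. binomial_weight p N j)
      \<le> (\<Sum>j | j \<le> N \<and> \<bar>?x j\<bar> > D. exp (- l * D) * (binomial_weight p N j * exp (l * ?x j) + binomial_weight p N j * exp ((- l) * ?x j)))"
  proof (rule sum_mono)
    fix j assume j: "j \<in> {j. j \<le> N \<and> \<bar>?x j\<bar> > D}"
    have two: "exp (l * \<bar>x\<bar>) \<le> exp (l * x) + exp ((- l) * x)" for x
    proof (cases "x \<ge> 0")
      case False
      then have "l * \<bar>x\<bar> = (- l) * x" by simp
      then show ?thesis by (simp only: exp_ge_zero le_add_same_cancel2)
    qed simp
    have "1 \<le> exp (l * (\<bar>?x j\<bar> - D))" using j l by simp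
    also have "\<dots> = exp (- l * D) * exp (l * \<bar>?x j\<bar>)" by (simp add: exp_add[symmetric] algebra_simps)
    also have "\<dots> \<le> exp (- l * D) * (exp (l * ?x j) + exp ((- l) * ?x j))"
      by (intro mult_left_mono two) auto
    finally have "1 \<le> exp (- l * D) * (exp (l * ?x j) + exp ((- l) * ?x j))" .
    from mult_left_mono[OF this binomial_weight_nonneg[OF p, of N j]]
    show "binomial_weight p N j \<le> exp (- l * D) * (binomial_weight p N j * exp (l * ?x j) + binomial_weight p N j * exp ((- l) * ?x j))"
      by (simp add: algebra_simps)
  qed
  also have "\<dots> \<le> (\<Sum>j\<le>N. exp (- l * D) * (binomial_weight p N j * exp (l * ?x j) + binomial_weight p N j * exp ((- l) * ?x j)))"
    by (intro sum_mono2) (auto intro!: mult_nonneg_nonneg add_nonneg_nonneg binomial_weight_nonneg p)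
  also have "\<dots> \<le> exp (- l * D) * (exp (l\<^sup>2 * N) + exp ((- l)\<^sup>2 * N))"
    unfolding sum_distrib_left[symmetric] sum.distrib
    using p l by (intro mult_left_mono add_mono binomial_exp_moment) auto
  also have "\<dots> = 2 * exp (l\<^sup>2 * N - l * D)" by (simp add: exp_diff exp_minus field_simps)
  finally show ?thesis .
qed

lemma filterlim_at_top_of_ratio:
  fixes m :: "nat \<Rightarrow> nat"
  assumes "(\<lambda>N. real (m N) / real N) \<longlonglongrightarrow> c" "c > 0"
  shows "filterlim m at_top sequentially"
proof -
  have "filterlim (\<lambda>N. real (m N) / real N * real N) at_top sequentially"
    by (rule filterlim_tendsto_pos_mult_at_top[OF assms filterlim_real_sequentially])
  then have "filterlim (\<lambda>N. real (m N)) at_top sequentially"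
  proof (rule filterlim_mono_eventually)
    show "eventually (\<lambda>N. real (m N) / real N * real N = real (m N)) sequentially"
      using eventually_gt_at_top[of 0] by eventually_elim simp
  qed auto
  then show ?thesis by (simp add: filterlim_sequentially_iff_filterlim_real)
qed

text \<open>The choice l = N^(-1/2) in the Chernoff exponent l^2 N - l D: the first term becomes 1,
  and with D = N^(2/3) the second becomes N^(1/6).\<close>

lemma powr_minus_half_square:
  assumes "N > 0"
  shows "(real N powr (-1/2))\<^sup>2 * real N = 1"
proof -
  have "(real N powr (-1/2))\<^sup>2 * real N = real N powr (-1/2) * real N powr (-1/2) * real N powr 1"
    using assms by (simp add: power2_eq_square)
  also have "\<dots> = 1" unfolding powr_add[symmetric] using assms by simp
  finally show ?thesis .
qed

text \<open>The weights concentrate where \<open>j\<close> differs from \<open>p * N\<close> by at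
  most \<open>D N\<close>, which is o(N); there a j is asymptotically L / (p N)^\<alpha>, uniformly.
  So the average is this value times the sum of squared weights, whose asymptotics are
  known.\<close>

lemma binomial_square_average:
  fixes a :: "nat \<Rightarrow> real"
  assumes p: "0 < p" "p < 1" and \<alpha>: "0 \<le> \<alpha>" and lim: "(\<lambda>N. a N * real N powr \<alpha>) \<longlonglongrightarrow> L"
  shows "(\<lambda>N. sqrt (real N) * real N powr \<alpha> * (\<Sum>j\<le>N. (binomial_weight p N j)\<^sup>2 * a j))
    \<longlonglongrightarrow> L / p powr \<alpha> / (2 * sqrt (pi * p * (1 - p)))"
proof -
  define D where "D N = real N powr (2/3)" for N :: nat
  define near where "near N = {j. j \<le> N \<and> \<bar>real j - p * real N\<bar> \<le> D N}" for N
  define far where "far N = {j. j \<le> N \<and> \<bar>real j - p * real N\<bar> > D N}" for N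
  define e where "e N j = real N powr \<alpha> * a j - L / p powr \<alpha>" for N j
  define S where "S N = (\<Sum>j\<le>N. (binomial_weight p N j)\<^sup>2)" for N
  have fin: "finite (near N)" "finite (far N)" for N unfolding near_def far_def by simp_all
  have split: "{..N} = near N \<union> far N" "near N \<inter> far N = {}" for N by (auto simp: near_def far_def)
  have w: "0 \<le> binomial_weight p N j" for N j using p by (simp add: binomial_weight_nonneg)
  \<comment> \<open>The worst index of the window is selected for each \<open>N\<close>. Uniform
    convergence on the windows thereby reduces to convergence of \<open>a\<close> along the single
    sequence \<open>m\<close>, which tends to infinity because \<open>m N / N\<close> tends to
    \<open>p\<close>.\<close>
  have "\<exists>j. \<bar>real j - p * real N\<bar> \<le> D N \<and> (\<forall>i\<in>near N. \<bar>e N i\<bar> \<le> \<bar>e N j\<bar>)" if "N > 0" for N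
  proof -
    have "\<bar>real (nat \<lfloor>p * N\<rfloor>) - p * real N\<bar> \<le> 1" using p by (simp add: of_nat_nat) linarith
    also have "1 \<le> D N" using that by (simp add: D_def ge_one_powr_ge_zero)
    finally have "\<bar>real (nat \<lfloor>p * N\<rfloor>) - p * real N\<bar> \<le> D N" .
    moreover have "nat \<lfloor>p * N\<rfloor> \<le> N"
      using p by (simp add: floor_le_iff nat_le_iff mult_left_le_one_le le_less_trans[of "p * N" N])
    ultimately have ne: "near N \<noteq> {}" by (auto simp: near_def)
    then have "Max ((\<lambda>i. \<bar>e N i\<bar>) ` near N) \<in> (\<lambda>i. \<bar>e N i\<bar>) ` near N" using fin by (intro Max_in) auto
    then obtain j where "j \<in> near N" "Max ((\<lambda>i. \<bar>e N i\<bar>) ` near N) = \<bar>e N j\<bar>" by auto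
    moreover have "\<bar>e N i\<bar> \<le> Max ((\<lambda>i. \<bar>e N i\<bar>) ` near N)" if "i \<in> near N" for i
      using fin that by (intro Max_ge) auto
    ultimately show ?thesis by (intro exI[of _ j]) (auto simp: near_def)
  qed
  then obtain m where m: "\<And>N. N > 0 \<Longrightarrow> \<bar>real (m N) - p * real N\<bar> \<le> D N"
    "\<And>N i. N > 0 \<Longrightarrow> i \<in> near N \<Longrightarrow> \<bar>e N i\<bar> \<le> \<bar>e N (m N)\<bar>" by metis
  have mN: "(\<lambda>N. real (m N) / real N) \<longlonglongrightarrow> p"
  proof -
    have "(\<lambda>N. real (m N) / real N - p) \<longlonglongrightarrow> 0"
    proof (rule Lim_null_comparison)
      show "eventually (\<lambda>N. norm (real (m N) / real N - p) \<le> D N / real N) sequentially"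
        using eventually_gt_at_top[of 0]
      proof eventually_elim
        case (elim N)
        have "real (m N) / real N - p = (real (m N) - p * real N) / real N" using elim by (simp add: field_simps)
        then show ?case using m(1)[OF elim] by (simp add: abs_divide divide_right_mono)
      qed
      show "(\<lambda>N. D N / real N) \<longlonglongrightarrow> 0" unfolding D_def by real_asymp
    qed
    from tendsto_add[OF this tendsto_const[of p]] show ?thesis by simp
  qed
  have minf: "filterlim m at_top sequentially" by (rule filterlim_at_top_of_ratio[OF mN p(1)])
  have em: "(\<lambda>N. \<bar>e N (m N)\<bar>) \<longlonglongrightarrow> 0"
  proof -
    have "(\<lambda>N. a (m N) * real (m N) powr \<alpha> / (real (m N) / real N) powr \<alpha>) \<longlonglongrightarrow> L / p powr \<alpha>"
      using p by (intro tendsto_divide tendsto_powr mN tendsto_const filterlim_compose[OF lim minf]) auto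
    moreover have "eventually (\<lambda>N. m N > 0) sequentially"
      using minf[unfolded filterlim_at_top, rule_format, of 1] by (rule eventually_mono) simp
    then have "eventually (\<lambda>N. a (m N) * real (m N) powr \<alpha> / (real (m N) / real N) powr \<alpha> = real N powr \<alpha> * a (m N)) sequentially"
      using eventually_gt_at_top[of 0] by eventually_elim (simp add: powr_divide)
    ultimately have "(\<lambda>N. real N powr \<alpha> * a (m N)) \<longlonglongrightarrow> L / p powr \<alpha>" by (rule Lim_transform_eventually)
    from tendsto_diff[OF this tendsto_const[of "L / p powr \<alpha>"]] show ?thesis
      unfolding e_def by (intro tendsto_rabs_zero) simp
  qed
  \<comment> \<open>Since \<alpha> is nonnegative, boundedness of the normalised sequence bounds
    \<open>a\<close> itself; index 0 is added separately because \<open>0 powr \<alpha>\<close> is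
    0.\<close>
  obtain K where K: "K > 0" "\<And>j. \<bar>a j\<bar> \<le> K"
  proof -
    have "Bseq (\<lambda>N. a N * real N powr \<alpha>)" using lim by (intro convergent_imp_Bseq) (auto simp: convergent_def)
    then obtain B where B: "B > 0" "\<And>N. norm (a N * real N powr \<alpha>) \<le> B" by (auto simp: Bseq_def)
    have "\<bar>a j\<bar> \<le> B + \<bar>a 0\<bar>" for j
    proof (cases "j = 0")
      case False
      then have "1 \<le> real j powr \<alpha>" using \<alpha> by (simp add: ge_one_powr_ge_zero)
      then have "\<bar>a j\<bar> * 1 \<le> \<bar>a j\<bar> * real j powr \<alpha>" by (intro mult_left_mono) auto
      also have "\<dots> \<le> B" using B(2)[of j] by (simp add: abs_mult)
      finally show ?thesis by simp
    qed (use B in simp)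
    then show ?thesis using B(1) by (intro that[of "B + \<bar>a 0\<bar>"]) auto
  qed
  have S: "(\<lambda>N. sqrt (real N) * S N) \<longlonglongrightarrow> 1 / (2 * sqrt (pi * p * (1 - p)))"
    using sum_binomial_squares_asymp[OF p] by (simp add: S_def binomial_weight_def)
  have diff: "(\<lambda>N. sqrt (real N) * (\<Sum>j\<le>N. (binomial_weight p N j)\<^sup>2 * e N j)) \<longlonglongrightarrow> 0"
  proof (rule Lim_null_comparison)
    let ?K = "\<lambda>N. K * real N powr \<alpha> + \<bar>L / p powr \<alpha>\<bar>"
    show "eventually (\<lambda>N. norm (sqrt (real N) * (\<Sum>j\<le>N. (binomial_weight p N j)\<^sup>2 * e N j))
      \<le> (sqrt (real N) * S N) * \<bar>e N (m N)\<bar> + sqrt (real N) * ?K N * (2 * exp (1 - real N powr (1/6)))) sequentially"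
      using eventually_gt_at_top[of 0]
    proof eventually_elim
      case (elim N)
      have eb: "\<bar>e N j\<bar> \<le> ?K N" for j
      proof -
        have "\<bar>e N j\<bar> \<le> \<bar>real N powr \<alpha> * a j\<bar> + \<bar>L / p powr \<alpha>\<bar>" unfolding e_def by (rule abs_triangle_ineq4)
        also have "\<bar>real N powr \<alpha> * a j\<bar> \<le> K * real N powr \<alpha>"
          using K(2)[of j] by (simp add: abs_mult mult.commute mult_right_mono)
        finally show ?thesis by simp
      qed
      have "\<bar>\<Sum>j\<le>N. (binomial_weight p N j)\<^sup>2 * e N j\<bar> \<le> (\<Sum>j\<le>N. (binomial_weight p N j)\<^sup>2 * \<bar>e N j\<bar>)"
        by (rule order.trans[OF sum_abs]) (simp add: abs_mult)
      also have "\<dots> = (\<Sum>j\<in>near N. (binomial_weight p N j)\<^sup>2 * \<bar>e N j\<bar>) + (\<Sum>j\<in>far N. (binomial_weight p N j)\<^sup>2 * \<bar>e N j\<bar>)"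
        unfolding split(1) by (rule sum.union_disjoint[OF fin split(2)])
      also have "(\<Sum>j\<in>near N. (binomial_weight p N j)\<^sup>2 * \<bar>e N j\<bar>) \<le> (\<Sum>j\<in>near N. (binomial_weight p N j)\<^sup>2 * \<bar>e N (m N)\<bar>)"
        using m(2)[OF elim] by (intro sum_mono mult_left_mono) auto
      also have "\<dots> \<le> S N * \<bar>e N (m N)\<bar>"
        unfolding S_def sum_distrib_right by (rule sum_mono2) (auto simp: near_def)
      also have "(\<Sum>j\<in>far N. (binomial_weight p N j)\<^sup>2 * \<bar>e N j\<bar>) \<le> (\<Sum>j\<in>far N. binomial_weight p N j * ?K N)"
      proof (intro sum_mono mult_mono eb)
        \<comment> \<open>A weight is at most the total weight 1, so its square is at most itself
          and the plain binomial tail bound applies.\<close>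
        fix j assume j: "j \<in> far N"
        have "binomial_weight p N j \<le> (\<Sum>j\<le>N. binomial_weight p N j)"
          using j w by (intro member_le_sum) (auto simp: far_def)
        then show "(binomial_weight p N j)\<^sup>2 \<le> binomial_weight p N j"
          using w[of N j] by (simp add: sum_binomial_weight power2_eq_square mult_left_le)
      qed (use w in auto)
      also have "\<dots> = ?K N * (\<Sum>j\<in>far N. binomial_weight p N j)"
        by (simp only: sum_distrib_right[symmetric] mult.commute)
      also have "\<dots> \<le> ?K N * (2 * exp (1 - real N powr (1/6)))"
      proof (rule mult_left_mono)
        let ?l = "real N powr (-1/2)"
        have l2: "?l\<^sup>2 * real N = 1" "?l * D N = real N powr (1/6)"
          using powr_minus_half_square[OF elim] unfolding D_def powr_add[symmetric] by simp_all
        have "?l \<le> 1" using elim powr_mono[of "-1/2" 0 "real N"] by simp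
        then have "(\<Sum>j\<in>far N. binomial_weight p N j) \<le> 2 * exp (?l\<^sup>2 * real N - ?l * D N)"
          unfolding far_def using p by (intro binomial_tail) auto
        then show "(\<Sum>j\<in>far N. binomial_weight p N j) \<le> 2 * exp (1 - real N powr (1/6))" by (simp only: l2)
      qed (use K in auto)
      finally have "\<bar>\<Sum>j\<le>N. (binomial_weight p N j)\<^sup>2 * e N j\<bar> \<le> S N * \<bar>e N (m N)\<bar> + ?K N * (2 * exp (1 - real N powr (1/6)))" by simp
      from mult_left_mono[OF this, of "sqrt (real N)"]
      show ?case by (simp add: abs_mult algebra_simps)
    qed
    have near_lim: "(\<lambda>N. (sqrt (real N) * S N) * \<bar>e N (m N)\<bar>) \<longlonglongrightarrow> 1 / (2 * sqrt (pi * p * (1 - p))) * 0"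
      by (intro tendsto_mult S em)
    have far_lim: "(\<lambda>N. sqrt (real N) * ?K N * (2 * exp (1 - real N powr (1/6)))) \<longlonglongrightarrow> 0"
    proof -
      define M where "M = \<bar>L / p powr \<alpha>\<bar>"
      have "M \<ge> 0" by (simp add: M_def)
      have 1: "(\<lambda>N::nat. sqrt (real N) * real N powr \<alpha> * (2 * exp (1 - real N powr (1/6)))) \<longlonglongrightarrow> 0" by real_asymp
      have 2: "(\<lambda>N::nat. sqrt (real N) * (2 * exp (1 - real N powr (1/6)))) \<longlonglongrightarrow> 0" by real_asymp
      have "(\<lambda>N::nat. K * (sqrt (real N) * real N powr \<alpha> * (2 * exp (1 - real N powr (1/6)))) + M * (sqrt (real N) * (2 * exp (1 - real N powr (1/6))))) \<longlonglongrightarrow> K * 0 + M * 0"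
        by (intro tendsto_add tendsto_mult tendsto_const 1 2)
      moreover have "sqrt (real N) * (K * real N powr \<alpha> + M) * E = K * (sqrt (real N) * real N powr \<alpha> * E) + M * (sqrt (real N) * E)"
        for N and E :: real
        by (simp only: distrib_left distrib_right mult_ac)
      ultimately show ?thesis unfolding M_def[symmetric] by (simp only: mult_zero_right add_0_right)
    qed
    show "(\<lambda>N. (sqrt (real N) * S N) * \<bar>e N (m N)\<bar> + sqrt (real N) * ?K N * (2 * exp (1 - real N powr (1/6)))) \<longlonglongrightarrow> 0"
      using tendsto_add[OF near_lim far_lim] by (simp only: mult_zero_right add_0_right)
  qed
  have "(\<lambda>N. sqrt (real N) * (\<Sum>j\<le>N. (binomial_weight p N j)\<^sup>2 * e N j) + L / p powr \<alpha> * (sqrt (real N) * S N))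
      \<longlonglongrightarrow> 0 + L / p powr \<alpha> * (1 / (2 * sqrt (pi * p * (1 - p))))"
    by (intro tendsto_add diff tendsto_mult tendsto_const S)
  moreover have "sqrt (real N) * (\<Sum>j\<le>N. (binomial_weight p N j)\<^sup>2 * e N j) + L / p powr \<alpha> * (sqrt (real N) * S N)
      = sqrt (real N) * real N powr \<alpha> * (\<Sum>j\<le>N. (binomial_weight p N j)\<^sup>2 * a j)" for N
    by (simp add: S_def e_def right_diff_distrib sum_subtractf sum_distrib_left mult_ac)
  ultimately show ?thesis by simp
qed

text \<open>After division by (k+1)^(2N) the recursion for \<open>pair_count\<close> becomes the
  average of the normalised count for \<open>k\<close> letters against squared binomial weights with
  p = k/(k+1), so \<open>binomial_square_average\<close> carries the induction. Each step
  contributes a factor N^(-1/2).\<close>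

theorem pair_count_asymp:
  assumes "k \<ge> 1"
  shows "(\<lambda>N. real (pair_count k N) / real k ^ (2 * N) * real N powr ((real k - 1) / 2))
    \<longlonglongrightarrow> real k powr (real k / 2) / (4 * pi) powr ((real k - 1) / 2)"
  using assms
proof (induction k rule: nat_induct_at_least)
  case base
  have one: "pair_count 1 N = 1" for N
  proof -
    have "pair_count 1 N = (\<Sum>j\<le>N. if j = 0 then 1 else 0)"
      unfolding One_nat_def pair_count.simps by (intro sum.cong) auto
    then show ?thesis by simp
  qed
  \<comment> \<open>Only eventually: at \<open>N = 0\<close> the factor \<open>0 powr 0\<close> is
    0.\<close>
  have "eventually (\<lambda>N. 1 = real (pair_count 1 N) / real 1 ^ (2 * N) * real N powr ((real 1 - 1) / 2)) sequentially"
    using eventually_gt_at_top[of 0] by eventually_elim (simp add: one[unfolded One_nat_def] del: pair_count.simps)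
  from Lim_transform_eventually[OF tendsto_const this] show ?case by simp
next
  case (Suc k)
  \<comment> \<open>The probability that a random letter of an alphabet of size k + 1 differs from
    the letter split off.\<close>
  define p where "p = real k / (real k + 1)"
  define \<alpha> where "\<alpha> = (real k - 1) / 2"
  define a where "a j = real (pair_count k j) / real k ^ (2 * j)" for j
  have k: "real k \<ge> 1" using Suc.hyps by simp
  have p: "0 < p" "p < 1" "1 - p = 1 / (real k + 1)" using k by (auto simp: p_def field_simps)
  have "0 \<le> \<alpha>" using k by (simp add: \<alpha>_def)
  note lim = binomial_square_average[OF p(1,2) this Suc.IH[folded a_def \<alpha>_def]]
  have wt: "(binomial_weight p N j)\<^sup>2 * a j = real ((N choose j)\<^sup>2 * pair_count k j) / (real k + 1) ^ (2 * N)" if "j \<le> N" for N j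
  proof -
    have "(real k + 1) ^ j * (real k + 1) ^ (N - j) = (real k + 1) ^ N"
      using that by (simp flip: power_add)
    then have "binomial_weight p N j = real (N choose j) * real k ^ j / (real k + 1) ^ N"
      unfolding binomial_weight_def p(3) unfolding p_def by (simp add: power_divide)
    then show ?thesis using k
      by (simp add: a_def power_mult_distrib power_divide power_mult[symmetric] mult.commute[of _ 2])
  qed
  have sums: "(\<Sum>j\<le>N. (binomial_weight p N j)\<^sup>2 * a j) = real (pair_count (Suc k) N) / real (Suc k) ^ (2 * N)" for N
  proof -
    have "(\<Sum>j\<le>N. (binomial_weight p N j)\<^sup>2 * a j) = (\<Sum>j\<le>N. real ((N choose j)\<^sup>2 * pair_count k j) / (real k + 1) ^ (2 * N))"
      by (intro sum.cong wt) auto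
    then show ?thesis by (simp add: add.commute flip: sum_divide_distrib)
  qed
  have pw: "sqrt (real N) * real N powr \<alpha> = real N powr ((real (Suc k) - 1) / 2)" for N
  proof -
    have "sqrt (real N) = real N powr (1/2)" by (simp add: powr_half_sqrt)
    then show ?thesis by (simp add: \<alpha>_def powr_add[symmetric] add_divide_distrib[symmetric])
  qed
  \<comment> \<open>With x = k and y = k + 1, the powers of x cancel because (x - 1)/2 + 1/2 = x/2,
    while y collects the exponent 1 + (x - 1)/2 = y/2.\<close>
  have const: "real k powr (real k / 2) / (4 * pi) powr \<alpha> / p powr \<alpha> / (2 * sqrt (pi * p * (1 - p)))
      = real (Suc k) powr (real (Suc k) / 2) / (4 * pi) powr ((real (Suc k) - 1) / 2)"
  proof -
    define x where "x = real k"
    define y where "y = real k + 1"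
    have pos: "x > 0" "y > 0" "x = y - 1" using k by (auto simp: x_def y_def)
    have s: "sqrt z = z powr (1/2)" if "z \<ge> 0" for z :: real using that by (simp add: powr_half_sqrt)
    have sq: "2 * sqrt (pi * p * (1 - p)) = (4 * pi) powr (1/2) * x powr (1/2) / y"
    proof -
      have "pi * p * (1 - p) = pi * x / y ^ 2" unfolding p(3) by (simp add: p_def x_def y_def power2_eq_square)
      then have "2 * sqrt (pi * p * (1 - p)) = sqrt (4 * pi) * sqrt x / y"
        using pos by (simp add: real_sqrt_divide real_sqrt_mult)
      then show ?thesis using pos by (simp add: s)
    qed
    have "x powr (x / 2) / (4 * pi) powr ((x - 1) / 2) / (x / y) powr ((x - 1) / 2) / ((4 * pi) powr (1/2) * x powr (1/2) / y)
        = (x powr (x / 2) / (x powr ((x - 1) / 2) * x powr (1/2))) * (y * y powr ((x - 1) / 2)) / ((4 * pi) powr ((x - 1) / 2) * (4 * pi) powr (1/2))"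
      using pos(1,2) by (simp add: powr_divide mult_ac)
    also have "x powr ((x - 1) / 2) * x powr (1/2) = x powr (x / 2)"
      by (simp add: powr_add[symmetric] add_divide_distrib[symmetric])
    also have "y * y powr ((x - 1) / 2) = y powr (y / 2)"
    proof -
      have "y * y powr ((x - 1) / 2) = y powr (1 + (x - 1) / 2)" using pos by (simp add: powr_add)
      also have "1 + (x - 1) / 2 = y / 2" unfolding pos(3) by (simp add: field_simps)
      finally show ?thesis .
    qed
    also have "(4 * pi) powr ((x - 1) / 2) * (4 * pi) powr (1/2) = (4 * pi) powr (x / 2)"
      by (simp add: powr_add[symmetric] add_divide_distrib[symmetric])
    finally show ?thesis unfolding sq \<alpha>_def using pos by (simp add: p_def x_def y_def add.commute)
  qed
  show ?case using lim unfolding sums pw const by (simp only: mult.commute)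
qed

section \<open>Integer vectors with zero sum in a box\<close>

text \<open>Fixing the entry at \<open>c\<close> leaves a vector on \<open>C\<close> with a smaller
  sum; the resulting convolution is multiplication by one more truncated geometric series.\<close>

lemma card_bounded_compositions:
  assumes "finite C"
  shows "real (card {x \<in> C \<rightarrow>\<^sub>E {..<m}. sum x C = (n::nat)})
    = fps_nth ((\<Sum>i<m. fps_X ^ i) ^ card C :: real fps) n"
  using assms
proof (induction C arbitrary: n rule: finite_induct)
  case empty
  have "{x \<in> {} \<rightarrow>\<^sub>E {..<m}. sum x {} = n} = (if n = 0 then {\<lambda>x. undefined} else {})"
    by auto
  then show ?case by simp
next
  case (insert c C)
  define T where "T n = {x \<in> C \<rightarrow>\<^sub>E {..<m}. sum x C = n}" for n
  define T' where "T' n = {x \<in> insert c C \<rightarrow>\<^sub>E {..<m}. sum x (insert c C) = n}" for n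
  have finT: "finite (T n)" for n
    unfolding T_def by (rule finite_subset[of _ "C \<rightarrow>\<^sub>E {..<m}"]) (use insert in \<open>auto simp: finite_PiE\<close>)
  have upd: "(\<Sum>y\<in>C. if y = c then i else x y) = sum x C" for x :: "'a \<Rightarrow> nat" and i
    using insert by (intro sum.cong) auto
  have "bij_betw (\<lambda>(i, x). x(c := i)) (SIGMA i:{i. i < m \<and> i \<le> n}. T (n - i)) (T' n)"
  proof (rule bij_betw_byWitness[where f' = "\<lambda>x. (x c, x(c := undefined))"])
    show "\<forall>a\<in>SIGMA i:{i. i < m \<and> i \<le> n}. T (n - i). (\<lambda>x. (x c, x(c := undefined))) ((\<lambda>(i, x). x(c := i)) a) = a"
      using insert.hyps by (auto simp: T_def fun_eq_iff PiE_iff extensional_def)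
    show "\<forall>a'\<in>T' n. (\<lambda>(i, x). x(c := i)) ((\<lambda>x. (x c, x(c := undefined))) a') = a'" by auto
    show "(\<lambda>(i, x). x(c := i)) ` (SIGMA i:{i. i < m \<and> i \<le> n}. T (n - i)) \<subseteq> T' n"
      using insert.hyps by (auto simp: T_def T'_def upd PiE_iff extensional_def)
    show "(\<lambda>x. (x c, x(c := undefined))) ` T' n \<subseteq> (SIGMA i:{i. i < m \<and> i \<le> n}. T (n - i))"
      using insert.hyps by (auto simp: T_def T'_def upd PiE_iff extensional_def)
  qed
  then have "card (T' n) = card (SIGMA i:{i. i < m \<and> i \<le> n}. T (n - i))"
    by (simp add: bij_betw_same_card)
  also have "\<dots> = (\<Sum>i | i < m \<and> i \<le> n. card (T (n - i)))"
    using finT by (intro card_SigmaI) auto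
  finally have "real (card (T' n)) = (\<Sum>i | i < m \<and> i \<le> n. fps_nth ((\<Sum>i<m. fps_X ^ i) ^ card C) (n - i))"
    using insert.IH by (simp add: T_def)
  also have "\<dots> = (\<Sum>i\<le>n. if i < m then fps_nth ((\<Sum>i<m. fps_X ^ i) ^ card C) (n - i) else 0)"
    by (rule sum.mono_neutral_cong_left) auto
  also have "\<dots> = fps_nth ((\<Sum>i<m. fps_X ^ i) * (\<Sum>i<m. fps_X ^ i) ^ card C) n"
  proof -
    have "fps_nth (\<Sum>i<m. fps_X ^ i :: real fps) i = (if i < m then 1 else 0)" for i
      by (simp add: fps_sum_nth)
    then show ?thesis by (auto simp: fps_mult_nth atMost_atLeast0 intro!: sum.cong)
  qed
  finally show ?case using insert.hyps by (simp add: T'_def)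
qed

lemma fps_nth_truncated_geometric_power:
  assumes "k > 0"
  shows "fps_nth ((\<Sum>i<m. fps_X ^ i) ^ k :: real fps) n
    = (\<Sum>j\<in>{0..k}. (-1) ^ j * real (k choose j) * (if j * m \<le> n then real ((k + (n - j * m) - 1) choose (k - 1)) else 0))"
proof -
  let ?G = "inverse ((1 - fps_X) ^ k) :: real fps"
  have "(\<Sum>i<m. fps_X ^ i) * (1 - fps_X) = (1 - fps_X ^ m :: real fps)"
    by (metis mult.commute one_diff_power_eq)
  moreover have "(1 - fps_X) * inverse (1 - fps_X) = (1 :: real fps)"
    by (rule inverse_mult_eq_1') simp
  ultimately have "(\<Sum>i<m. fps_X ^ i) = (1 - fps_X ^ m) * inverse (1 - fps_X :: real fps)"
    by (metis mult.assoc mult.right_neutral)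
  then have "(\<Sum>i<m. fps_X ^ i) ^ k = (1 - fps_X ^ m) ^ k * ?G"
    by (simp add: power_mult_distrib fps_inverse_power)
  also have "(1 - fps_X ^ m :: real fps) ^ k = (\<Sum>j\<in>{0..k}. fps_const ((-1) ^ j * real (k choose j)) * fps_X ^ (j * m))"
  proof -
    have "(- (fps_X ^ m) + 1 :: real fps) ^ k = (\<Sum>j\<le>k. of_nat (k choose j) * (- (fps_X ^ m)) ^ j * 1 ^ (k - j))"
      by (rule binomial_ring)
    also have "\<dots> = (\<Sum>j\<in>{0..k}. fps_const ((-1) ^ j * real (k choose j)) * fps_X ^ (j * m))"
    proof (rule sum.cong)
      fix j
      have "(- (fps_X ^ m) :: real fps) ^ j = fps_const ((-1) ^ j) * fps_X ^ (j * m)"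
        by (subst power_minus) (simp add: power_mult[symmetric] mult.commute fps_const_power[symmetric] fps_const_neg[symmetric] del: fps_const_neg fps_const_power)
      then show "of_nat (k choose j) * (- (fps_X ^ m)) ^ j * 1 ^ (k - j) = fps_const ((-1) ^ j * real (k choose j)) * fps_X ^ (j * m)"
        by (simp add: fps_of_nat[symmetric] fps_const_mult[symmetric] mult_ac del: fps_const_mult fps_const_power)
    qed auto
    finally show ?thesis by simp
  qed
  finally have "fps_nth ((\<Sum>i<m. fps_X ^ i) ^ k) n
     = (\<Sum>j\<in>{0..k}. (-1) ^ j * real (k choose j) * fps_nth (fps_X ^ (j * m) * ?G) n)"
    by (simp add: sum_distrib_right fps_sum_nth mult.assoc)
  also have "\<dots> = (\<Sum>j\<in>{0..k}. (-1) ^ j * real (k choose j) * (if j * m \<le> n then real ((k + (n - j * m) - 1) choose (k - 1)) else 0))"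
  proof (intro sum.cong refl arg_cong2[of _ _ _ _ "(*)"])
    fix j
    have G: "?G = Abs_fps (\<lambda>i. real ((k + i - 1) choose i))"
      using one_minus_const_fps_X_neg_power'[OF assms, of "1::real"] by simp
    \<comment> \<open>The lower index is switched to the fixed number \<open>k - 1\<close>, so that
      the coefficient is visibly a polynomial of degree \<open>k - 1\<close> in
      \<open>i\<close>.\<close>
    have "real ((k + i - 1) choose i) = real ((k + i - 1) choose (k - 1))" for i
      using assms binomial_symmetric[of i "k + i - 1"] by simp
    then show "fps_nth (fps_X ^ (j * m) * ?G) n = (if j * m \<le> n then real ((k + (n - j * m) - 1) choose (k - 1)) else 0)"
      unfolding G by (simp add: fps_X_power_mult_nth)
  qed
  finally show ?thesis .
qed

definition zero_sum_box :: "'c set \<Rightarrow> nat \<Rightarrow> ('c \<Rightarrow> int) set" where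
  "zero_sum_box C M = {s \<in> C \<rightarrow>\<^sub>E {- int M..int M}. sum s C = 0}"

lemma finite_zero_sum_box: "finite C \<Longrightarrow> finite (zero_sum_box C M)"
  unfolding zero_sum_box_def
  by (rule finite_subset[of _ "C \<rightarrow>\<^sub>E {- int M..int M}"]) (auto simp: finite_PiE)

text \<open>Adding \<open>M\<close> to every entry turns the box into \<open>k\<close> nonnegative
  parts below \<open>2 * M + 1\<close> with total \<open>k * M\<close>.\<close>

lemma card_zero_sum_box:
  assumes C: "finite C" "card C = k" "k > 0"
  shows "real (card (zero_sum_box C M)) = (\<Sum>j\<in>{0..k}. (-1) ^ j * real (k choose j) *
    (if j * (2 * M + 1) \<le> k * M then real ((k + (k * M - j * (2 * M + 1)) - 1) choose (k - 1)) else 0))"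
proof -
  have "bij_betw (\<lambda>s. restrict (\<lambda>c. nat (s c + int M)) C) (zero_sum_box C M) {x \<in> C \<rightarrow>\<^sub>E {..<2 * M + 1}. sum x C = k * M}"
  proof (rule bij_betw_byWitness[where f' = "\<lambda>x. restrict (\<lambda>c. int (x c) - int M) C"])
    show "\<forall>a\<in>zero_sum_box C M. restrict (\<lambda>c. int (restrict (\<lambda>c. nat (a c + int M)) C c) - int M) C = a"
      by (force simp: zero_sum_box_def fun_eq_iff PiE_iff extensional_def restrict_def)
    show "\<forall>a'\<in>{x \<in> C \<rightarrow>\<^sub>E {..<2 * M + 1}. sum x C = k * M}. restrict (\<lambda>c. nat (restrict (\<lambda>c. int (a' c) - int M) C c + int M)) C = a'"
      by (auto simp: fun_eq_iff PiE_iff extensional_def restrict_def)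
    show "(\<lambda>s. restrict (\<lambda>c. nat (s c + int M)) C) ` zero_sum_box C M \<subseteq> {x \<in> C \<rightarrow>\<^sub>E {..<2 * M + 1}. sum x C = k * M}"
    proof (rule image_subsetI)
      fix s assume s: "s \<in> zero_sum_box C M"
      then have b: "- int M \<le> s c" "s c \<le> int M" if "c \<in> C" for c
        using that by (auto simp: zero_sum_box_def PiE_iff)
      have "int (\<Sum>c\<in>C. nat (s c + int M)) = (\<Sum>c\<in>C. s c + int M)"
        unfolding of_nat_sum using b by (intro sum.cong) force+
      also have "\<dots> = int (k * M)" using s C by (simp add: sum.distrib zero_sum_box_def)
      finally have "(\<Sum>c\<in>C. nat (s c + int M)) = k * M" by linarith
      then show "restrict (\<lambda>c. nat (s c + int M)) C \<in> {x \<in> C \<rightarrow>\<^sub>E {..<2 * M + 1}. sum x C = k * M}"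
        using b by force
    qed
    show "(\<lambda>x. restrict (\<lambda>c. int (x c) - int M) C) ` {x \<in> C \<rightarrow>\<^sub>E {..<2 * M + 1}. sum x C = k * M} \<subseteq> zero_sum_box C M"
      using C by (force simp: zero_sum_box_def sum_subtractf of_nat_sum[symmetric] PiE_iff simp del: of_nat_sum)
  qed
  then have "card (zero_sum_box C M) = card {x \<in> C \<rightarrow>\<^sub>E {..<2 * M + 1}. sum x C = k * M}"
    by (rule bij_betw_same_card)
  then show ?thesis
    using card_bounded_compositions[OF C(1), of "2 * M + 1" "k * M"] fps_nth_truncated_geometric_power[OF C(3), of "2 * M + 1" "k * M"] C
    by simp
qed

lemma binomial_linear_asymp:
  fixes f :: "nat \<Rightarrow> nat"
  assumes "(\<lambda>M. real (f M) / real M) \<longlonglongrightarrow> c"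
  shows "(\<lambda>M. real (f M choose r) / real M ^ r) \<longlonglongrightarrow> c ^ r / fact r"
proof -
  have "(\<lambda>M. (\<Prod>i<r. (real (f M) / real M - real i / real M)) / fact r) \<longlonglongrightarrow> (\<Prod>i<r. c - 0) / fact r"
  proof (intro tendsto_divide tendsto_prod tendsto_diff assms tendsto_const)
    show "(\<lambda>M. real i / real M) \<longlonglongrightarrow> 0" for i by real_asymp
  qed auto
  moreover have "(\<Prod>i<r. (real (f M) / real M - real i / real M)) / fact r = real (f M choose r) / real M ^ r" for M
  proof -
    have "real (f M choose r) = (\<Prod>i<r. real (f M) - real i) / fact r"
      by (simp add: binomial_gbinomial gbinomial_prod_rev atLeast0LessThan)
    moreover have "(\<Prod>i<r. (real (f M) / real M - real i / real M)) = (\<Prod>i<r. real (f M) - real i) / real M ^ r"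
      by (simp add: diff_divide_distrib[symmetric] prod_dividef)
    ultimately show ?thesis by simp
  qed
  ultimately show ?thesis by simp
qed

text \<open>In the term \<open>j\<close> the argument of the binomial coefficient grows like (k - 2
  j) M as long as 2 j < k; the other terms vanish identically. The number of terms stays fixed, so
  limits can be taken one by one.\<close>

lemma card_zero_sum_box_asymp:
  assumes C: "finite C" "card C = k" "k > 0"
  shows "(\<lambda>M. real (card (zero_sum_box C M)) / real M ^ (k - 1)) \<longlonglongrightarrow> Z_star k"
proof -
  define t where "t M j = (if j * (2 * M + 1) \<le> k * M then real ((k + (k * M - j * (2 * M + 1)) - 1) choose (k - 1)) else 0)" for M j
  have lim: "(\<lambda>M. t M j / real M ^ (k - 1)) \<longlonglongrightarrow> (if j \<le> k div 2 then (real k - 2 * real j) ^ (k - 1) / fact (k - 1) else 0)" for j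
  proof (cases "2 * j < k")
    case True
    have ev: "eventually (\<lambda>M. j * (2 * M + 1) \<le> k * M) sequentially"
      using eventually_ge_at_top[of j]
    proof eventually_elim
      case (elim M)
      have "j * (2 * M + 1) \<le> (2 * j + 1) * M" using elim by (simp add: algebra_simps)
      also have "\<dots> \<le> k * M" using True by (intro mult_right_mono) auto
      finally show ?case .
    qed
    have "(\<lambda>M. real (k + (k * M - j * (2 * M + 1)) - 1) / real M) \<longlonglongrightarrow> real k - 2 * real j"
    proof -
      have "(\<lambda>M. ((real k - 2 * real j) * real M + (real k - 1 - real j)) / real M) \<longlonglongrightarrow> real k - 2 * real j"
        by real_asymp
      moreover have "eventually (\<lambda>M. ((real k - 2 * real j) * real M + (real k - 1 - real j)) / real M = real (k + (k * M - j * (2 * M + 1)) - 1) / real M) sequentially"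
        using ev
      proof eventually_elim
        case (elim M)
        have "real (k + (k * M - j * (2 * M + 1)) - 1) = real k + (real (k * M) - real (j * (2 * M + 1))) - 1"
          using elim C(3) by (simp add: of_nat_diff)
        then show ?case by (simp add: algebra_simps)
      qed
      ultimately show ?thesis by (rule Lim_transform_eventually)
    qed
    then have "(\<lambda>M. real ((k + (k * M - j * (2 * M + 1)) - 1) choose (k - 1)) / real M ^ (k - 1)) \<longlonglongrightarrow> (real k - 2 * real j) ^ (k - 1) / fact (k - 1)"
      by (rule binomial_linear_asymp)
    moreover have "eventually (\<lambda>M. real ((k + (k * M - j * (2 * M + 1)) - 1) choose (k - 1)) / real M ^ (k - 1) = t M j / real M ^ (k - 1)) sequentially"
      using ev by eventually_elim (simp add: t_def)
    ultimately have "(\<lambda>M. t M j / real M ^ (k - 1)) \<longlonglongrightarrow> (real k - 2 * real j) ^ (k - 1) / fact (k - 1)"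
      by (rule Lim_transform_eventually)
    moreover have "j \<le> k div 2" using True by simp
    ultimately show ?thesis by simp
  next
    case False
    then have j: "k \<le> 2 * j" "j \<ge> 1" using C(3) by auto
    have "t M j = 0" for M
    proof -
      have "k * M \<le> 2 * j * M" using j by (intro mult_right_mono) auto
      also have "\<dots> < j * (2 * M + 1)" using j by (simp add: algebra_simps)
      finally show ?thesis by (simp add: t_def)
    qed
    moreover have "(if j \<le> k div 2 then (real k - 2 * real j) ^ (k - 1) / fact (k - 1) else 0) = 0"
    proof (cases "j \<le> k div 2")
      case True
      \<comment> \<open>The borderline index of \<open>Z_star\<close>: its term is a positive power
        of zero, in agreement with the vanishing of \<open>t\<close>.\<close>
      then have "k = 2 * j" using j by simp
      then show ?thesis using j by simp
    qed simp
    ultimately show ?thesis by simp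
  qed
  have "(\<lambda>M. \<Sum>j\<in>{0..k}. (-1) ^ j * real (k choose j) * (t M j / real M ^ (k - 1)))
    \<longlonglongrightarrow> (\<Sum>j\<in>{0..k}. (-1) ^ j * real (k choose j) * (if j \<le> k div 2 then (real k - 2 * real j) ^ (k - 1) / fact (k - 1) else 0))"
    by (intro tendsto_sum tendsto_mult tendsto_const lim)
  also have "(\<Sum>j\<in>{0..k}. (-1) ^ j * real (k choose j) * (if j \<le> k div 2 then (real k - 2 * real j) ^ (k - 1) / fact (k - 1) else 0))
     = (\<Sum>j\<in>{0..k div 2}. (-1) ^ j * real (k choose j) * ((real k - 2 * real j) ^ (k - 1) / fact (k - 1)))"
    by (rule sum.mono_neutral_cong_right) auto
  also have "\<dots> = Z_star k"
    by (simp add: Z_star_def sum_divide_distrib[symmetric])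
  finally show ?thesis
    unfolding card_zero_sum_box[OF C] t_def by (simp only: sum_divide_distrib times_divide_eq_right)
qed

text \<open>Positivity is invisible in the alternating sum, but the limit of the counts is bounded
  below by an explicit family of vectors: all entries but one range freely over an interval of
  radius about M/(k-1) and the last restores the sum. It is what allows division by the limiting
  constant.\<close>

lemma Z_star_pos:
  assumes "k > 0"
  shows "Z_star k > 0"
proof (cases "k = 1")
  case True
  then show ?thesis by (simp add: Z_star_def)
next
  case False
  define r where "r = k - 1"
  have r: "r > 0" "k = Suc r" using assms False by (auto simp: r_def)
  \<comment> \<open>Radius \<open>M div r\<close> for \<open>r\<close> free entries keeps the last
    entry, minus their sum, within \<open>M\<close>.\<close>
  have card: "(2 * (M div r) + 1) ^ r \<le> card (zero_sum_box {..<k} M)" for M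
  proof -
    let ?B = "{..<r} \<rightarrow>\<^sub>E {- int (M div r)..int (M div r)}"
    let ?h = "\<lambda>s. s(r := - sum s {..<r})"
    have upd: "sum (s(r := x)) {..<r} = sum s {..<r}" for s :: "nat \<Rightarrow> int" and x by (rule sum.cong) auto
    have "inj_on ?h ?B"
    proof (rule inj_onI)
      fix s s' assume s: "s \<in> ?B" "s' \<in> ?B" and e: "?h s = ?h s'"
      show "s = s'"
      proof
        fix c show "s c = s' c" using s fun_cong[OF e, of c] by (cases "c < r") (auto simp: PiE_iff extensional_def)
      qed
    qed
    moreover have "?h ` ?B \<subseteq> zero_sum_box {..<k} M"
    proof (rule image_subsetI)
      fix s assume s: "s \<in> ?B"
      then have b: "\<bar>s c\<bar> \<le> int (M div r)" if "c < r" for c using that by (force simp: PiE_iff)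
      have "\<bar>sum s {..<r}\<bar> \<le> (\<Sum>c<r. \<bar>s c\<bar>)" by (rule sum_abs)
      also have "\<dots> \<le> (\<Sum>c<r. int (M div r))" using b by (intro sum_mono) auto
      also have "\<dots> \<le> int M" by (simp flip: of_nat_mult)
      finally have "\<bar>sum s {..<r}\<bar> \<le> int M" .
      moreover have "\<bar>s c\<bar> \<le> int M" if "c < r" for c
        using b[OF that] div_le_dividend[of M r] by linarith
      ultimately show "?h s \<in> zero_sum_box {..<k} M"
        using s unfolding r(2) zero_sum_box_def
        by (auto simp: lessThan_Suc upd PiE_iff extensional_def abs_le_iff less_Suc_eq; fastforce)
    qed
    ultimately have "card ?B \<le> card (zero_sum_box {..<k} M)"
      by (intro card_inj_on_le finite_zero_sum_box) auto
    moreover have "card ?B = (2 * (M div r) + 1) ^ r"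
      by (simp add: card_funcsetE nat_add_distrib nat_mult_distrib)
    ultimately show ?thesis by simp
  qed
  have "(1 / real r) ^ r \<le> Z_star k"
  proof (rule LIMSEQ_le_const[OF card_zero_sum_box_asymp[of "{..<k}" k]])
    show "\<exists>N. \<forall>M\<ge>N. (1 / real r) ^ r \<le> real (card (zero_sum_box {..<k} M)) / real M ^ (k - 1)"
    proof (intro exI allI impI)
      fix M :: nat assume M: "M \<ge> 1"
      have "M = r * (M div r) + M mod r" "M mod r < r" using r by simp_all
      then have "M \<le> r * (M div r + 1)" unfolding distrib_left by linarith
      then have "real M \<le> real r * (M div r + 1)" unfolding of_nat_mult[symmetric] of_nat_le_iff .
      then have "real M / real r \<le> M div r + 1" using r by (simp add: pos_divide_le_eq mult.commute)
      then have "real M / real r \<le> 2 * (M div r) + 1" by linarith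
      then have "(real M / real r) ^ r \<le> real (2 * (M div r) + 1) ^ r" by (intro power_mono) auto
      also have "\<dots> \<le> real (card (zero_sum_box {..<k} M))" using card[of M] unfolding of_nat_power[symmetric] of_nat_le_iff .
      finally show "(1 / real r) ^ r \<le> real (card (zero_sum_box {..<k} M)) / real M ^ (k - 1)"
        using M by (simp add: r(2) field_simps power_divide)
    qed
  qed (use assms in auto)
  moreover have "(1 / real r) ^ r > 0" using r by simp
  ultimately show ?thesis by linarith
qed

section \<open>Well separated shift vectors\<close>

abbreviation positions :: "nat \<Rightarrow> int set" where
  "positions N \<equiv> {0..<int N}"

definition balanced_pairs :: "nat \<Rightarrow> 'c set \<Rightarrow> real \<Rightarrow> ((int \<Rightarrow> 'c) \<times> (int \<Rightarrow> 'c)) set" where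
  "balanced_pairs N C D = {(f, g). (f, g) \<in> equal_content (positions N) (positions N) C \<and> balanced N C D f \<and> balanced N C D g}"

text \<open>When the shifts are pairwise distinct, the shift of a chain serves as its colour, which
  removes the ambiguity of renaming colours: a set of \<open>k\<close> integers replaces a shift vector.\<close>

definition gap_sets :: "nat \<Rightarrow> nat \<Rightarrow> real \<Rightarrow> int set set" where
  "gap_sets k M G = {A. A \<subseteq> {- int M..int M} \<and> card A = k \<and> \<Sum>A = 0 \<and>
     (\<forall>a\<in>A. \<forall>b\<in>A. a \<noteq> b \<longrightarrow> G < real_of_int \<bar>a - b\<bar>)}"

lemma gap_setsD:
  assumes "A \<in> gap_sets k M G"
  shows "finite A" "card A = k"
  using assms finite_subset[of A "{- int M..int M}"] by (auto simp: gap_sets_def)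

lemma finite_gap_sets: "finite (gap_sets k M G)"
  by (rule finite_subset[of _ "Pow {- int M..int M}"]) (auto simp: gap_sets_def)

lemma equal_content_iff_prefix_count:
  "(f, g) \<in> equal_content (positions N) (positions N) C \<longleftrightarrow>
     f \<in> positions N \<rightarrow>\<^sub>E C \<and> g \<in> positions N \<rightarrow>\<^sub>E C \<and> (\<forall>c\<in>C. prefix_count f c (int N) = prefix_count g c (int N))"
  by (simp add: equal_content_def prefix_count_def)

lemma equal_content_prefix_count:
  assumes "(f, g) \<in> equal_content (positions N) (positions N) C"
  shows "prefix_count f c (int N) = prefix_count g c (int N)"
proof (cases "c \<in> C")
  case True
  then show ?thesis using assms by (simp add: equal_content_iff_prefix_count)
next
  case False
  then have "\<not> (\<exists>j\<in>positions N. f j = c)" "\<not> (\<exists>j\<in>positions N. g j = c)"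
    using assms by (auto simp: equal_content_iff_prefix_count PiE_iff)
  then have "\<not> prefix_count f c (int N) > 0" "\<not> prefix_count g c (int N) > 0"
    by (simp_all add: prefix_count_pos_iff)
  then show ?thesis using prefix_count_nonneg[of f c "int N"] prefix_count_nonneg[of g c "int N"] by simp
qed

lemma card_balanced_pairs_le:
  "finite C \<Longrightarrow> card (balanced_pairs N C D) \<le> pair_count (card C) N"
  using card_mono[of "equal_content (positions N) (positions N) C" "balanced_pairs N C D"]
  by (auto simp: card_equal_content finite_equal_content balanced_pairs_def)

text \<open>The parameter \<open>l\<close> is the exponent in the Chernoff bound.\<close>

definition unbalanced_bound :: "nat \<Rightarrow> nat \<Rightarrow> real \<Rightarrow> real \<Rightarrow> real" where
  "unbalanced_bound k N D l = 4 * k * (N + 1) * real k ^ (2 * N) * exp (l\<^sup>2 * N - l * D)"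

text \<open>One word is unbalanced and the other is left arbitrary. Giving up the content condition
  is affordable, since \<open>pair_count k N\<close> is itself \<open>k ^ (2 * N)\<close> up to a
  power of \<open>N\<close>.\<close>

lemma card_unbalanced_pairs:
  fixes l :: real
  assumes C: "finite C" "C \<noteq> {}" and l: "0 \<le> l" "l \<le> 1"
  shows "real (card (equal_content (positions N) (positions N) C - balanced_pairs N C D))
    \<le> unbalanced_bound (card C) N D l"
proof -
  let ?W = "positions N \<rightarrow>\<^sub>E C" and ?U = "{f \<in> positions N \<rightarrow>\<^sub>E C. \<not> balanced N C D f}"
  have fin: "finite ?W" "finite ?U" using C by (simp_all add: finite_PiE)
  have "equal_content (positions N) (positions N) C - balanced_pairs N C D \<subseteq> ?U \<times> ?W \<union> ?W \<times> ?U"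
    by (auto simp: balanced_pairs_def equal_content_def)
  then have "card (equal_content (positions N) (positions N) C - balanced_pairs N C D) \<le> card (?U \<times> ?W \<union> ?W \<times> ?U)"
    using fin by (intro card_mono) auto
  also have "\<dots> \<le> card (?U \<times> ?W) + card (?W \<times> ?U)" by (rule card_Un_le)
  also have "\<dots> = 2 * card C ^ N * card ?U" by (simp add: card_cartesian_product card_funcsetE)
  finally have "real (card (equal_content (positions N) (positions N) C - balanced_pairs N C D)) \<le> real (2 * card C ^ N * card ?U)"
    by (simp only: of_nat_le_iff)
  also have "\<dots> \<le> 2 * real (card C) ^ N * (2 * card C * (N + 1) * (real (card C) ^ N * exp (l\<^sup>2 * N - l * D)))"
  proof -
    have "real (card ?U) \<le> 2 * card C * (N + 1) * (real (card C) ^ N * exp (l\<^sup>2 * N - l * D))"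
      by (rule card_unbalanced_words[OF C l])
    from mult_left_mono[OF this, of "2 * real (card C) ^ N"] show ?thesis by simp
  qed
  also have "\<dots> = unbalanced_bound (card C) N D l"
  proof -
    have "real (card C) ^ (2 * N) = real (card C) ^ N * real (card C) ^ N" by (simp add: mult_2 power_add)
    then show ?thesis unfolding unbalanced_bound_def by (simp only: of_nat_mult of_nat_numeral mult_ac) simp
  qed
  finally show ?thesis .
qed

lemma card_balanced_pairs_ge:
  fixes l :: real
  assumes C: "finite C" "C \<noteq> {}" and l: "0 \<le> l" "l \<le> 1"
  shows "real (pair_count (card C) N) - unbalanced_bound (card C) N D l \<le> real (card (balanced_pairs N C D))"
proof -
  let ?E = "equal_content (positions N) (positions N) C"
  have "finite ?E" using C by (simp add: finite_equal_content)
  moreover have sub: "balanced_pairs N C D \<subseteq> ?E" by (auto simp: balanced_pairs_def)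
  ultimately have "card ?E = card (?E - balanced_pairs N C D) + card (balanced_pairs N C D)"
    by (metis add.commute card_Diff_subset card_mono finite_subset le_add_diff_inverse)
  moreover have "card ?E = pair_count (card C) N" using C by (simp add: card_equal_content)
  ultimately show ?thesis using card_unbalanced_pairs[OF C l, of N D] by linarith
qed

text \<open>The difference \<open>s c - s d\<close> and the other \<open>k - 2\<close> entries
  determine \<open>s\<close>, because the vanishing sum supplies \<open>s c + s d\<close>. A close
  pair thus costs one degree of freedom.\<close>

lemma card_zero_sum_close_pair:
  assumes C: "finite C" "card C = k" and cd: "c \<in> C" "d \<in> C" "c \<noteq> d" and G: "0 \<le> G"
  shows "real (card {s \<in> zero_sum_box C M. real_of_int \<bar>s c - s d\<bar> \<le> G}) \<le> (2 * G + 1) * (2 * real M + 1) ^ (k - 2)"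
proof -
  let ?T = "{s \<in> zero_sum_box C M. real_of_int \<bar>s c - s d\<bar> \<le> G}"
  let ?C' = "C - {c, d}"
  let ?h = "\<lambda>s. (s c - s d, restrict s ?C')"
  let ?B = "{- \<lfloor>G\<rfloor>..\<lfloor>G\<rfloor>} \<times> (?C' \<rightarrow>\<^sub>E {- int M..int M})"
  have sumC: "sum s C = s c + s d + sum s ?C'" for s :: "'a \<Rightarrow> int"
  proof -
    have "sum s C = sum s ?C' + sum s {c, d}" using C cd by (intro sum.subset_diff) auto
    then show ?thesis using cd by simp
  qed
  have "inj_on ?h ?T"
  proof (rule inj_onI)
    fix s t assume s: "s \<in> ?T" "t \<in> ?T" and e: "?h s = ?h t"
    have o: "s x = t x" if "x \<in> ?C'" for x using e that by (metis Pair_inject restrict_apply')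
    then have "sum s ?C' = sum t ?C'" by (intro sum.cong) auto
    moreover have "sum s C = 0" "sum t C = 0" using s by (auto simp: zero_sum_box_def)
    ultimately have "s c = t c" "s d = t d" using e sumC[of s] sumC[of t] by auto
    then have "s x = t x" if "x \<in> C" for x using o[of x] that by blast
    then show "s = t" using s unfolding zero_sum_box_def by (blast intro: PiE_ext)
  qed
  moreover have "?h ` ?T \<subseteq> ?B"
  proof (rule image_subsetI)
    fix s assume s: "s \<in> ?T"
    have "\<bar>s c - s d\<bar> \<le> \<lfloor>G\<rfloor>" using s by (simp add: le_floor_iff)
    moreover have "restrict s ?C' \<in> ?C' \<rightarrow>\<^sub>E {- int M..int M}"
      unfolding restrict_PiE_iff using s by (auto simp: zero_sum_box_def PiE_iff)
    ultimately show "?h s \<in> ?B" by (simp add: abs_le_iff)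
  qed
  moreover have "finite ?B" using C by (auto intro!: finite_PiE)
  ultimately have "card ?T \<le> card ?B" by (intro card_inj_on_le)
  also have "card ?B = nat (2 * \<lfloor>G\<rfloor> + 1) * (2 * M + 1) ^ (k - 2)"
  proof -
    have "card ?C' = k - 2" using C cd by (simp add: card_Diff_subset)
    then show ?thesis using C by (simp add: card_cartesian_product card_funcsetE algebra_simps nat_add_distrib nat_mult_distrib)
  qed
  finally have "real (card ?T) \<le> real (nat (2 * \<lfloor>G\<rfloor> + 1) * (2 * M + 1) ^ (k - 2))" by (simp only: of_nat_le_iff)
  also have "\<dots> = real_of_int (2 * \<lfloor>G\<rfloor> + 1) * (2 * real M + 1) ^ (k - 2)"
    using G by (simp add: add.commute)
  also have "\<dots> \<le> (2 * G + 1) * (2 * real M + 1) ^ (k - 2)"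
    by (intro mult_right_mono) auto
  finally show ?thesis .
qed

definition gap_vectors :: "'c set \<Rightarrow> nat \<Rightarrow> real \<Rightarrow> ('c \<Rightarrow> int) set" where
  "gap_vectors C M G = {s \<in> zero_sum_box C M. \<forall>c\<in>C. \<forall>d\<in>C. c \<noteq> d \<longrightarrow> G < real_of_int \<bar>s c - s d\<bar>}"

text \<open>Union bound over ordered pairs of distinct colours. For \<open>k <= 1\<close> there are
  none, and the conditional prevents the truncated exponent \<open>k - 2\<close> from producing an
  error as large as the main term.\<close>

lemma card_gap_vectors_ge:
  assumes C: "finite C" "card C = k" and G: "0 \<le> G"
  shows "real (card (zero_sum_box C M)) - real k ^ 2 * ((2 * G + 1) * (if k \<le> 1 then 0 else (2 * real M + 1) ^ (k - 2)))
    \<le> real (card (gap_vectors C M G))"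
proof -
  let ?Z = "zero_sum_box C M"
  define T where "T = (\<lambda>(c, d). {s \<in> ?Z. real_of_int \<bar>s c - s d\<bar> \<le> G})"
  let ?P = "{(c, d). c \<in> C \<and> d \<in> C \<and> c \<noteq> d}"
  have finP: "finite ?P" by (rule finite_subset[of _ "C \<times> C"]) (use C in auto)
  have finZ: "finite ?Z" using C by (simp add: finite_zero_sum_box)
  have "card (\<Union>p\<in>?P. T p) \<le> (\<Sum>p\<in>?P. card (T p))" using finP by (rule card_UN_le)
  then have "real (card (\<Union>p\<in>?P. T p)) \<le> (\<Sum>p\<in>?P. real (card (T p)))"
    unfolding of_nat_sum[symmetric] of_nat_le_iff .
  also have "\<dots> \<le> (\<Sum>p\<in>?P. (2 * G + 1) * (2 * real M + 1) ^ (k - 2))"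
    unfolding T_def using card_zero_sum_close_pair[OF C _ _ _ G] by (intro sum_mono) auto
  also have "\<dots> \<le> real k ^ 2 * ((2 * G + 1) * (if k \<le> 1 then 0 else (2 * real M + 1) ^ (k - 2)))"
  proof (cases "k \<le> 1")
    case True
    then have "\<forall>c\<in>C. \<forall>d\<in>C. c = d" using card_le_Suc0_iff_eq[OF C(1)] C(2) by (metis One_nat_def)
    then have "?P = {}" by blast
    then show ?thesis unfolding \<open>?P = {}\<close> using True by simp
  next
    case False
    have "card ?P \<le> card (C \<times> C)" using C by (intro card_mono) auto
    then have "card ?P \<le> k ^ 2" using C by (simp add: card_cartesian_product power2_eq_square)
    then have "real (card ?P) \<le> real k ^ 2" unfolding of_nat_power[symmetric] of_nat_le_iff .
    then show ?thesis using False G by (simp add: mult_right_mono)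
  qed
  finally have U: "real (card (\<Union>p\<in>?P. T p)) \<le> real k ^ 2 * ((2 * G + 1) * (if k \<le> 1 then 0 else (2 * real M + 1) ^ (k - 2)))" .
  have "?Z = gap_vectors C M G \<union> (\<Union>p\<in>?P. T p)"
    by (auto simp: gap_vectors_def T_def not_less)
  then have "card ?Z \<le> card (gap_vectors C M G) + card (\<Union>p\<in>?P. T p)"
    using card_Un_le[of "gap_vectors C M G" "\<Union>p\<in>?P. T p"] by simp
  then show ?thesis using U by linarith
qed

text \<open>As \<open>G\<close> is nonnegative the entries are distinct, so a gap vector is a
  bijection from \<open>C\<close> onto its set of values, and every gap set is attained by
  \<open>k!\<close> of them.\<close>

lemma card_gap_vectors:
  assumes C: "finite C" "card C = k" and G: "0 \<le> G"
  shows "card (gap_vectors C M G) = fact k * card (gap_sets k M G)"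
proof -
  have inj: "inj_on s C" if "s \<in> gap_vectors C M G" for s
    using that G by (force simp: gap_vectors_def inj_on_def)
  have img: "s ` C \<in> gap_sets k M G" if "s \<in> gap_vectors C M G" for s
    using that C card_image[OF inj[OF that]] sum.reindex[OF inj[OF that], of "\<lambda>x. x"]
    by (auto simp: gap_sets_def gap_vectors_def zero_sum_box_def PiE_iff)
  have "gap_vectors C M G = (\<Union>A\<in>gap_sets k M G. {s \<in> C \<rightarrow>\<^sub>E A. inj_on s C})"
  proof (intro equalityI subsetI)
    fix s assume s: "s \<in> gap_vectors C M G"
    then have "s \<in> C \<rightarrow>\<^sub>E s ` C" by (auto simp: gap_vectors_def zero_sum_box_def PiE_iff)
    then show "s \<in> (\<Union>A\<in>gap_sets k M G. {s \<in> C \<rightarrow>\<^sub>E A. inj_on s C})"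
      using inj[OF s] img[OF s] by blast
  next
    fix s assume "s \<in> (\<Union>A\<in>gap_sets k M G. {s \<in> C \<rightarrow>\<^sub>E A. inj_on s C})"
    then obtain A where A: "A \<in> gap_sets k M G" "s \<in> C \<rightarrow>\<^sub>E A" "inj_on s C" by auto
    have "finite A" by (rule gap_setsD[OF A(1)])
    then have "s ` C = A"
      using A C by (intro card_subset_eq) (auto simp: card_image gap_sets_def)
    then have "sum s C = 0" using sum.reindex[OF A(3), of "\<lambda>x. x"] A(1) by (simp add: gap_sets_def)
    moreover have "s \<in> C \<rightarrow>\<^sub>E {- int M..int M}"
      using PiE_mono[of C "\<lambda>_. A" "\<lambda>_. {- int M..int M}"] A(1,2) by (auto simp: gap_sets_def)
    moreover have "G < real_of_int \<bar>s c - s d\<bar>" if "c \<in> C" "d \<in> C" "c \<noteq> d" for c d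
    proof -
      have "s c \<in> A" "s d \<in> A" "s c \<noteq> s d" using A(2,3) that by (auto dest: inj_onD)
      then show ?thesis using A(1) by (simp add: gap_sets_def)
    qed
    ultimately show "s \<in> gap_vectors C M G"
      by (simp add: gap_vectors_def zero_sum_box_def)
  qed
  also have "card \<dots> = (\<Sum>A\<in>gap_sets k M G. card {s \<in> C \<rightarrow>\<^sub>E A. inj_on s C})"
  proof (rule card_UN_disjoint)
    show "\<forall>A\<in>gap_sets k M G. finite {s \<in> C \<rightarrow>\<^sub>E A. inj_on s C}"
    proof
      fix A assume "A \<in> gap_sets k M G"
      then have "finite A" by (rule gap_setsD)
      then have "finite (C \<rightarrow>\<^sub>E A)" using C by (simp add: finite_PiE)
      then show "finite {s \<in> C \<rightarrow>\<^sub>E A. inj_on s C}" by simp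
    qed
    show "\<forall>A\<in>gap_sets k M G. \<forall>B\<in>gap_sets k M G. A \<noteq> B \<longrightarrow> {s \<in> C \<rightarrow>\<^sub>E A. inj_on s C} \<inter> {s \<in> C \<rightarrow>\<^sub>E B. inj_on s C} = {}"
    proof (intro ballI impI, rule ccontr)
      fix A B assume AB: "A \<in> gap_sets k M G" "B \<in> gap_sets k M G" "A \<noteq> B"
        and "{s \<in> C \<rightarrow>\<^sub>E A. inj_on s C} \<inter> {s \<in> C \<rightarrow>\<^sub>E B. inj_on s C} \<noteq> {}"
      then obtain s where s: "s \<in> C \<rightarrow>\<^sub>E A" "s \<in> C \<rightarrow>\<^sub>E B" "inj_on s C" by auto
      have "finite A" "finite B" "card A = card (s ` C)" "card B = card (s ` C)"
        using gap_setsD[OF AB(1)] gap_setsD[OF AB(2)] C(2) card_image[OF s(3)] by simp_all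
      moreover have "s ` C \<subseteq> A" "s ` C \<subseteq> B" using s by auto
      ultimately have "s ` C = A" "s ` C = B" by (simp_all add: card_subset_eq)
      then show False using AB(3) by simp
    qed
  qed (rule finite_gap_sets)
  also have "\<dots> = (\<Sum>A\<in>gap_sets k M G. fact k)"
  proof (rule sum.cong[OF refl])
    fix A assume A: "A \<in> gap_sets k M G"
    then have "finite A" "card A = k" by (rule gap_setsD)+
    then have "card {s \<in> C \<rightarrow>\<^sub>E A. inj_on s C} = (\<Prod>i\<in>{0..<k}. k - i)"
      using card_inj_on_subset_funcset[of C A C] C by simp
    also have "\<dots> = fact k" by (simp add: fact_prod_rev)
    finally show "card {s \<in> C \<rightarrow>\<^sub>E A. inj_on s C} = fact k" .
  qed
  finally show ?thesis by simp
qed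

section \<open>Balanced colourings: shift against displacement, and the lower bound\<close>

context
  fixes N :: nat
  assumes N_pos: "N > 0"
begin

lemma balanced_count:
  assumes "balanced N C D f" "c \<in> C"
  shows "\<bar>real_of_int (prefix_count f c (int N)) - real N / card C\<bar> \<le> D"
  using assms by (auto simp: balanced_def dest!: bspec[of _ _ c] bspec[of _ _ "int N"])

text \<open>Each whole period between 0 and \<open>i\<close> contributes an error of at most
  \<open>D\<close>, and the incomplete one a further \<open>D\<close>.\<close>

lemma colour_rank_approx:
  assumes "balanced N C D f" "c \<in> C" "card C = k"
  shows "\<bar>real_of_int (colour_rank N f c i) - real_of_int i / k\<bar> \<le> D * (real_of_int \<bar>i div int N\<bar> + 1)"
proof -
  define q r where "q = i div int N" and "r = i mod int N"
  let ?n = "prefix_count f c (int N)"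
  have r: "r \<in> {0..int N}" using N_pos by (simp add: r_def less_imp_le)
  have "i = int N * q + r" by (simp add: q_def r_def)
  then have i: "real_of_int i = real N * q + r" by (metis of_int_add of_int_mult of_int_of_nat_eq)
  have "real_of_int (colour_rank N f c i) - real_of_int i / k = (real_of_int ?n - real N / k) * q + (real_of_int (prefix_count f c r) - r / k)"
    unfolding i by (simp add: colour_rank_def q_def[symmetric] r_def[symmetric] algebra_simps add_divide_distrib)
  also have "\<bar>\<dots>\<bar> \<le> \<bar>real_of_int ?n - real N / k\<bar> * \<bar>q\<bar> + \<bar>real_of_int (prefix_count f c r) - r / k\<bar>"
    by (metis abs_mult abs_triangle_ineq of_int_abs)
  also have "\<dots> \<le> D * \<bar>q\<bar> + D"
    using balanced_count[OF assms(1,2)] assms r by (intro add_mono mult_right_mono) (auto simp: balanced_def)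
  finally show ?thesis by (simp add: q_def distrib_left)
qed

lemma coloured_in_window:
  assumes "(f, g) \<in> balanced_pairs N C D" "i \<in> positions N"
  shows "f i \<in> C" "balanced N C D f" "balanced N C D g" "f (i mod int N) = f i" "0 \<le> D"
proof -
  show 1: "f i \<in> C" "balanced N C D f" "balanced N C D g" "f (i mod int N) = f i"
    using assms by (auto simp: balanced_pairs_def equal_content_def PiE_iff)
  show "0 \<le> D" using balanced_count[OF 1(2,1)] by linarith
qed

lemma bounded_from_window:
  assumes per: "\<And>i. \<sigma> (i + int N) = \<sigma> i + int N"
    and b: "\<And>i. i \<in> positions N \<Longrightarrow> \<bar>\<sigma> i - i\<bar> < int N"
  shows "\<bar>\<sigma> i - i\<bar> < int N"
proof -
  have "\<sigma> (i mod int N + i div int N * int N) = \<sigma> (i mod int N) + i div int N * int N"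
    by (rule periodic_shift[OF N_pos]) (rule per)
  then have "\<sigma> i - i = \<sigma> (i mod int N) - i mod int N" by (simp add: minus_div_mult_eq_mod[symmetric])
  then show ?thesis using b[of "i mod int N"] N_pos by simp
qed

text \<open>A value at \<open>i + N\<close> or beyond would force the shift to be at least the class
  size plus the difference of the two ranks at \<open>i\<close>. These three quantities deviate by
  at most \<open>D\<close> each, hence the margin \<open>3 * D\<close>; the lower side is
  symmetric.\<close>

lemma coloured_bounded:
  assumes fg: "(f, g) \<in> balanced_pairs N C D" and k: "card C = k"
    and col: "coloured_by N \<sigma> f g s" and per: "\<And>i. \<sigma> (i + int N) = \<sigma> i + int N"
    and s: "\<And>c. c \<in> C \<Longrightarrow> real_of_int \<bar>s c\<bar> + 3 * D < real N / k"
  shows "\<bar>\<sigma> i - i\<bar> < int N"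
proof (rule bounded_from_window[of \<sigma>, OF per])
  fix i assume i: "i \<in> positions N"
  note w = coloured_in_window[OF fg i]
  let ?c = "f i"
  have rk: "colour_rank N g ?c (\<sigma> i) = colour_rank N f ?c i + s ?c"
    using col w(4) unfolding coloured_by_def[OF N_pos] by metis
  have idiv: "i div int N = 0" using i by simp
  have f: "\<bar>real_of_int (colour_rank N f ?c i) - real_of_int i / k\<bar> \<le> D"
    and g: "\<bar>real_of_int (colour_rank N g ?c i) - real_of_int i / k\<bar> \<le> D"
    using colour_rank_approx[OF w(2,1) k, of i] colour_rank_approx[OF w(3,1) k, of i] unfolding idiv by simp_all
  have n: "\<bar>real_of_int (prefix_count g ?c (int N)) - real N / k\<bar> \<le> D"
    using balanced_count[OF w(3,1)] k by simp
  have "\<sigma> i < i + int N"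
  proof (rule ccontr)
    assume "\<not> \<sigma> i < i + int N"
    then have "colour_rank N g ?c (i + int N) \<le> colour_rank N g ?c (\<sigma> i)"
      by (intro colour_rank_mono[OF N_pos]) simp
    then have "real_of_int (colour_rank N g ?c i) + real_of_int (prefix_count g ?c (int N)) \<le> real_of_int (colour_rank N f ?c i) + real_of_int (s ?c)"
      unfolding colour_rank_shift[OF N_pos] rk by linarith
    then show False using f g n s[OF w(1)] by linarith
  qed
  moreover have "i - int N < \<sigma> i"
  proof (rule ccontr)
    assume "\<not> i - int N < \<sigma> i"
    then have "colour_rank N g ?c (\<sigma> i + int N) \<le> colour_rank N g ?c i"
      by (intro colour_rank_mono[OF N_pos]) simp
    then have "real_of_int (colour_rank N f ?c i) + real_of_int (s ?c) + real_of_int (prefix_count g ?c (int N)) \<le> real_of_int (colour_rank N g ?c i)"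
      unfolding colour_rank_shift[OF N_pos] rk by linarith
    then show False using f g n s[OF w(1)] by linarith
  qed
  ultimately show "\<bar>\<sigma> i - i\<bar> < int N" by linarith
qed

lemma abs_div_le_one:
  assumes "\<bar>y - i\<bar> < int N" "i \<in> positions N"
  shows "\<bar>y div int N\<bar> \<le> 1"
proof -
  define q where "q = y div int N"
  have "y = int N * q + y mod int N" "0 \<le> y mod int N" "y mod int N < int N"
    using N_pos by (simp_all add: q_def)
  moreover have "- int N \<le> y" "y < 2 * int N" using assms by auto
  ultimately have "int N * q < int N * 2" "int N * (- 2) < int N * q" by linarith+
  then have "q < 2" "- 2 < q" using N_pos by (simp_all only: mult_less_cancel_left_pos of_nat_0_less_iff)
  then show ?thesis by (simp add: q_def)
qed

text \<open>Ranks are close to position divided by \<open>k\<close>. Boundedness puts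
  \<open>\<sigma> i\<close> at most one period away from the window, so its rank has error
  \<open>2 * D\<close>, and the rank of \<open>i\<close> has error \<open>D\<close>.\<close>

lemma coloured_displacement:
  assumes fg: "(f, g) \<in> balanced_pairs N C D" and k: "card C = k"
    and col: "coloured_by N \<sigma> f g s" and b: "\<bar>\<sigma> i - i\<bar> < int N" and i: "i \<in> positions N"
  shows "\<bar>real_of_int (\<sigma> i - i) / k - real_of_int (s (f i))\<bar> \<le> 3 * D"
proof -
  note w = coloured_in_window[OF fg i]
  let ?c = "f i"
  have rk: "colour_rank N g ?c (\<sigma> i) = colour_rank N f ?c i + s ?c"
    using col w(4) unfolding coloured_by_def[OF N_pos] by metis
  have idiv: "i div int N = 0" using i by simp
  have "\<bar>\<sigma> i div int N\<bar> \<le> 1" by (rule abs_div_le_one[OF b i])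
  then have "D * (real_of_int \<bar>\<sigma> i div int N\<bar> + 1) \<le> D * 2" using w(5) by (intro mult_left_mono) auto
  then have "\<bar>real_of_int (colour_rank N g ?c (\<sigma> i)) - real_of_int (\<sigma> i) / k\<bar> \<le> 2 * D"
    using colour_rank_approx[OF w(3,1) k, of "\<sigma> i"] by linarith
  moreover have "\<bar>real_of_int (colour_rank N f ?c i) - real_of_int i / k\<bar> \<le> D"
    using colour_rank_approx[OF w(2,1) k, of i] unfolding idiv by simp
  ultimately show ?thesis unfolding rk of_int_diff diff_divide_distrib by simp
qed

lemma avoidingD:
  assumes "\<sigma> \<in> bounded_avoiding_decreasing N m"
  shows "bij \<sigma>" "\<sigma> (i + int N) = \<sigma> i + int N" "affine_permutation N \<sigma>" "\<bar>\<sigma> i - i\<bar> < int N"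
    "\<not> contains_decreasing m \<sigma>"
  using assms by (auto simp: bounded_avoiding_decreasing_def bounded_affine_permutation_def affine_permutation_def)

text \<open>An element of the gap set is both a colour and its own shift, hence the identity as
  shift function. The hypothesis on \<open>M\<close> makes every colour occur and keeps the
  permutation bounded; the zero sum of \<open>A\<close> makes it affine.\<close>

lemma gap_set_permutation:
  assumes A: "A \<in> gap_sets k M G" and k: "k > 0" and fg: "(f, g) \<in> balanced_pairs N A D"
    and M: "real M + 3 * D < real N / k"
  shows "\<exists>\<sigma>\<in>bounded_avoiding_decreasing N (k + 1). coloured_by N \<sigma> f g (\<lambda>a. a)"
proof -
  note A' = gap_setsD[OF A]
  have ec: "(f, g) \<in> equal_content (positions N) (positions N) A" using fg by (simp add: balanced_pairs_def)
  have fA: "f (i mod int N) \<in> A" for i using ec N_pos by (auto simp: equal_content_def PiE_iff)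
  have D: "0 \<le> D" and bal: "balanced N A D f" using coloured_in_window[OF fg, of 0] N_pos by auto
  obtain \<sigma> where \<sigma>: "coloured_by N \<sigma> f g (\<lambda>a. a)" "bij \<sigma>" "\<And>i. \<sigma> (i + int N) = \<sigma> i + int N"
    using coloured_by_exists[OF N_pos equal_content_prefix_count[OF ec], of "\<lambda>a. a"] by blast
  have small: "real_of_int \<bar>a\<bar> \<le> real M" if "a \<in> A" for a
    using A that by (auto simp: gap_sets_def abs_le_iff)
  have "affine_permutation N \<sigma> \<longleftrightarrow> sum (\<lambda>a. a) A = 0"
  proof (rule affine_of_coloured[OF N_pos \<sigma>(2,3,1) A'(1) fA])
    fix c assume "c \<in> A"
    then have "\<bar>real_of_int (prefix_count f c (int N)) - real N / k\<bar> \<le> D"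
      using balanced_count[OF bal] A'(2) by simp
    then have "real_of_int (prefix_count f c (int N)) > 0" using M D by linarith
    then show "prefix_count f c (int N) > 0 \<or> c = 0" by simp
  qed
  then have "affine_permutation N \<sigma>" using A by (simp add: gap_sets_def)
  moreover have "\<bar>\<sigma> i - i\<bar> < int N" for i
    by (rule coloured_bounded[OF fg A'(2) \<sigma>(1,3)]) (use small M in force)
  moreover have "\<not> contains_decreasing (k + 1) \<sigma>"
    by (rule not_contains_decreasing_coloured[where f = f and \<sigma> = \<sigma>, OF N_pos coloured_by_mono[OF N_pos \<sigma>(1)] fA A'])
  ultimately have "\<sigma> \<in> bounded_avoiding_decreasing N (k + 1)"
    by (simp add: bounded_avoiding_decreasing_def bounded_affine_permutation_def)
  then show ?thesis using \<sigma>(1) by blast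
qed

lemma coloured_by_value_colour:
  assumes "bij \<sigma>" "\<And>i. \<sigma> (i + int N) = \<sigma> i + int N" "coloured_by N \<sigma> f g s" "coloured_by N \<sigma> f g' s'" "y \<in> positions N"
  shows "g y = g' y"
proof -
  have "y \<in> (\<lambda>i. \<sigma> i mod int N) ` positions N"
    using bij_betw_imp_surj_on[OF bij_betw_periodic_mod[OF N_pos assms(1,2)]] assms(5) by simp
  then obtain i where "y = \<sigma> i mod int N" by blast
  then show ?thesis using assms(3,4) unfolding coloured_by_def[OF N_pos] by simp
qed

text \<open>Both labels of a position lie within \<open>3 * D\<close> of its displacement divided by
  \<open>k\<close>. The gap then forces the two colourings to have the same classes, and a class
  determines its label through \<open>shift_eq_sum\<close>.\<close>

lemma gap_set_colouring_unique:
  assumes \<sigma>: "\<sigma> \<in> bounded_avoiding_decreasing N m" and k: "k > 0"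
    and A: "A \<in> gap_sets k M G" "(f, g) \<in> balanced_pairs N A D" "coloured_by N \<sigma> f g (\<lambda>a. a)"
    and A': "A' \<in> gap_sets k M G" "(f', g') \<in> balanced_pairs N A' D" "coloured_by N \<sigma> f' g' (\<lambda>a. a)"
    and G: "12 * D \<le> G" and D: "D < real N / k"
  shows "A = A' \<and> f = f' \<and> g = g'"
proof -
  note s = avoidingD[OF \<sigma>]
  note cA = gap_setsD[OF A(1)] and cA' = gap_setsD[OF A'(1)]
  have near: "\<bar>real_of_int (f i) - real_of_int (f' i)\<bar> \<le> 6 * D" if "i \<in> positions N" for i
    using coloured_displacement[OF A(2) cA(2) A(3) s(4) that] coloured_displacement[OF A'(2) cA'(2) A'(3) s(4) that] by linarith
  \<comment> \<open>Positions with equal \<open>h\<close> have \<open>h'\<close> at most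
    \<open>12 * D\<close> apart, which does not exceed the gap; so their \<open>h'\<close>
    agree.\<close>
  have same: "h' i = h' j"
    if h: "h' i \<in> B" "h' j \<in> B" "h i = h j" and B: "B \<in> gap_sets k M G"
      and "\<bar>real_of_int (h i) - real_of_int (h' i)\<bar> \<le> 6 * D" "\<bar>real_of_int (h j) - real_of_int (h' j)\<bar> \<le> 6 * D"
    for h h' :: "int \<Rightarrow> int" and i j B
  proof (rule ccontr)
    assume "h' i \<noteq> h' j"
    then have "G < real_of_int \<bar>h' i - h' j\<bar>" using B h(1,2) by (simp add: gap_sets_def)
    then show False using that(5,6) h(3) G by linarith
  qed
  have fin: "f i \<in> A" "f' i \<in> A'" if "i \<in> positions N" for i
    using coloured_in_window(1)[OF A(2) that] coloured_in_window(1)[OF A'(2) that] by auto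
  have iff: "f i = f j \<longleftrightarrow> f' i = f' j" if "i \<in> positions N" "j \<in> positions N" for i j
    using same[of f' i A' j f] same[of f i A j f'] near[OF that(1)] near[OF that(2)] fin that A(1) A'(1)
    by (metis abs_minus_commute)
  \<comment> \<open>Since \<open>D < N / k\<close> every colour occurs, so the label, being its own
    shift, is the sum of quotients over its class.\<close>
  have shift: "h c = c"
    if "(f0, g0) \<in> balanced_pairs N B D" "coloured_by N \<sigma> f0 g0 (\<lambda>a. a)" "B \<in> gap_sets k M G"
    "c \<in> B" "h = (\<lambda>c. \<Sum>i | i \<in> positions N \<and> f0 i = c. \<sigma> i div int N)"
    for f0 g0 B c and h :: "int \<Rightarrow> int"
  proof -
    have "\<bar>real_of_int (prefix_count f0 c (int N)) - real N / k\<bar> \<le> D"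
      using balanced_count[of B D f0 c] gap_setsD[OF that(3)] that by (simp add: balanced_pairs_def)
    then have "prefix_count f0 c (int N) > 0" using D by linarith
    from shift_eq_sum[OF N_pos s(1,2) that(2) this] show ?thesis using that(5) by simp
  qed
  have "f i = f' i" if i: "i \<in> positions N" for i
  proof -
    have "f i = (\<Sum>j | j \<in> positions N \<and> f j = f i. \<sigma> j div int N)"
      using shift[OF A(2,3,1) fin(1)[OF i] refl] by simp
    also have "\<dots> = (\<Sum>j | j \<in> positions N \<and> f' j = f' i. \<sigma> j div int N)"
      by (intro sum.cong) (use iff[OF _ i] in auto)
    also have "\<dots> = f' i" using shift[OF A'(2,3,1) fin(2)[OF i] refl] by simp
    finally show ?thesis .
  qed
  moreover have ext: "f \<in> positions N \<rightarrow>\<^sub>E A" "f' \<in> positions N \<rightarrow>\<^sub>E A'" "g \<in> positions N \<rightarrow>\<^sub>E A" "g' \<in> positions N \<rightarrow>\<^sub>E A'"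
    using A(2) A'(2) by (auto simp: balanced_pairs_def equal_content_def)
  ultimately have ff: "f = f'" by (intro extensionalityI[of f "positions N" f']) (auto simp: PiE_iff)
  have img: "f0 ` positions N = B" if "(f0, g0) \<in> balanced_pairs N B D" "B \<in> gap_sets k M G" for f0 g0 B
  proof (intro equalityI subsetI)
    fix c assume "c \<in> B"
    have "\<bar>real_of_int (prefix_count f0 c (int N)) - real N / k\<bar> \<le> D"
      using balanced_count[of B D f0 c] gap_setsD[OF that(2)] that \<open>c \<in> B\<close> by (simp add: balanced_pairs_def)
    then have "prefix_count f0 c (int N) > 0" using D by linarith
    then show "c \<in> f0 ` positions N" unfolding prefix_count_pos_iff by blast
  qed (use coloured_in_window(1)[OF that(1)] in auto)
  have "A = A'" using img[OF A(2,1)] img[OF A'(2,1)] ff by simp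
  moreover have "g = g'"
    using coloured_by_value_colour[OF s(1,2) A(3) A'(3)[folded ff]] ext
    by (intro extensionalityI[of g "positions N" g']) (auto simp: PiE_iff)
  ultimately show ?thesis using ff by simp
qed

text \<open>By uniqueness, triples of a gap set and a balanced pair coloured by it embed into the
  permutations, and the number of balanced pairs has a lower bound uniform in the gap set.\<close>

lemma card_bounded_avoiding_ge:
  fixes l :: real
  assumes k: "k > 0" and M: "real M + 3 * D < real N / k" and G: "12 * D \<le> G" and D: "0 \<le> D" and l: "0 \<le> l" "l \<le> 1"
  shows "real (card (gap_sets k M G)) * (real (pair_count k N) - unbalanced_bound k N D l)
    \<le> real (card (bounded_avoiding_decreasing N (k + 1)))"
proof -
  let ?X = "SIGMA A:gap_sets k M G. balanced_pairs N A D"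
  have "\<exists>\<sigma>. \<sigma> \<in> bounded_avoiding_decreasing N (k + 1) \<and> coloured_by N \<sigma> (fst (snd x)) (snd (snd x)) (\<lambda>a. a)" if "x \<in> ?X" for x
    using gap_set_permutation[of "fst x" k M G "fst (snd x)" "snd (snd x)" D] k M that by (auto simp: Bex_def)
  then obtain \<Psi> where \<Psi>: "\<And>x. x \<in> ?X \<Longrightarrow> \<Psi> x \<in> bounded_avoiding_decreasing N (k + 1)"
    "\<And>x. x \<in> ?X \<Longrightarrow> coloured_by N (\<Psi> x) (fst (snd x)) (snd (snd x)) (\<lambda>a. a)" by metis
  have "inj_on \<Psi> ?X"
  proof (rule inj_onI)
    fix x y assume xy: "x \<in> ?X" "y \<in> ?X" and e: "\<Psi> x = \<Psi> y"
    have "fst x = fst y \<and> fst (snd x) = fst (snd y) \<and> snd (snd x) = snd (snd y)"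
      by (rule gap_set_colouring_unique[OF \<Psi>(1)[OF xy(1)] k _ _ \<Psi>(2)[OF xy(1)] _ _ \<Psi>(2)[OF xy(2), folded e] G])
        (use xy M D in auto)
    then show "x = y" by (simp add: prod_eq_iff)
  qed
  then have "card ?X \<le> card (bounded_avoiding_decreasing N (k + 1))"
    using \<Psi>(1) by (intro card_inj_on_le[of \<Psi>] finite_bounded_avoiding_decreasing N_pos) auto
  moreover have "card ?X = (\<Sum>A\<in>gap_sets k M G. card (balanced_pairs N A D))"
  proof (rule card_SigmaI[OF finite_gap_sets], rule ballI)
    fix A assume "A \<in> gap_sets k M G"
    then show "finite (balanced_pairs N A D)"
      by (intro finite_subset[of "balanced_pairs N A D" "equal_content (positions N) (positions N) A"] finite_equal_content)
        (auto simp: balanced_pairs_def dest: gap_setsD)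
  qed
  moreover have "real (card (gap_sets k M G)) * (real (pair_count k N) - unbalanced_bound k N D l)
      \<le> (\<Sum>A\<in>gap_sets k M G. real (card (balanced_pairs N A D)))"
  proof -
    have "real (pair_count k N) - unbalanced_bound k N D l \<le> real (card (balanced_pairs N A D))" if "A \<in> gap_sets k M G" for A
      using card_balanced_pairs_ge[of A l N D] gap_setsD[OF that] l k by force
    then show ?thesis using sum_bounded_below[of "gap_sets k M G" _ "\<lambda>A. real (card (balanced_pairs N A D))"] by blast
  qed
  ultimately show ?thesis by (simp flip: of_nat_sum) 
qed

end

section \<open>The upper bound\<close>

context
  fixes N :: nat
  assumes N_pos: "N > 0"
begin

text \<open>The crude radius \<open>N\<close> for shifts holds since a shift is a sum of at most
  \<open>N\<close> quotients from {-1, 0, 1}; it serves the unbalanced colourings, whose rarity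
  absorbs any power of \<open>N\<close>. Colours that do not occur receive the empty sum 0.\<close>

lemma increasing_colouring:
  assumes \<sigma>: "\<sigma> \<in> bounded_avoiding_decreasing N (k + 1)"
  defines "C \<equiv> {1..int k}"
  shows "\<exists>f g s. (f, g) \<in> equal_content (positions N) (positions N) C \<and> s \<in> C \<rightarrow>\<^sub>E {- int N..int N} \<and>
    sum s C = 0 \<and> coloured_by N \<sigma> f g s"
proof -
  note \<sigma>' = avoidingD[OF N_pos \<sigma>]
  obtain f where f: "f \<in> positions N \<rightarrow>\<^sub>E C" "\<And>i j. f (i mod int N) = f (j mod int N) \<Longrightarrow> i < j \<Longrightarrow> \<sigma> i < \<sigma> j"
    using increasing_colouring_exists[OF N_pos bij_is_inj[OF \<sigma>'(1)] \<sigma>'(5,2)] unfolding C_def by blast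
  define g where "g = restrict (\<lambda>y. f (inv \<sigma> y mod int N)) (positions N)"
  define s where "s = restrict (\<lambda>c. \<Sum>i | i \<in> positions N \<and> f i = c. \<sigma> i div int N) C"
  have fC: "f (i mod int N) \<in> C" for i using f(1) N_pos by (auto simp: PiE_iff)
  have com: "coloured_by N \<sigma> f g s"
    by (rule coloured_by_of_increasing[OF N_pos \<sigma>'(3) f(2)]) (use f(1) in \<open>auto simp: g_def s_def PiE_iff\<close>)
  then have col: "\<And>i. g (\<sigma> i mod int N) = f (i mod int N)" by (simp add: coloured_by_def[OF N_pos])
  have "g \<in> positions N \<rightarrow>\<^sub>E C" unfolding g_def restrict_PiE_iff using fC by simp
  moreover have "prefix_count f c (int N) = prefix_count g c (int N)" for c
    by (rule prefix_count_eq_of_coloured[of N \<sigma> g f, OF N_pos \<sigma>'(1,2) col, symmetric])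
  ultimately have "(f, g) \<in> equal_content (positions N) (positions N) C"
    using f(1) by (simp add: equal_content_iff_prefix_count)
  moreover have "s \<in> C \<rightarrow>\<^sub>E {- int N..int N}"
    unfolding s_def restrict_PiE_iff
  proof
    fix c assume "c \<in> C"
    have fin: "finite {i. i \<in> positions N \<and> f i = c}" by (rule finite_subset[of _ "positions N"]) auto
    have d: "\<bar>\<sigma> i div int N\<bar> \<le> 1" if "i \<in> positions N" for i
      by (rule abs_div_le_one[OF N_pos \<sigma>'(4) that])
    have "\<bar>\<Sum>i | i \<in> positions N \<and> f i = c. \<sigma> i div int N\<bar> \<le> (\<Sum>i | i \<in> positions N \<and> f i = c. \<bar>\<sigma> i div int N\<bar>)"
      by (rule sum_abs)
    also have "\<dots> \<le> (\<Sum>i | i \<in> positions N \<and> f i = c. 1)" using d by (intro sum_mono) auto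
    also have "\<dots> \<le> (\<Sum>i\<in>positions N. 1)" by (intro sum_mono2) auto
    finally show "(\<Sum>i | i \<in> positions N \<and> f i = c. \<sigma> i div int N) \<in> {- int N..int N}" by auto
  qed
  moreover have "sum s C = 0"
  proof -
    have "affine_permutation N \<sigma> \<longleftrightarrow> sum s C = 0"
    proof (rule affine_of_coloured[OF N_pos \<sigma>'(1,2) com _ fC])
      fix c assume c: "c \<in> C"
      show "prefix_count f c (int N) > 0 \<or> s c = 0"
      proof (cases "prefix_count f c (int N) > 0")
        case False
        then have e: "{i. i \<in> positions N \<and> f i = c} = {}" using prefix_count_pos_iff[of f c "int N"] by auto
        show ?thesis using c unfolding s_def restrict_apply' [OF c] e by simp
      qed simp
    qed (simp add: C_def)
    then show ?thesis using \<sigma>'(3) by simp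
  qed
  ultimately show ?thesis using com by blast
qed

text \<open>Every colour occurs because \<open>D < N / k\<close>; comparing the shift with the
  displacement of one point of the chain, which is below \<open>N\<close>, gives the bound.\<close>

lemma shift_bound:
  assumes fg: "(f, g) \<in> balanced_pairs N C D" and k: "card C = k" and D: "D < real N / k"
    and com: "coloured_by N \<sigma> f g s" and b: "\<And>i. \<bar>\<sigma> i - i\<bar> < int N" and c: "c \<in> C"
  shows "real_of_int \<bar>s c\<bar> \<le> real N / k + 3 * D"
proof -
  have "\<bar>real_of_int (prefix_count f c (int N)) - real N / k\<bar> \<le> D"
    using balanced_count[OF N_pos, of C D f c] fg k c by (simp add: balanced_pairs_def)
  then have "prefix_count f c (int N) > 0" using D by linarith
  then obtain i where i: "i \<in> positions N" "f i = c" unfolding prefix_count_pos_iff by blast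
  have "\<bar>real_of_int (\<sigma> i - i) / k - real_of_int (s c)\<bar> \<le> 3 * D"
    using coloured_displacement[OF N_pos fg k com b i(1)] i(2) by simp
  moreover have "\<bar>real_of_int (\<sigma> i - i) / k\<bar> \<le> real N / k"
  proof -
    have "\<bar>real_of_int (\<sigma> i - i)\<bar> \<le> real N" using b[of i] by linarith
    then show ?thesis by (simp add: abs_divide divide_right_mono)
  qed
  ultimately show ?thesis by linarith
qed

text \<open>Renaming colours by the injective map \<open>s\<close> leaves all prefix counts and
  ranks unchanged, and each new colour is its own shift.\<close>

lemma recolour_by_shift:
  assumes s: "s \<in> gap_vectors C M G" and G: "0 \<le> G" and C: "finite C" "card C = k"
    and fg: "(f, g) \<in> balanced_pairs N C D" and com: "coloured_by N \<sigma> f g s"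
  shows "\<exists>A\<in>gap_sets k M G. \<exists>f' g'. (f', g') \<in> balanced_pairs N A D \<and> coloured_by N \<sigma> f' g' (\<lambda>a. a)"
proof -
  have inj: "inj_on s C"
    using s G by (force simp: gap_vectors_def inj_on_def)
  define re where "re h = restrict (\<lambda>i. s (h i)) (positions N)" for h :: "int \<Rightarrow> 'a"
  have W: "f \<in> positions N \<rightarrow>\<^sub>E C" "g \<in> positions N \<rightarrow>\<^sub>E C" "balanced N C D f" "balanced N C D g"
    "\<And>c. c \<in> C \<Longrightarrow> prefix_count f c (int N) = prefix_count g c (int N)"
    using fg by (auto simp: balanced_pairs_def equal_content_iff_prefix_count)
  have pc: "prefix_count (re h) (s c) m = prefix_count h c m"
    if "h \<in> positions N \<rightarrow>\<^sub>E C" "c \<in> C" "m \<le> int N" for h c m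
  proof -
    have "{j \<in> {0..<m}. re h j = s c} = {j \<in> {0..<m}. h j = c}"
      using that inj by (auto simp: re_def PiE_iff dest: inj_onD)
    then show ?thesis by (simp add: prefix_count_def)
  qed
  have rk: "colour_rank N (re h) (s c) i = colour_rank N h c i"
    if "h \<in> positions N \<rightarrow>\<^sub>E C" "c \<in> C" for h c i
    using pc[OF that, of "int N"] pc[OF that, of "i mod int N"] N_pos
    by (simp add: colour_rank_def less_imp_le)
  have cardA: "card (s ` C) = card C" by (rule card_image[OF inj])
  have A: "s ` C \<in> gap_sets k M G"
    using s C cardA sum.reindex[OF inj, of "\<lambda>x. x"]
    by (auto simp: gap_sets_def gap_vectors_def zero_sum_box_def PiE_iff)
  have bal: "balanced N (s ` C) D (re h)" if "h \<in> positions N \<rightarrow>\<^sub>E C" "balanced N C D h" for h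
    using that(2) pc[OF that(1)] unfolding balanced_def cardA by auto
  have "(re f, re g) \<in> balanced_pairs N (s ` C) D"
    unfolding balanced_pairs_def equal_content_iff_prefix_count
    using W bal[OF W(1,3)] bal[OF W(2,4)] pc[OF W(1)] pc[OF W(2)]
    by (auto simp: re_def PiE_iff)
  moreover have "coloured_by N \<sigma> (re f) (re g) (\<lambda>a. a)"
    unfolding coloured_by_def[OF N_pos]
  proof
    fix i
    have w: "i mod int N \<in> positions N" "\<sigma> i mod int N \<in> positions N" using N_pos by auto
    then have fc: "f (i mod int N) \<in> C" using W(1) by auto
    have re: "re f (i mod int N) = s (f (i mod int N))" "re g (\<sigma> i mod int N) = s (g (\<sigma> i mod int N))"
      using w by (simp_all add: re_def)
    show "re g (\<sigma> i mod int N) = re f (i mod int N) \<and>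
      colour_rank N (re g) (re f (i mod int N)) (\<sigma> i) = colour_rank N (re f) (re f (i mod int N)) i + re f (i mod int N)"
      using com unfolding re rk[OF W(1) fc] rk[OF W(2) fc] coloured_by_def[OF N_pos] by metis
  qed
  ultimately show ?thesis using A by blast
qed

text \<open>One colouring is chosen per permutation and determines it. Unbalanced colourings
  (\<open>S1\<close>) are paired with the crude box of radius \<open>N\<close>. Balanced ones whose
  shifts are not gap vectors (\<open>S2\<close>) still have shifts in the box of radius
  \<open>M'\<close>, and \<open>fact k * card (gap_sets k M G)\<close> counts the gap vectors
  removed from it. The rest (\<open>S3\<close>) are recoloured by shifts, so that sets are counted
  in place of vectors; this produces the factor 1/k!.\<close>

lemma card_bounded_avoiding_le:
  fixes l :: real
  assumes k: "k > 0" and D: "0 \<le> D" "D < real N / k" and G: "0 \<le> G" and l: "0 \<le> l" "l \<le> 1"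
    and M: "M \<le> M'" "real N / k + 3 * D \<le> real M'"
  shows "real (card (bounded_avoiding_decreasing N (k + 1)))
    \<le> real (card (gap_sets k M G)) * real (pair_count k N) + unbalanced_bound k N D l * (2 * real N + 1) ^ k
      + real (pair_count k N) * (real (card (zero_sum_box {1..int k} M')) - fact k * real (card (gap_sets k M G)))"
proof -
  let ?S = "bounded_avoiding_decreasing N (k + 1)"
  let ?C = "{1..int k}"
  let ?E = "equal_content (positions N) (positions N) ?C"
  let ?B = "balanced_pairs N ?C D"
  let ?G = "gap_vectors ?C M G" and ?Z = "zero_sum_box ?C M'"
  have C: "finite ?C" "?C \<noteq> {}" "card ?C = k" using k by auto
  have finS: "finite ?S" by (rule finite_bounded_avoiding_decreasing[OF N_pos])
  have "\<exists>f g s. (f, g) \<in> ?E \<and> s \<in> ?C \<rightarrow>\<^sub>E {- int N..int N} \<and> sum s ?C = 0 \<and> coloured_by N \<sigma> f g s" if "\<sigma> \<in> ?S" for \<sigma>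
    using increasing_colouring[OF that] by simp
  then obtain F H T where FHT: "\<And>\<sigma>. \<sigma> \<in> ?S \<Longrightarrow> (F \<sigma>, H \<sigma>) \<in> ?E \<and> T \<sigma> \<in> ?C \<rightarrow>\<^sub>E {- int N..int N} \<and> sum (T \<sigma>) ?C = 0 \<and> coloured_by N \<sigma> (F \<sigma>) (H \<sigma>) (T \<sigma>)"
    by metis
  define S1 where "S1 = {\<sigma> \<in> ?S. (F \<sigma>, H \<sigma>) \<notin> ?B}"
  define S2 where "S2 = {\<sigma> \<in> ?S. (F \<sigma>, H \<sigma>) \<in> ?B \<and> T \<sigma> \<notin> ?G}"
  define S3 where "S3 = {\<sigma> \<in> ?S. (F \<sigma>, H \<sigma>) \<in> ?B \<and> T \<sigma> \<in> ?G}"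
  let ?h = "\<lambda>\<sigma>. ((F \<sigma>, H \<sigma>), T \<sigma>)"
  have inj: "inj_on ?h ?S"
  proof (rule inj_onI)
    fix \<sigma> \<tau> assume "\<sigma> \<in> ?S" "\<tau> \<in> ?S" "?h \<sigma> = ?h \<tau>"
    then show "\<sigma> = \<tau>" using FHT[of \<sigma>] FHT[of \<tau>] coloured_by_unique[OF N_pos, of \<sigma> "F \<sigma>" "H \<sigma>" "T \<sigma>" \<tau>] by simp
  qed
  have finE: "finite ?E" by (rule finite_equal_content) auto
  have finZ: "finite ?Z" by (rule finite_zero_sum_box) auto
  have GZ: "?G \<subseteq> ?Z"
  proof
    fix s assume "s \<in> ?G"
    then have s: "s \<in> ?C \<rightarrow>\<^sub>E {- int M..int M}" "sum s ?C = 0" by (auto simp: gap_vectors_def zero_sum_box_def)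
    have "s \<in> ?C \<rightarrow>\<^sub>E {- int M'..int M'}" using s(1) M(1) PiE_mono[of ?C "\<lambda>_. {- int M..int M}" "\<lambda>_. {- int M'..int M'}"] by auto
    then show "s \<in> ?Z" using s(2) by (simp add: zero_sum_box_def)
  qed
  have "card S1 \<le> card ((?E - ?B) \<times> (?C \<rightarrow>\<^sub>E {- int N..int N}))"
  proof (rule card_inj_on_le[of ?h])
    show "inj_on ?h S1" by (rule inj_on_subset[OF inj]) (auto simp: S1_def)
    show "?h ` S1 \<subseteq> (?E - ?B) \<times> (?C \<rightarrow>\<^sub>E {- int N..int N})"
    proof (rule image_subsetI)
      fix \<sigma> assume "\<sigma> \<in> S1"
      then show "?h \<sigma> \<in> (?E - ?B) \<times> (?C \<rightarrow>\<^sub>E {- int N..int N})" using FHT[of \<sigma>] by (simp add: S1_def)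
    qed
    show "finite ((?E - ?B) \<times> (?C \<rightarrow>\<^sub>E {- int N..int N}))" using finE by (auto intro!: finite_PiE)
  qed
  also have "\<dots> = card (?E - ?B) * (2 * N + 1) ^ k"
    using C by (simp add: card_cartesian_product card_funcsetE nat_add_distrib nat_mult_distrib)
  finally have "real (card S1) \<le> real (card (?E - ?B)) * (2 * real N + 1) ^ k"
    unfolding of_nat_le_iff[symmetric, where 'a = real] by (simp add: add.commute)
  also have "\<dots> \<le> unbalanced_bound k N D l * (2 * real N + 1) ^ k"
    using card_unbalanced_pairs[OF C(1,2) l, of N D] C(3) by (intro mult_right_mono) auto
  finally have 1: "real (card S1) \<le> unbalanced_bound k N D l * (2 * real N + 1) ^ k" .
  have "card S2 \<le> card (?E \<times> (?Z - ?G))"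
  proof (rule card_inj_on_le[of ?h])
    show "inj_on ?h S2" by (rule inj_on_subset[OF inj]) (auto simp: S2_def)
    show "?h ` S2 \<subseteq> ?E \<times> (?Z - ?G)"
    proof (rule image_subsetI)
      fix \<sigma> assume \<sigma>: "\<sigma> \<in> S2"
      then have S: "\<sigma> \<in> ?S" and B: "(F \<sigma>, H \<sigma>) \<in> ?B" and G: "T \<sigma> \<notin> ?G" by (auto simp: S2_def)
      have "\<bar>T \<sigma> c\<bar> \<le> int M'" if "c \<in> ?C" for c
      proof -
        have "real_of_int \<bar>T \<sigma> c\<bar> \<le> real N / k + 3 * D"
          using FHT[OF S] avoidingD(4)[OF N_pos S] D that by (intro shift_bound[OF B C(3)]) auto
        then show ?thesis using M(2) by linarith
      qed
      then have "T \<sigma> \<in> ?C \<rightarrow>\<^sub>E {- int M'..int M'}" using FHT[OF S] by (force simp: PiE_iff abs_le_iff)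
      then show "?h \<sigma> \<in> ?E \<times> (?Z - ?G)" using FHT[OF S] G by (simp add: zero_sum_box_def)
    qed
    show "finite (?E \<times> (?Z - ?G))" using finE finZ by auto
  qed
  also have "\<dots> = pair_count k N * card (?Z - ?G)" by (simp add: card_cartesian_product card_equal_content)
  finally have "real (card S2) \<le> real (pair_count k N) * real (card (?Z - ?G))"
    unfolding of_nat_mult[symmetric] of_nat_le_iff .
  also have "real (card (?Z - ?G)) = real (card ?Z) - fact k * real (card (gap_sets k M G))"
  proof -
    have "card ?G = fact k * card (gap_sets k M G)" by (rule card_gap_vectors[OF C(1,3) G])
    moreover have "card (?Z - ?G) = card ?Z - card ?G" "card ?G \<le> card ?Z"
      using GZ finZ by (auto intro: card_Diff_subset card_mono finite_subset)
    ultimately show ?thesis by (simp add: of_nat_diff)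
  qed
  finally have 2: "real (card S2) \<le> real (pair_count k N) * (real (card ?Z) - fact k * real (card (gap_sets k M G)))" .
  have "\<exists>A f g. A \<in> gap_sets k M G \<and> (f, g) \<in> balanced_pairs N A D \<and> coloured_by N \<sigma> f g (\<lambda>a. a)" if "\<sigma> \<in> S3" for \<sigma>
    using recolour_by_shift[OF _ G C(1,3), of "T \<sigma>" M "F \<sigma>" "H \<sigma>" D \<sigma>] FHT[of \<sigma>] that by (auto simp: S3_def)
  then obtain A f g where Afg: "\<And>\<sigma>. \<sigma> \<in> S3 \<Longrightarrow> A \<sigma> \<in> gap_sets k M G \<and> (f \<sigma>, g \<sigma>) \<in> balanced_pairs N (A \<sigma>) D \<and> coloured_by N \<sigma> (f \<sigma>) (g \<sigma>) (\<lambda>a. a)"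
    by metis
  let ?X = "SIGMA A:gap_sets k M G. balanced_pairs N A D"
  have finB: "finite (balanced_pairs N A D)" if "A \<in> gap_sets k M G" for A
    using gap_setsD(1)[OF that]
    by (intro finite_subset[of "balanced_pairs N A D" "equal_content (positions N) (positions N) A"] finite_equal_content)
      (auto simp: balanced_pairs_def)
  have "card S3 \<le> card ?X"
  proof (rule card_inj_on_le[of "\<lambda>\<sigma>. (A \<sigma>, (f \<sigma>, g \<sigma>))"])
    show "inj_on (\<lambda>\<sigma>. (A \<sigma>, (f \<sigma>, g \<sigma>))) S3"
    proof (rule inj_onI)
      fix \<sigma> \<tau> assume "\<sigma> \<in> S3" "\<tau> \<in> S3" "(A \<sigma>, (f \<sigma>, g \<sigma>)) = (A \<tau>, (f \<tau>, g \<tau>))"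
      then show "\<sigma> = \<tau>" using Afg[of \<sigma>] Afg[of \<tau>] coloured_by_unique[OF N_pos, of \<sigma> "f \<sigma>" "g \<sigma>" "\<lambda>a. a" \<tau>] by simp
    qed
    show "(\<lambda>\<sigma>. (A \<sigma>, (f \<sigma>, g \<sigma>))) ` S3 \<subseteq> ?X" using Afg by auto
    show "finite ?X" using finB by (intro finite_SigmaI finite_gap_sets)
  qed
  also have "card ?X = (\<Sum>A\<in>gap_sets k M G. card (balanced_pairs N A D))"
    using finB by (intro card_SigmaI finite_gap_sets) auto
  also have "\<dots> \<le> (\<Sum>A\<in>gap_sets k M G. pair_count k N)"
  proof (rule sum_mono)
    fix A assume "A \<in> gap_sets k M G"
    then show "card (balanced_pairs N A D) \<le> pair_count k N"
      using card_balanced_pairs_le[of A N D] gap_setsD[of A k M G] by simp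
  qed
  also have "\<dots> = card (gap_sets k M G) * pair_count k N" by simp
  finally have 3: "real (card S3) \<le> real (card (gap_sets k M G)) * real (pair_count k N)"
    unfolding of_nat_mult[symmetric] of_nat_le_iff .
  have "?S = S1 \<union> S2 \<union> S3" by (auto simp: S1_def S2_def S3_def)
  then have "card ?S \<le> card S1 + card S2 + card S3"
    using card_Un_le[of "S1 \<union> S2" S3] card_Un_le[of S1 S2] by simp
  then show ?thesis using 1 2 3 by linarith
qed

end

section \<open>The asymptotic count\<close>

text \<open>Vectors with a close pair number O((G + 1) N^(k-2)), which is negligible against N^(k-1)
  as G is o(N). So the gap vectors have the same asymptotics as the whole box.\<close>

lemma card_gap_sets_asymp:
  fixes M :: "nat \<Rightarrow> nat" and G :: "nat \<Rightarrow> real"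
  assumes k: "k > 0" and c: "c > 0" and M: "(\<lambda>N. real (M N) / real N) \<longlonglongrightarrow> c"
    and G: "(\<lambda>N. G N / real N) \<longlonglongrightarrow> 0" "\<And>N. 0 \<le> G N"
  shows "(\<lambda>N. real (card (zero_sum_box {1..int k} (M N))) / real N ^ (k - 1)) \<longlonglongrightarrow> Z_star k * c ^ (k - 1)"
    and "(\<lambda>N. fact k * real (card (gap_sets k (M N) (G N))) / real N ^ (k - 1)) \<longlonglongrightarrow> Z_star k * c ^ (k - 1)"
proof -
  let ?C = "{1..int k}"
  have C: "finite ?C" "card ?C = k" by simp_all
  have inf: "filterlim M at_top sequentially" by (rule filterlim_at_top_of_ratio[OF M c])
  show box: "(\<lambda>N. real (card (zero_sum_box ?C (M N))) / real N ^ (k - 1)) \<longlonglongrightarrow> Z_star k * c ^ (k - 1)"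
  proof (rule Lim_transform_eventually)
    show "(\<lambda>N. real (card (zero_sum_box ?C (M N))) / real (M N) ^ (k - 1) * (real (M N) / real N) ^ (k - 1)) \<longlonglongrightarrow> Z_star k * c ^ (k - 1)"
      by (intro tendsto_mult tendsto_power M filterlim_compose[OF card_zero_sum_box_asymp[OF C k] inf])
    have "eventually (\<lambda>N. M N > 0) sequentially"
      using inf[unfolded filterlim_at_top, rule_format, of 1] by (rule eventually_mono) simp
    then show "eventually (\<lambda>N. real (card (zero_sum_box ?C (M N))) / real (M N) ^ (k - 1) * (real (M N) / real N) ^ (k - 1)
        = real (card (zero_sum_box ?C (M N))) / real N ^ (k - 1)) sequentially"
      by eventually_elim (simp add: power_divide)
  qed
  define err where "err N = real k ^ 2 * ((2 * G N + 1) * (if k \<le> 1 then 0 else (2 * real (M N) + 1) ^ (k - 2)))" for N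
  have err: "(\<lambda>N. err N / real N ^ (k - 1)) \<longlonglongrightarrow> 0"
  proof (cases "k \<le> 1")
    case True
    then show ?thesis by (simp add: err_def)
  next
    case False
    then have pow: "real N ^ (k - 1) = real N * real N ^ (k - 2)" for N
      by (simp add: power_Suc[symmetric] Suc_diff_Suc numeral_2_eq_2 del: power_Suc)
    have one: "(\<lambda>N. 1 / real N) \<longlonglongrightarrow> 0" by real_asymp
    have "(\<lambda>N. real k ^ 2 * ((2 * (G N / real N) + 1 / real N) * (2 * (real (M N) / real N) + 1 / real N) ^ (k - 2)))
        \<longlonglongrightarrow> real k ^ 2 * ((2 * 0 + 0) * (2 * c + 0) ^ (k - 2))"
      by (intro tendsto_intros M G(1) one)
    moreover have "real k ^ 2 * ((2 * (G N / real N) + 1 / real N) * (2 * (real (M N) / real N) + 1 / real N) ^ (k - 2)) = err N / real N ^ (k - 1)" for N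
      using False by (simp add: err_def pow[unfolded One_nat_def] add_divide_distrib[symmetric] power_divide)
    ultimately show ?thesis by simp
  qed
  have ge: "real (card (zero_sum_box ?C (M N))) - err N \<le> fact k * real (card (gap_sets k (M N) (G N)))" for N
    using card_gap_vectors_ge[OF C G(2), of "M N" N] card_gap_vectors[OF C G(2), of "M N" N] by (simp add: err_def)
  have le: "fact k * real (card (gap_sets k (M N) (G N))) \<le> real (card (zero_sum_box ?C (M N)))" for N
  proof -
    have "card (gap_vectors ?C (M N) (G N)) \<le> card (zero_sum_box ?C (M N))"
      by (intro card_mono finite_zero_sum_box C) (auto simp: gap_vectors_def)
    then have "real (fact k * card (gap_sets k (M N) (G N))) \<le> real (card (zero_sum_box ?C (M N)))"
      unfolding card_gap_vectors[OF C G(2)] of_nat_le_iff .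
    then show ?thesis by simp
  qed
  show "(\<lambda>N. fact k * real (card (gap_sets k (M N) (G N))) / real N ^ (k - 1)) \<longlonglongrightarrow> Z_star k * c ^ (k - 1)"
  proof (rule tendsto_sandwich[OF _ _ _ box])
    show "(\<lambda>N. real (card (zero_sum_box ?C (M N))) / real N ^ (k - 1) - err N / real N ^ (k - 1)) \<longlonglongrightarrow> Z_star k * c ^ (k - 1)"
      using tendsto_diff[OF box err] by simp
    show "eventually (\<lambda>N. real (card (zero_sum_box ?C (M N))) / real N ^ (k - 1) - err N / real N ^ (k - 1)
        \<le> fact k * real (card (gap_sets k (M N) (G N))) / real N ^ (k - 1)) sequentially"
      using ge by (intro always_eventually allI) (simp add: divide_right_mono flip: diff_divide_distrib)
    show "eventually (\<lambda>N. fact k * real (card (gap_sets k (M N) (G N))) / real N ^ (k - 1)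
        \<le> real (card (zero_sum_box ?C (M N))) / real N ^ (k - 1)) sequentially"
      using le by (intro always_eventually allI divide_right_mono) auto
  qed
qed

theorem theorem2p2:
  fixes k :: nat
  assumes "k \<ge> 1"
  shows "(\<lambda>N. real (card (bounded_avoiding_decreasing N (k + 1))) /
            (real k ^ (2 * N) * (real N / (4 * pi)) powr ((real k - 1) / 2) *
              (Z_star k / (real k powr (real k / 2) * fact (k - 1)))))
         \<longlonglongrightarrow> 1"
proof -
  define \<kappa> where "\<kappa> = real k"
  have \<kappa>: "\<kappa> \<ge> 1" using assms by (simp add: \<kappa>_def)
  define h where "h = (\<kappa> - 1) / 2"
  have h: "h \<ge> 0" using \<kappa> by (simp add: h_def)
  define D where "D N = real N powr (2/3)" for N :: nat
  define l where "l N = real N powr (-1/2)" for N :: nat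
  \<comment> \<open>The lower bound requires \<open>M N + 3 * D N < N / k\<close>; the coefficient 4
    leaves room for the strict inequality. The companion \<open>M'\<close> is the radius that
    \<open>shift_bound\<close> guarantees in the upper bound.\<close>
  define M where "M N = nat \<lfloor>real N / \<kappa> - 4 * D N\<rfloor>" for N
  define M' where "M' N = nat \<lceil>real N / \<kappa> + 3 * D N\<rceil>" for N
  define a where "a N = real (card (gap_sets k (M N) (12 * D N)))" for N
  define L where "L N = real (card (zero_sum_box {1..int k} (M' N)))" for N
  define P where "P N = real (pair_count k N)" for N
  define U where "U N = unbalanced_bound k N (D N) (l N)" for N
  define X where "X N = real (card (bounded_avoiding_decreasing N (k + 1)))" for N
  \<comment> \<open>The order of the count: N^(k-1) shift vectors times k^(2N) N^(-h) pairs of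
    words, where k - 1 = 2 h.\<close>
  define W where "W N = \<kappa> ^ (2 * N) * real N powr h" for N
  have D0: "0 \<le> D N" for N by (simp add: D_def)
  have pos_M: "eventually (\<lambda>N. 0 < real N / \<kappa> - 4 * D N) sequentially"
    unfolding D_def using \<kappa> by real_asymp
  have M_bounds: "real (M N) \<le> real N / \<kappa> - 4 * D N" "real N / \<kappa> - 4 * D N - 1 \<le> real (M N)"
    if "0 < real N / \<kappa> - 4 * D N" for N
    using that by (simp_all add: M_def)
  have M'_bounds: "real N / \<kappa> + 3 * D N \<le> real (M' N)" "real (M' N) \<le> real N / \<kappa> + 3 * D N + 1" for N
  proof -
    have "0 \<le> real N / \<kappa> + 3 * D N" using D0[of N] \<kappa> by simp
    then show "real N / \<kappa> + 3 * D N \<le> real (M' N)" "real (M' N) \<le> real N / \<kappa> + 3 * D N + 1"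
      unfolding M'_def by linarith+
  qed
  have M_lim: "(\<lambda>N. real (M N) / real N) \<longlonglongrightarrow> 1 / \<kappa>"
  proof (rule tendsto_sandwich)
    show "(\<lambda>N. (real N / \<kappa> - 4 * D N - 1) / real N) \<longlonglongrightarrow> 1 / \<kappa>" unfolding D_def using \<kappa> by (real_asymp simp: inverse_eq_divide)
    show "(\<lambda>N. (real N / \<kappa> - 4 * D N) / real N) \<longlonglongrightarrow> 1 / \<kappa>" unfolding D_def using \<kappa> by (real_asymp simp: inverse_eq_divide)
    show "eventually (\<lambda>N. (real N / \<kappa> - 4 * D N - 1) / real N \<le> real (M N) / real N) sequentially"
      using pos_M by eventually_elim (intro divide_right_mono M_bounds, auto)
    show "eventually (\<lambda>N. real (M N) / real N \<le> (real N / \<kappa> - 4 * D N) / real N) sequentially"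
      using pos_M by eventually_elim (intro divide_right_mono M_bounds, auto)
  qed
  have M'_lim: "(\<lambda>N. real (M' N) / real N) \<longlonglongrightarrow> 1 / \<kappa>"
  proof (rule tendsto_sandwich)
    show "(\<lambda>N. (real N / \<kappa> + 3 * D N) / real N) \<longlonglongrightarrow> 1 / \<kappa>" unfolding D_def using \<kappa> by (real_asymp simp: inverse_eq_divide)
    show "(\<lambda>N. (real N / \<kappa> + 3 * D N + 1) / real N) \<longlonglongrightarrow> 1 / \<kappa>" unfolding D_def using \<kappa> by (real_asymp simp: inverse_eq_divide)
  qed (intro always_eventually allI divide_right_mono M'_bounds; simp)+
  define Zk where "Zk = Z_star k * (1 / \<kappa>) ^ (k - 1)"
  have G_lim: "(\<lambda>N. 12 * D N / real N) \<longlonglongrightarrow> 0" unfolding D_def by real_asymp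
  have k0: "k > 0" and ik: "1 / \<kappa> > 0" using assms \<kappa> by auto
  have a_lim: "(\<lambda>N. fact k * a N / real N ^ (k - 1)) \<longlonglongrightarrow> Zk"
    unfolding a_def Zk_def by (rule card_gap_sets_asymp(2)[OF k0 ik M_lim G_lim]) (simp add: D0)
  have L_lim: "(\<lambda>N. L N / real N ^ (k - 1)) \<longlonglongrightarrow> Zk"
    unfolding L_def Zk_def by (rule card_gap_sets_asymp(1)[OF k0 ik M'_lim G_lim]) (simp add: D0)
  define c where "c = \<kappa> powr (\<kappa> / 2) / (4 * pi) powr h"
  have P_lim: "(\<lambda>N. P N / \<kappa> ^ (2 * N) * real N powr h) \<longlonglongrightarrow> c"
    using pair_count_asymp[OF assms] unfolding P_def c_def h_def \<kappa>_def .
  have hh: "real N powr h * real N powr h = real N ^ (k - 1)" if "N > 0" for N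
  proof -
    have "real N powr h * real N powr h = real N powr (real (k - 1))"
      using assms by (simp add: powr_add[symmetric] h_def \<kappa>_def of_nat_diff)
    then show ?thesis using that by (simp add: powr_realpow)
  qed
  have scale: "x * y / W N = x / real N ^ (k - 1) * (y / \<kappa> ^ (2 * N) * real N powr h)" if "N > 0" for x y and N
    using hh[OF that, symmetric] that by (simp add: W_def)
  have lD: "(l N)\<^sup>2 * real N = 1" "l N * D N = real N powr (1/6)" if "N > 0" for N
    using powr_minus_half_square[OF that] unfolding l_def D_def powr_add[symmetric] by simp_all
  have U_eq: "U N / \<kappa> ^ (2 * N) = 4 * \<kappa> * (real N + 1) * exp (1 - real N powr (1/6))" if "N > 0" for N
    using \<kappa> lD[OF that] by (simp add: U_def unbalanced_bound_def \<kappa>_def)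
  have U_lim: "(\<lambda>N. U N / \<kappa> ^ (2 * N) * real N powr h) \<longlonglongrightarrow> 0"
  proof (rule Lim_transform_eventually)
    show "(\<lambda>N. 4 * \<kappa> * (real N + 1) * exp (1 - real N powr (1/6)) * real N powr h) \<longlonglongrightarrow> 0"
      using \<kappa> h by real_asymp
    show "eventually (\<lambda>N. 4 * \<kappa> * (real N + 1) * exp (1 - real N powr (1/6)) * real N powr h = U N / \<kappa> ^ (2 * N) * real N powr h) sequentially"
      using eventually_gt_at_top[of 0] by eventually_elim (simp add: U_eq)
  qed
  have U_lim': "(\<lambda>N. U N * (2 * real N + 1) ^ k / W N) \<longlonglongrightarrow> 0"
  proof (rule Lim_transform_eventually)
    show "(\<lambda>N. 4 * \<kappa> * (real N + 1) * exp (1 - real N powr (1/6)) * (2 * real N + 1) ^ k / real N powr h) \<longlonglongrightarrow> 0"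
      using \<kappa> h by real_asymp
    show "eventually (\<lambda>N. 4 * \<kappa> * (real N + 1) * exp (1 - real N powr (1/6)) * (2 * real N + 1) ^ k / real N powr h = U N * (2 * real N + 1) ^ k / W N) sequentially"
      using eventually_gt_at_top[of 0] by eventually_elim (simp add: U_eq[symmetric] W_def)
  qed
  have a_lim': "(\<lambda>N. a N / real N ^ (k - 1)) \<longlonglongrightarrow> Zk / fact k"
    using tendsto_divide[OF a_lim tendsto_const[of "fact k"]] by simp
  \<comment> \<open>Both bounds share the main term \<open>a N * P N\<close>. The \<open>U\<close>
    terms vanish, and the last term of the upper bound does too, because \<open>L N\<close> and
    \<open>fact k * a N\<close> have the same limit after normalisation.\<close>
  have X_lim: "(\<lambda>N. X N / W N) \<longlonglongrightarrow> Zk / fact k * c"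
  proof (rule tendsto_sandwich)
    show "(\<lambda>N. a N / real N ^ (k - 1) * (P N / \<kappa> ^ (2 * N) * real N powr h - U N / \<kappa> ^ (2 * N) * real N powr h)) \<longlonglongrightarrow> Zk / fact k * c"
      using tendsto_mult[OF a_lim' tendsto_diff[OF P_lim U_lim]] by simp
    show "(\<lambda>N. a N / real N ^ (k - 1) * (P N / \<kappa> ^ (2 * N) * real N powr h) + U N * (2 * real N + 1) ^ k / W N
      + (L N / real N ^ (k - 1) - fact k * a N / real N ^ (k - 1)) * (P N / \<kappa> ^ (2 * N) * real N powr h)) \<longlonglongrightarrow> Zk / fact k * c"
      using tendsto_add[OF tendsto_add[OF tendsto_mult[OF a_lim' P_lim] U_lim'] tendsto_mult[OF tendsto_diff[OF L_lim a_lim] P_lim]] by simp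
    have l: "0 \<le> l N" "l N \<le> 1" if "N > 0" for N
      using that powr_mono[of "-1/2" 0 "real N"] by (simp_all add: l_def)
    show "eventually (\<lambda>N. a N / real N ^ (k - 1) * (P N / \<kappa> ^ (2 * N) * real N powr h - U N / \<kappa> ^ (2 * N) * real N powr h) \<le> X N / W N) sequentially"
      using eventually_gt_at_top[of 0] pos_M
    proof eventually_elim
      case (elim N)
      have "D N > 0" using elim(1) by (simp add: D_def)
      then have "a N * (P N - U N) \<le> X N"
        unfolding a_def P_def U_def X_def using M_bounds(1)[OF elim(2)] D0[of N] l[OF elim(1)] k0
        by (intro card_bounded_avoiding_ge[OF elim(1)]) (simp_all add: \<kappa>_def)
      then have "a N * (P N - U N) / W N \<le> X N / W N" by (intro divide_right_mono) (simp_all add: W_def)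
      then show ?case unfolding scale[OF elim(1)] by (simp only: diff_divide_distrib left_diff_distrib)
    qed
    show "eventually (\<lambda>N. X N / W N \<le> a N / real N ^ (k - 1) * (P N / \<kappa> ^ (2 * N) * real N powr h) + U N * (2 * real N + 1) ^ k / W N
      + (L N / real N ^ (k - 1) - fact k * a N / real N ^ (k - 1)) * (P N / \<kappa> ^ (2 * N) * real N powr h)) sequentially"
      using eventually_gt_at_top[of 0] pos_M
    proof eventually_elim
      case (elim N)
      have "real (M N) \<le> real (M' N)" "D N < real N / \<kappa>"
        using M_bounds(1)[OF elim(2)] M'_bounds(1)[of N] D0[of N] elim(2) by linarith+
      then have "X N \<le> a N * P N + U N * (2 * real N + 1) ^ k + P N * (L N - fact k * a N)"
        unfolding a_def P_def U_def X_def L_def using M'_bounds(1)[of N] D0[of N] l[OF elim(1)] k0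
        by (intro card_bounded_avoiding_le[OF elim(1)]) (simp_all add: \<kappa>_def)
      then have "X N / W N \<le> (a N * P N + U N * (2 * real N + 1) ^ k + P N * (L N - fact k * a N)) / W N"
        by (intro divide_right_mono) (simp_all add: W_def)
      also have "\<dots> = a N * P N / W N + U N * (2 * real N + 1) ^ k / W N + (L N - fact k * a N) * P N / W N"
        by (simp only: add_divide_distrib mult.commute)
      finally show ?case unfolding scale[OF elim(1), of _ "P N"] by (simp only: diff_divide_distrib)
    qed
  qed
  define K where "K = Z_star k / ((4 * pi) powr h * (\<kappa> powr (\<kappa> / 2) * fact (k - 1)))"
  have K: "Zk / fact k * c = K"
  proof -
    \<comment> \<open>The factor k^(k/2) from the pairs moves to the denominator: since k^(k-1) k! =
      k^k (k-1)!, dividing it by this leaves 1 / (k^(k/2) (k-1)!).\<close>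
    have kk: "\<kappa> powr (\<kappa> / 2) * \<kappa> powr (\<kappa> / 2) = \<kappa> ^ (k - 1) * \<kappa>"
    proof -
      have "\<kappa> powr (\<kappa> / 2) * \<kappa> powr (\<kappa> / 2) = \<kappa> powr (real k)" by (simp add: powr_add[symmetric] \<kappa>_def)
      also have "\<dots> = \<kappa> ^ k" using \<kappa> by (simp add: powr_realpow)
      also have "\<dots> = \<kappa> ^ (k - 1) * \<kappa>" using k0 by (simp add: power_eq_if)
      finally show ?thesis .
    qed
    have f: "fact k = \<kappa> * (fact (k - 1) :: real)" using k0 by (simp add: \<kappa>_def fact_reduce)
    have nz: "\<kappa> powr (\<kappa> / 2) > 0" "(4 * pi) powr h > 0" "\<kappa> ^ (k - 1) > 0" "\<kappa> > 0" using \<kappa> by simp_all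
    have "Zk / fact k * c = Z_star k * \<kappa> powr (\<kappa> / 2) / (\<kappa> ^ (k - 1) * \<kappa> * fact (k - 1) * (4 * pi) powr h)"
      unfolding Zk_def f c_def by (simp add: power_divide)
    also have "\<dots> = K"
      unfolding kk[symmetric] K_def using nz by (simp add: field_simps)
    finally show ?thesis .
  qed
  have "K > 0" using Z_star_pos[OF k0] \<kappa> by (simp add: K_def)
  then have "(\<lambda>N. X N / W N / K) \<longlonglongrightarrow> 1"
    using tendsto_divide[OF X_lim[unfolded K] tendsto_const[of K]] by simp
  moreover have "X N / W N / K = X N / (real k ^ (2 * N) * (real N / (4 * pi)) powr ((real k - 1) / 2) *
              (Z_star k / (real k powr (real k / 2) * fact (k - 1))))" for N
    by (simp add: W_def K_def powr_divide flip: \<kappa>_def h_def)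
  ultimately show ?thesis unfolding X_def by simp
qed

end
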